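(* Let $X$ and $Y$ be anisotropic quasilinear $p$-hypersurfaces over $F$. If there exists an integer $n \geq 1$ such that $\dim(Y) \leq p^n - 2 < \dim(X)$, then there are no rational morphisms $X \dashrightarrow Y$.
   Context: $p$ is a prime and $F$ is a non-perfect field of characteristic $p$. Rational morphisms are over the base field and need not be dominant. A quasilinear $p$-form over $F$ is a map $\varphi\colon V_\varphi \to F$ on a finite-dimensional $F$-vector space $V_\varphi$ with $\varphi(\lambda v)=\lambda^p\varphi(v)$ and $\varphi(v+w)=\varphi(v)+\varphi(w)$ for all $\lambda\in F$, $v,w\in V_\varphi$ (in coordinates, $a_1x_1^p+\dots+a_nx_n^p$). It is isotropic if $\varphi(v)=0$ for some $v\ne 0$, and anisotropic otherwise. For a quasilinear $p$-form $\varphi$ over $F$ with $\dim V_\varphi=d+2\ge 2$, $X_\varphi=\{\varphi=0\}\subset\mathbb{P}(V_\varphi)$ is the associated projective hypersurface, of dimension $d$; schemes of this type are called quasilinear $p$-hypersurfaces. $X_\varphi$ is called anisotropic if $\varphi$ is; in that case it is integral. *)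

theory Defs
  imports
    "HOL-Computational_Algebra.Primes"
    "HOL-Library.Poly_Mapping"
    "HOL-Analysis.Abstract_Topology"
    "HOL-Algebra.QuotRing"
begin

section \<open>Ringed spaces over a field and rational morphisms\<close>

text \<open>
  The data of a space with a sheaf of \<open>F\<close>-algebras. For open \<open>V \<subseteq> U\<close>, \<open>sections X U\<close> is the ring
  of sections over \<open>U\<close>, \<open>res_map X U V\<close> is restriction from \<open>U\<close> to \<open>V\<close>, and \<open>struct_map X U\<close> is
  the structure map from \<open>F\<close> to the sections over \<open>U\<close>. Only values at open sets matter.
\<close>

record ('f, 'x, 's) ringed_space =
  points :: "'x topology"
  sections :: "'x set \<Rightarrow> 's ring"
  res_map :: "'x set \<Rightarrow> 'x set \<Rightarrow> 's \<Rightarrow> 's"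
  struct_map :: "'x set \<Rightarrow> 'f \<Rightarrow> 's"

definition open_subspace ::
    "('f, 'x, 's) ringed_space \<Rightarrow> 'x set \<Rightarrow> ('f, 'x, 's) ringed_space" where
  "open_subspace X U = X\<lparr>points := subtopology (points X) U\<rparr>"

text \<open>
  The germ at \<open>x\<close> of a section \<open>s\<close> over \<open>V\<close> is a unit of the stalk, i.e. of the direct limit of the
  rings of sections over the neighbourhoods of \<open>x\<close>, if and only if \<open>s\<close> becomes a unit on some
  neighbourhood of \<open>x\<close>. This allows locality of a morphism to be expressed without stalks.
\<close>

definition germ_unit :: "('f, 'x, 's) ringed_space \<Rightarrow> 'x set \<Rightarrow> 's \<Rightarrow> 'x \<Rightarrow> bool" where
  "germ_unit X V s x \<longleftrightarrow>
     (\<exists>V'. openin (points X) V' \<and> x \<in> V' \<and> V' \<subseteq> V \<and>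
           res_map X V V' s \<in> Units (sections X V'))"

definition preimage :: "('f, 'x, 's) ringed_space \<Rightarrow> ('x \<Rightarrow> 'y) \<Rightarrow> 'y set \<Rightarrow> 'x set" where
  "preimage X g V = {x \<in> topspace (points X). g x \<in> V}"

text \<open>
  A morphism of locally ringed spaces over \<open>F\<close>: a continuous map \<open>g\<close> and \<open>F\<close>-algebra homomorphisms
  \<open>\<gamma> V\<close> from the sections of \<open>Y\<close> over \<open>V\<close> to the sections of \<open>X\<close> over the preimage of \<open>V\<close>,
  compatible with restriction and inducing local homomorphisms on the stalks (a germ whose image
  is a unit is itself a unit).
\<close>

definition lrs_morphism ::
    "('f, 'x, 's) ringed_space \<Rightarrow> ('f, 'y, 't) ringed_space \<Rightarrow>
     ('x \<Rightarrow> 'y) \<Rightarrow> ('y set \<Rightarrow> 't \<Rightarrow> 's) \<Rightarrow> bool" where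
  "lrs_morphism X Y g \<gamma> \<longleftrightarrow>
     continuous_map (points X) (points Y) g \<and>
     (\<forall>V. openin (points Y) V \<longrightarrow>
        \<gamma> V \<in> ring_hom (sections Y V) (sections X (preimage X g V)) \<and>
        (\<forall>c. \<gamma> V (struct_map Y V c) = struct_map X (preimage X g V) c) \<and>
        (\<forall>V'. openin (points Y) V' \<and> V' \<subseteq> V \<longrightarrow>
           (\<forall>s \<in> carrier (sections Y V).
              \<gamma> V' (res_map Y V V' s) =
                res_map X (preimage X g V) (preimage X g V') (\<gamma> V s))) \<and>
        (\<forall>x \<in> preimage X g V. \<forall>s \<in> carrier (sections Y V).
           germ_unit X (preimage X g V) (\<gamma> V s) x \<longrightarrow> germ_unit Y V s (g x)))"

definition dense_open :: "('f, 'x, 's) ringed_space \<Rightarrow> 'x set \<Rightarrow> bool" where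
  "dense_open X U \<longleftrightarrow>
     openin (points X) U \<and> (points X) closure_of U = topspace (points X)"

text \<open>
  A rational morphism is an equivalence class of morphisms \<open>(g, \<gamma>)\<close> defined on dense open subsets
  \<open>U\<close>, two being identified if they agree on a smaller dense open subset. (For a non-reduced source
  one would ask for schematic density.) There is no dominance requirement.
\<close>

definition partial_morphisms ::
    "('f, 'x, 's) ringed_space \<Rightarrow> ('f, 'y, 't) ringed_space \<Rightarrow>
     ('x set \<times> ('x \<Rightarrow> 'y) \<times> ('y set \<Rightarrow> 't \<Rightarrow> 's)) set" where
  "partial_morphisms X Y =
     {(U, g, \<gamma>). dense_open X U \<and> lrs_morphism (open_subspace X U) Y g \<gamma>}"

definition agree_on ::
    "('f, 'x, 's) ringed_space \<Rightarrow> ('f, 'y, 't) ringed_space \<Rightarrow> 'x set \<Rightarrow>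
     ('x set \<times> ('x \<Rightarrow> 'y) \<times> ('y set \<Rightarrow> 't \<Rightarrow> 's)) \<Rightarrow>
     ('x set \<times> ('x \<Rightarrow> 'y) \<times> ('y set \<Rightarrow> 't \<Rightarrow> 's)) \<Rightarrow> bool" where
  "agree_on X Y W = (\<lambda>(U, g, \<gamma>) (U', g', \<gamma>').
     W \<subseteq> U \<inter> U' \<and> (\<forall>x \<in> W. g x = g' x) \<and>
     (\<forall>V. openin (points Y) V \<longrightarrow> (\<forall>s \<in> carrier (sections Y V).
        res_map X (preimage (open_subspace X U) g V)
                  (preimage (open_subspace X W) g V) (\<gamma> V s) =
        res_map X (preimage (open_subspace X U') g' V)
                  (preimage (open_subspace X W) g' V) (\<gamma>' V s))))"

definition same_rational ::
    "('f, 'x, 's) ringed_space \<Rightarrow> ('f, 'y, 't) ringed_space \<Rightarrow>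
     ('x set \<times> ('x \<Rightarrow> 'y) \<times> ('y set \<Rightarrow> 't \<Rightarrow> 's)) rel" where
  "same_rational X Y =
     {(f, f'). f \<in> partial_morphisms X Y \<and> f' \<in> partial_morphisms X Y \<and>
               (\<exists>W. dense_open X W \<and> agree_on X Y W f f')}"

definition rational_morphisms ::
    "('f, 'x, 's) ringed_space \<Rightarrow> ('f, 'y, 't) ringed_space \<Rightarrow>
     ('x set \<times> ('x \<Rightarrow> 'y) \<times> ('y set \<Rightarrow> 't \<Rightarrow> 's)) set set" where
  "rational_morphisms X Y = partial_morphisms X Y // same_rational X Y"


section \<open>Proj of a graded algebra\<close>

text \<open>
  Throughout, \<open>S\<close> is a commutative ring graded by the additive subgroups \<open>Gr d\<close>, and \<open>\<iota>\<close> is a ring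
  homomorphism from \<open>F\<close> to the degree-zero part of \<open>S\<close>.
\<close>

definition homog :: "(nat \<Rightarrow> 'a set) \<Rightarrow> 'a set" where
  "homog Gr = (\<Union>d. Gr d)"

definition proj_points :: "'a ring \<Rightarrow> (nat \<Rightarrow> 'a set) \<Rightarrow> 'a set set" where
  "proj_points S Gr =
     {\<pp>. primeideal \<pp> S \<and> \<pp> = genideal S (\<pp> \<inter> homog Gr) \<and> \<not> (\<Union>d\<in>{0<..}. Gr d) \<subseteq> \<pp>}"

text \<open>The standard open sets of homogeneous elements (of any degree) are a base of the Zariski topology.\<close>

definition proj_topology :: "'a ring \<Rightarrow> (nat \<Rightarrow> 'a set) \<Rightarrow> 'a set topology" where
  "proj_topology S Gr =
     topology_generated_by {{\<pp> \<in> proj_points S Gr. h \<notin> \<pp>} | h. h \<in> homog Gr}"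

text \<open>
  The degree-zero part of the localization of \<open>S\<close> at the homogeneous elements outside \<open>\<pp>\<close>. Its
  elements are equivalence classes of pairs of homogeneous elements of equal degree;
  \<open>hfrac S Gr \<pp> a b\<close> is the class of the fraction \<open>a / b\<close>.
\<close>

definition hfrac :: "'a ring \<Rightarrow> (nat \<Rightarrow> 'a set) \<Rightarrow> 'a set \<Rightarrow> 'a \<Rightarrow> 'a \<Rightarrow> ('a \<times> 'a) set" where
  "hfrac S Gr \<pp> a b =
     {(c, e). (\<exists>d. c \<in> Gr d \<and> e \<in> Gr d) \<and> e \<notin> \<pp> \<and>
              (\<exists>t \<in> homog Gr - \<pp>. t \<otimes>\<^bsub>S\<^esub> (a \<otimes>\<^bsub>S\<^esub> e) = t \<otimes>\<^bsub>S\<^esub> (c \<otimes>\<^bsub>S\<^esub> b))}"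

definition hloc :: "'a ring \<Rightarrow> (nat \<Rightarrow> 'a set) \<Rightarrow> 'a set \<Rightarrow> ('a \<times> 'a) set ring" where
  "hloc S Gr \<pp> =
     \<lparr>carrier = {hfrac S Gr \<pp> a b | a b d. a \<in> Gr d \<and> b \<in> Gr d \<and> b \<notin> \<pp>},
      mult = (\<lambda>A B. \<Union>(a, b)\<in>A. \<Union>(c, e)\<in>B. hfrac S Gr \<pp> (a \<otimes>\<^bsub>S\<^esub> c) (b \<otimes>\<^bsub>S\<^esub> e)),
      one = hfrac S Gr \<pp> \<one>\<^bsub>S\<^esub> \<one>\<^bsub>S\<^esub>,
      zero = hfrac S Gr \<pp> \<zero>\<^bsub>S\<^esub> \<one>\<^bsub>S\<^esub>,
      add = (\<lambda>A B. \<Union>(a, b)\<in>A. \<Union>(c, e)\<in>B.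
               hfrac S Gr \<pp> ((a \<otimes>\<^bsub>S\<^esub> e) \<oplus>\<^bsub>S\<^esub> (c \<otimes>\<^bsub>S\<^esub> b)) (b \<otimes>\<^bsub>S\<^esub> e))\<rparr>"

text \<open>
  The structure sheaf: sections over \<open>U\<close> are the functions sending each point of \<open>U\<close> to an element
  of its local ring which are locally given by a single fraction.
\<close>

definition proj_sections ::
    "'a ring \<Rightarrow> (nat \<Rightarrow> 'a set) \<Rightarrow> 'a set set \<Rightarrow> ('a set \<Rightarrow> ('a \<times> 'a) set) ring" where
  "proj_sections S Gr U =
     \<lparr>carrier =
        {s \<in> (\<Pi>\<^sub>E \<pp>\<in>U. carrier (hloc S Gr \<pp>)).
           \<forall>\<pp>\<in>U. \<exists>V a b d. openin (proj_topology S Gr) V \<and> \<pp> \<in> V \<and> V \<subseteq> U \<and>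
             a \<in> Gr d \<and> b \<in> Gr d \<and> (\<forall>\<qq>\<in>V. b \<notin> \<qq> \<and> s \<qq> = hfrac S Gr \<qq> a b)},
      mult = (\<lambda>s t. \<lambda>\<pp>\<in>U. s \<pp> \<otimes>\<^bsub>hloc S Gr \<pp>\<^esub> t \<pp>),
      one = (\<lambda>\<pp>\<in>U. \<one>\<^bsub>hloc S Gr \<pp>\<^esub>),
      zero = (\<lambda>\<pp>\<in>U. \<zero>\<^bsub>hloc S Gr \<pp>\<^esub>),
      add = (\<lambda>s t. \<lambda>\<pp>\<in>U. s \<pp> \<oplus>\<^bsub>hloc S Gr \<pp>\<^esub> t \<pp>)\<rparr>"

definition Proj ::
    "'a ring \<Rightarrow> (nat \<Rightarrow> 'a set) \<Rightarrow> ('f \<Rightarrow> 'a) \<Rightarrow>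
     ('f, 'a set, 'a set \<Rightarrow> ('a \<times> 'a) set) ringed_space" where
  "Proj S Gr \<iota> =
     \<lparr>points = proj_topology S Gr,
      sections = proj_sections S Gr,
      res_map = (\<lambda>U V s. restrict s V),
      struct_map = (\<lambda>U c. \<lambda>\<pp>\<in>U. hfrac S Gr \<pp> (\<iota> c) \<one>\<^bsub>S\<^esub>)\<rparr>"


section \<open>Quasilinear p-hypersurfaces\<close>

definition quasilinear_form ::
    "nat \<Rightarrow> ('f::field \<Rightarrow> 'v::ab_group_add \<Rightarrow> 'v) \<Rightarrow> ('v \<Rightarrow> 'f) \<Rightarrow> bool" where
  "quasilinear_form p scale \<phi> \<longleftrightarrow>
     (\<forall>c v. \<phi> (scale c v) = c ^ p * \<phi> v) \<and> (\<forall>v w. \<phi> (v + w) = \<phi> v + \<phi> w)"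

definition isotropic :: "('v::ab_group_add \<Rightarrow> 'f::field) \<Rightarrow> bool" where
  "isotropic \<phi> \<longleftrightarrow> (\<exists>v. v \<noteq> 0 \<and> \<phi> v = 0)"

abbreviation anisotropic :: "('v::ab_group_add \<Rightarrow> 'f::field) \<Rightarrow> bool" where
  "anisotropic \<phi> \<equiv> \<not> isotropic \<phi>"

text \<open>
  Polynomials over \<open>F\<close> with one variable \<open>x\<^sub>b\<close> for each element \<open>b\<close> of a basis \<open>B\<close> of \<open>V\<close>; the
  variable \<open>x\<^sub>b\<close> is the coordinate function dual to \<open>b\<close>, so this is the symmetric algebra of the
  dual of \<open>V\<close>.
\<close>

type_synonym ('v, 'f) mpoly = "('v \<Rightarrow>\<^sub>0 nat) \<Rightarrow>\<^sub>0 'f"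

definition poly_ring :: "'v set \<Rightarrow> ('v, 'f::field) mpoly ring" where
  "poly_ring B =
     \<lparr>carrier = {f. \<forall>m \<in> Poly_Mapping.keys f. Poly_Mapping.keys m \<subseteq> B},
      mult = (*), one = 1, zero = 0, add = (+)\<rparr>"

definition homog_polys :: "'v set \<Rightarrow> nat \<Rightarrow> ('v, 'f::field) mpoly set" where
  "homog_polys B d =
     {f \<in> carrier (poly_ring B).
        \<forall>m \<in> Poly_Mapping.keys f. (\<Sum>b\<in>Poly_Mapping.keys m. Poly_Mapping.lookup m b) = d}"

definition const_poly :: "'f::field \<Rightarrow> ('v, 'f) mpoly" where
  "const_poly c = Poly_Mapping.single 0 c"

text \<open>
  The form \<open>\<phi>\<close> in coordinates: by additivity and homogeneity, the value of \<open>\<phi>\<close> at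
  \<open>\<Sum>b\<in>B. x\<^sub>b b\<close> is \<open>\<Sum>b\<in>B. \<phi>(b) x\<^sub>b ^ p\<close>.
\<close>

definition form_poly :: "nat \<Rightarrow> 'v set \<Rightarrow> ('v \<Rightarrow> 'f::field) \<Rightarrow> ('v, 'f) mpoly" where
  "form_poly p B \<phi> = (\<Sum>b\<in>B. Poly_Mapping.single (Poly_Mapping.single b p) (\<phi> b))"

definition form_ideal :: "nat \<Rightarrow> 'v set \<Rightarrow> ('v \<Rightarrow> 'f::field) \<Rightarrow> ('v, 'f) mpoly set" where
  "form_ideal p B \<phi> = genideal (poly_ring B) {form_poly p B \<phi>}"

text \<open>
  The hypersurface \<open>{\<phi> = 0}\<close> in \<open>\<P>(V)\<close>, as the scheme \<open>Proj\<close> of the homogeneous coordinate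
  ring \<open>F[x\<^sub>b | b \<in> B] / (\<phi>)\<close> over \<open>F\<close>. Elements of this ring are cosets of polynomials. Changing
  the basis \<open>B\<close> changes the result by a canonical isomorphism.
\<close>

definition quasilinear_hypersurface ::
    "nat \<Rightarrow> 'v set \<Rightarrow> ('v \<Rightarrow> 'f::field) \<Rightarrow>
     ('f, ('v, 'f) mpoly set set,
      ('v, 'f) mpoly set set \<Rightarrow> (('v, 'f) mpoly set \<times> ('v, 'f) mpoly set) set) ringed_space" where
  "quasilinear_hypersurface p B \<phi> =
     (let P = poly_ring B; I = form_ideal p B \<phi> in
      Proj (P Quot I) (\<lambda>d. (\<lambda>f. I +>\<^bsub>P\<^esub> f) ` homog_polys B d) (\<lambda>c. I +>\<^bsub>P\<^esub> const_poly c))"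

end

theory Submission
  imports Defs
    "HOL-Algebra.Embedded_Algebras"
    "HOL-Computational_Algebra.Polynomial_Factorial"
begin

text \<open>
  Let \<open>k = F ^ p\<close> and normalise the coefficients \<open>e\<^sub>b\<close> of \<open>\<phi>\<close> so that one of them is \<open>1\<close>; anisotropy
  of \<open>\<phi>\<close> and \<open>\<psi>\<close> means that their coefficients are linearly independent over \<open>k\<close>. By Frobenius the
  function field of \<open>X\<close> becomes \<open>k1 = k(X) (\<alpha>)\<close> inside \<open>F(X)\<close>, where \<open>\<alpha> = \<Sum> e\<^sub>b X\<^sub>b\<close>, and a rational
  morphism to \<open>Y\<close>, evaluated at the generic point, makes the coefficients \<open>w\<close> of \<open>\<psi>\<close> linearly
  dependent over \<open>k1\<close>.

  Let \<open>A'\<close> be the \<open>k1\<close>-span of the \<open>e\<^sub>b\<close>, let \<open>D = d/d\<alpha>\<close> on \<open>k1\<close> and let \<open>\<partial>\<^sub>b\<close> be the partial derivatives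
  of \<open>F(X)\<close>. Applying \<open>\<partial>\<^sub>b\<close> to a relation \<open>\<Sum> c\<^sub>j w\<^sub>j = 0\<close> over \<open>k1\<close> shows that \<open>v = \<Sum> D(c\<^sub>j) w\<^sub>j\<close>
  multiplies \<open>A'\<close> into the \<open>k1\<close>-span of the \<open>w\<^sub>j\<close>. For a suitable relation \<open>v\<close> is nonzero, hence
  \<open>dim A' < dim \<psi> \<le> p ^ n\<close>. Applied to the relations among the \<open>e\<^sub>b\<close> themselves the same computation
  produces elements \<open>v\<close> of the stabilizer field \<open>N = {x. x A' \<subseteq> A'}\<close>, whose degree over \<open>k1\<close> is a power
  of \<open>p\<close> dividing \<open>dim A'\<close>. If two successive derivatives of a relation are relations, then \<open>A'\<close> is closed
  under multiplication, so \<open>A' = N\<close> and \<open>dim \<phi> \<le> p dim N\<close>; otherwise \<open>c \<mapsto> v\<close> is injective and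
  \<open>dim \<phi> \<le> dim A' + dim N\<close>. In both cases \<open>dim \<phi> \<le> p ^ n\<close>.
\<close>

section \<open>Linear algebra over a subfield\<close>

text \<open>Frobenius linearises the problem. Send a constant \<open>c\<close> to
  \<open>c ^ p\<close> and rename \<open>x\<^sub>b ^ p\<close> as \<open>X\<^sub>b\<close>; the
  equation of \<open>X\<close> turns the eliminated variable into \<alpha>, and the equation of
  \<open>Y\<close> at the generic point becomes
  \<open>\<Sum> w\<^sub>j ^ p z\<^sub>j ^ p = 0\<close> with \<open>z\<^sub>j\<close> in
  \<open>k1\<close>, the p-th power of a linear relation. The obstacle is that
  \<open>\<partial>\<^sub>b\<close> need not preserve \<open>k1\<close>, because
  \<open>\<partial>\<^sub>b \<alpha> = e\<^sub>b\<close>. On \<open>k1\<close> it is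
  \<open>DI\<^sub>b + e\<^sub>b D\<close>, where \<open>DI\<^sub>b\<close> acts on the coordinates
  over \<open>K = k(X)\<close> and preserves \<open>k1\<close>. The defect
  \<open>e\<^sub>b D\<close> is what carries \<open>e\<^sub>b v\<close> into the span of the
  \<open>w\<^sub>j\<close>. A suitable relation exists because \<open>D ^ p = 0\<close> and the
  kernel of \<open>D\<close> on \<open>k1\<close> is \<open>K\<close>: the successive derivatives of
  a nontrivial relation cannot all be relations. Divisibility explains the threshold:
  \<open>dim A' = p ^ m * s < p ^ n\<close> forces \<open>m < n\<close> and
  \<open>s + 1 \<le> p ^ (n - m)\<close>, which leaves room for one more
  \<open>dim N = p ^ m\<close>, or for the factor \<open>p\<close>.\<close>

definition field_ring :: "'a::field ring" where
  "field_ring = \<lparr>carrier = UNIV, mult = (*), one = 1, zero = 0, add = (+)\<rparr>"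

lemma field_ring_sel:
  "carrier field_ring = UNIV" "x \<otimes>\<^bsub>field_ring\<^esub> y = x * y" "\<one>\<^bsub>field_ring\<^esub> = 1"
  "\<zero>\<^bsub>field_ring\<^esub> = 0" "x \<oplus>\<^bsub>field_ring\<^esub> y = x + y"
  by (simp_all add: field_ring_def)

lemma field_field_ring: "field (field_ring :: 'a::field ring)"
proof -
  have "cring (field_ring :: 'a ring)"
  proof (rule cringI)
    show "abelian_group (field_ring :: 'a ring)"
    proof (rule abelian_groupI)
      fix x :: 'a
      show "\<exists>y\<in>carrier field_ring. y \<oplus>\<^bsub>field_ring\<^esub> x = \<zero>\<^bsub>field_ring\<^esub>"
        by (rule bexI[of _ "- x"]) (simp_all add: field_ring_sel)
    qed (auto simp: field_ring_sel)
    show "comm_monoid (field_ring :: 'a ring)"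
      by (rule comm_monoidI) (auto simp: field_ring_sel)
  qed (auto simp: field_ring_sel algebra_simps)
  then show ?thesis
  proof (rule cring.cring_fieldI)
    show "Units (field_ring :: 'a ring) = carrier field_ring - {\<zero>\<^bsub>field_ring\<^esub>}"
      by (auto simp: Units_def field_ring_sel)
        (metis left_inverse right_inverse)
  qed
qed

text \<open>Spans, dimensions and the tower law for subfields are formulated for ring records; this
  makes them available for every type-class field.\<close>

interpretation FR: field "field_ring :: 'a::field ring"
  by (rule field_field_ring)

definition is_subfield :: "'a::field set \<Rightarrow> bool" where
  "is_subfield k \<longleftrightarrow> 1 \<in> k \<and> (\<forall>x\<in>k. \<forall>y\<in>k. x - y \<in> k \<and> x * y \<in> k) \<and> (\<forall>x\<in>k. inverse x \<in> k)"

lemma is_subfieldD: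
  assumes "is_subfield k"
  shows is_subfield_one: "1 \<in> k" and is_subfield_zero: "0 \<in> k"
    and is_subfield_diff: "x \<in> k \<Longrightarrow> y \<in> k \<Longrightarrow> x - y \<in> k"
    and is_subfield_mult: "x \<in> k \<Longrightarrow> y \<in> k \<Longrightarrow> x * y \<in> k"
    and is_subfield_inverse: "x \<in> k \<Longrightarrow> inverse x \<in> k"
    and is_subfield_uminus: "x \<in> k \<Longrightarrow> - x \<in> k"
    and is_subfield_add: "x \<in> k \<Longrightarrow> y \<in> k \<Longrightarrow> x + y \<in> k"
    and is_subfield_divide: "x \<in> k \<Longrightarrow> y \<in> k \<Longrightarrow> x / y \<in> k"
    and is_subfield_power: "x \<in> k \<Longrightarrow> x ^ n \<in> k"
    and is_subfield_of_nat: "of_nat n \<in> k"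
proof -
  show d: "x - y \<in> k" and m: "x * y \<in> k" if "x \<in> k" "y \<in> k" for x y
    using assms that unfolding is_subfield_def by auto
  show i: "inverse x \<in> k" if "x \<in> k" for x
    using assms that unfolding is_subfield_def by auto
  show one: "1 \<in> k" using assms unfolding is_subfield_def by auto
  show z: "0 \<in> k" using d[OF one one] by simp
  show u: "- x \<in> k" if "x \<in> k" for x using d[OF z that] by simp
  show a: "x + y \<in> k" if "x \<in> k" "y \<in> k" for x y using d[OF that(1) u[OF that(2)]] by simp
  show "x / y \<in> k" if "x \<in> k" "y \<in> k" for x y
    using m[OF that(1) i[OF that(2)]] by (simp add: divide_inverse)
  show "x ^ n \<in> k" if "x \<in> k" for x using that one m by (induction n) auto
  show "of_nat n \<in> k" using one z a by (induction n) auto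
qed

lemma is_subfield_sum: "is_subfield k \<Longrightarrow> (\<And>i. i \<in> J \<Longrightarrow> f i \<in> k) \<Longrightarrow> sum f J \<in> k"
  by (induction J rule: infinite_finite_induct) (auto simp: is_subfield_zero is_subfield_add)

text \<open>Inverses come for free once p-th powers land in a field:
  \<open>1 / x = x ^ (p - 1) * (1 / x ^ p)\<close>.\<close>

lemma is_subfieldI_power:
  assumes "1 \<in> k" "\<And>x y. x \<in> k \<Longrightarrow> y \<in> k \<Longrightarrow> x - y \<in> k" "\<And>x y. x \<in> k \<Longrightarrow> y \<in> k \<Longrightarrow> x * y \<in> k"
    and "is_subfield K" "K \<subseteq> k" "\<And>x. x \<in> k \<Longrightarrow> x ^ p \<in> K" "p > 0"
  shows "is_subfield k"
proof -
  have "inverse x \<in> k" if "x \<in> k" for x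
  proof -
    have pow: "x ^ n \<in> k" for n using assms(1,3) that by (induction n) auto
    have "inverse (x ^ p) \<in> k" using assms(4-6) that is_subfield_inverse by blast
    moreover have "inverse x = x ^ (p - 1) * inverse (x ^ p)"
      using \<open>p > 0\<close> by (cases "x = 0"; cases p) (auto simp: field_simps)
    ultimately show ?thesis using pow assms(3) by metis
  qed
  then show ?thesis unfolding is_subfield_def using assms(1-3) by blast
qed

lemma is_subfield_subfield: "is_subfield k \<Longrightarrow> subfield k field_ring"
proof (rule FR.subfieldI')
  assume k: "is_subfield k"
  show "subring k field_ring"
  proof (rule FR.subringI)
    fix x assume x: "x \<in> k"
    have "\<ominus>\<^bsub>field_ring\<^esub> x = - x"
      using FR.minus_equality[of "- x" x] by (simp add: field_ring_sel)
    then show "\<ominus>\<^bsub>field_ring\<^esub> x \<in> k" using k x by (simp add: is_subfield_uminus)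
  qed (use k in \<open>auto simp: field_ring_sel is_subfield_one is_subfield_mult is_subfield_add\<close>)
  fix x assume "x \<in> k - {\<zero>\<^bsub>field_ring\<^esub>}"
  then have x: "x \<in> k" "x \<noteq> 0" by (auto simp: field_ring_sel)
  have "inv\<^bsub>field_ring\<^esub> x = inverse x"
    by (rule FR.comm_inv_char) (use x in \<open>auto simp: field_ring_sel\<close>)
  then show "inv\<^bsub>field_ring\<^esub> x \<in> k" using k x by (simp add: is_subfield_inverse)
qed

text \<open>Families are indexed rather than given as sets, since their members may coincide and
  since derivations will act on the coefficient functions of relations.\<close>

definition span_over :: "'a::field set \<Rightarrow> ('i \<Rightarrow> 'a) \<Rightarrow> 'i set \<Rightarrow> 'a set" where
  "span_over k e J = {\<Sum>i\<in>J. c i * e i | c. \<forall>i\<in>J. c i \<in> k}"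

definition lin_indep :: "'a::field set \<Rightarrow> ('i \<Rightarrow> 'a) \<Rightarrow> 'i set \<Rightarrow> bool" where
  "lin_indep k e J \<longleftrightarrow>
     (\<forall>c. (\<forall>i\<in>J. c i \<in> k) \<longrightarrow> (\<Sum>i\<in>J. c i * e i) = 0 \<longrightarrow> (\<forall>i\<in>J. c i = 0))"

section \<open>Transfer between lists of vectors and indexed families\<close>

lemma combine_map:
  "distinct l \<Longrightarrow> FR.combine (map c l) (map e l) = (\<Sum>i\<in>set l. c i * e i)"
  by (induction l) (auto simp: field_ring_sel)

lemma ex_map: "distinct l \<Longrightarrow> length Ks = length l \<Longrightarrow> \<exists>c. Ks = map c l"
  by (rule exI[of _ "the \<circ> map_of (zip l Ks)"])
    (auto intro!: nth_equalityI simp: map_of_zip_nth)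

lemma Span_map:
  assumes "is_subfield k" "distinct l"
  shows "FR.Span k (map e l) = span_over k e (set l)"
proof -
  have "FR.Span k (map e l) = {FR.combine Ks (map e l) |Ks. length Ks = length l \<and> set Ks \<subseteq> k}"
    using FR.Span_eq_combine_set_length_version[OF is_subfield_subfield[OF assms(1)], of "map e l"]
    by (simp add: field_ring_sel del: FR.Span.simps)
  also have "\<dots> = span_over k e (set l)"
  proof safe
    fix Ks assume Ks: "length Ks = length l" "set Ks \<subseteq> k"
    obtain c where c: "Ks = map c l" using ex_map[OF assms(2) Ks(1)] by auto
    show "FR.combine Ks (map e l) \<in> span_over k e (set l)"
      unfolding c combine_map[OF assms(2)] span_over_def using Ks c by auto
  next
    fix x assume "x \<in> span_over k e (set l)"
    then obtain c where "x = (\<Sum>i\<in>set l. c i * e i)" "\<forall>i\<in>set l. c i \<in> k"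
      unfolding span_over_def by auto
    then show "\<exists>Ks. x = FR.combine Ks (map e l) \<and> length Ks = length l \<and> set Ks \<subseteq> k"
      by (intro exI[of _ "map c l"]) (auto simp: combine_map[OF assms(2)])
  qed
  finally show ?thesis .
qed

lemma independent_map:
  assumes k: "is_subfield k" and l: "distinct l" and i: "lin_indep k e (set l)"
  shows "FR.independent k (map e l)"
proof (rule ccontr)
  assume dep: "\<not> ?thesis"
  then obtain Ks where Ks: "length Ks = length (map e l)"
    "FR.combine Ks (map e l) = \<zero>\<^bsub>field_ring\<^esub>" "set Ks \<subseteq> k" "set Ks \<noteq> {\<zero>\<^bsub>field_ring\<^esub>}"
    using FR.dependent_imp_non_trivial_combine[OF is_subfield_subfield[OF k], of "map e l"]
    by (auto simp: field_ring_sel)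
  obtain c where c: "Ks = map c l" using ex_map[OF l] Ks(1) by auto
  have "\<forall>i\<in>set l. c i = 0"
    using i Ks(2,3) unfolding c combine_map[OF l] lin_indep_def by (auto simp: field_ring_sel)
  then have "l = []" using Ks(4) unfolding c by (cases l) (auto simp: field_ring_sel)
  then show False using dep by auto
qed

lemma span_over_zero: "is_subfield k \<Longrightarrow> 0 \<in> span_over k e J"
  unfolding span_over_def by (auto intro!: exI[of _ "\<lambda>_. 0"] simp: is_subfield_zero)

lemma span_over_add: "is_subfield k \<Longrightarrow> x \<in> span_over k e J \<Longrightarrow> y \<in> span_over k e J \<Longrightarrow> x + y \<in> span_over k e J"
proof -
  assume k: "is_subfield k" and "x \<in> span_over k e J" "y \<in> span_over k e J"
  then obtain c d where "x = (\<Sum>i\<in>J. c i * e i)" "\<forall>i\<in>J. c i \<in> k"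
    "y = (\<Sum>i\<in>J. d i * e i)" "\<forall>i\<in>J. d i \<in> k" unfolding span_over_def by auto
  then show ?thesis using k unfolding span_over_def
    by (auto intro!: exI[of _ "\<lambda>i. c i + d i"] simp: sum.distrib algebra_simps is_subfield_add)
qed

lemma span_over_scale: "is_subfield k \<Longrightarrow> x \<in> span_over k e J \<Longrightarrow> a \<in> k \<Longrightarrow> a * x \<in> span_over k e J"
proof -
  assume k: "is_subfield k" "a \<in> k" and "x \<in> span_over k e J"
  then obtain c where "x = (\<Sum>i\<in>J. c i * e i)" "\<forall>i\<in>J. c i \<in> k" unfolding span_over_def by auto
  then show ?thesis using k unfolding span_over_def
    by (auto intro!: exI[of _ "\<lambda>i. a * c i"] simp: sum_distrib_left mult.assoc is_subfield_mult)
qed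

lemma span_over_uminus: "is_subfield k \<Longrightarrow> x \<in> span_over k e J \<Longrightarrow> - x \<in> span_over k e J"
  using span_over_scale[of k x e J "-1"] by (simp add: is_subfield_uminus is_subfield_one)

lemma span_over_diff: "is_subfield k \<Longrightarrow> x \<in> span_over k e J \<Longrightarrow> y \<in> span_over k e J \<Longrightarrow> x - y \<in> span_over k e J"
  using span_over_add[of k x e J "- y"] by (simp add: span_over_uminus)

lemma span_over_sum:
  "is_subfield k \<Longrightarrow> (\<And>j. j \<in> I \<Longrightarrow> f j \<in> span_over k e J) \<Longrightarrow> sum f I \<in> span_over k e J"
  by (induction I rule: infinite_finite_induct) (auto simp: span_over_zero span_over_add)

lemma span_over_base: "is_subfield k \<Longrightarrow> finite J \<Longrightarrow> i \<in> J \<Longrightarrow> e i \<in> span_over k e J"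
  unfolding span_over_def
  by (auto intro!: exI[of _ "\<lambda>j. if j = i then 1 else 0"]
      simp: is_subfield_zero is_subfield_one sum.delta if_distrib[of "\<lambda>x. x * _"] cong: if_cong)

lemma span_over_comb:
  "is_subfield k \<Longrightarrow> (\<And>i. i \<in> J \<Longrightarrow> c i \<in> k) \<Longrightarrow> (\<Sum>i\<in>J. c i * e i) \<in> span_over k e J"
  unfolding span_over_def by auto

lemma span_over_least:
  assumes "0 \<in> V" "\<And>x y. x \<in> V \<Longrightarrow> y \<in> V \<Longrightarrow> x + y \<in> V"
    "\<And>a i. a \<in> k \<Longrightarrow> i \<in> J \<Longrightarrow> a * e i \<in> V"
  shows "span_over k e J \<subseteq> V"
proof
  fix x assume "x \<in> span_over k e J"
  then obtain c where x: "x = (\<Sum>i\<in>J. c i * e i)" "\<forall>i\<in>J. c i \<in> k" unfolding span_over_def by auto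
  have "(\<Sum>i\<in>L. c i * e i) \<in> V" if "L \<subseteq> J" for L
    using that by (induction L rule: infinite_finite_induct) (use x assms in auto)
  then show "x \<in> V" using x by auto
qed

lemma span_over_subset:
  assumes "is_subfield k" "\<And>i. i \<in> J \<Longrightarrow> e i \<in> span_over k f L"
  shows "span_over k e J \<subseteq> span_over k f L"
  by (rule span_over_least) (use assms in \<open>auto intro: span_over_zero span_over_add span_over_scale\<close>)

lemma subalgebraI:
  assumes "0 \<in> V" "\<And>x y. x \<in> V \<Longrightarrow> y \<in> V \<Longrightarrow> x + y \<in> V" "\<And>a x. a \<in> k \<Longrightarrow> x \<in> V \<Longrightarrow> a * x \<in> V"
    "is_subfield k"
  shows "subalgebra k V field_ring"
proof -
  have neg: "- x \<in> V" if "x \<in> V" for x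
    using assms(3)[of "-1" x] that assms(4) by (simp add: is_subfield_uminus is_subfield_one)
  have inv: "\<ominus>\<^bsub>field_ring\<^esub> x = - x" for x :: 'a
    using FR.minus_equality[of "- x" x] by (simp add: field_ring_sel)
  have "subgroup V (add_monoid field_ring)"
    by (rule FR.add.subgroupI)
      (use assms neg inv in \<open>auto simp: field_ring_sel a_inv_def[symmetric]\<close>)
  then show ?thesis
    using assms(3) by (auto simp: subalgebra_def subalgebra_axioms_def field_ring_sel)
qed

lemma indep_card_le_dim:
  assumes "is_subfield k" "finite J" "lin_indep k e J" "e ` J \<subseteq> E" "FR.finite_dimension k E"
  shows "card J \<le> FR.dim k E"
proof -
  obtain l where l: "set l = J" "distinct l" using finite_distinct_list[OF assms(2)] by auto
  have sf: "subfield k field_ring" using assms(1) by (rule is_subfield_subfield)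
  have "FR.dimension (FR.dim k E) k E"
    using FR.finite_dimensionE[OF sf assms(5)] by (simp add: over_def)
  from FR.independent_length_le_dimension[OF sf this independent_map[OF assms(1) l(2)], of e]
  show ?thesis using assms(3,4) l by (simp add: distinct_card[symmetric])
qed

lemma dim_span_over_indep:
  assumes "is_subfield k" "finite J" "lin_indep k e J"
  shows "FR.finite_dimension k (span_over k e J)" "FR.dim k (span_over k e J) = card J"
proof -
  obtain l where l: "set l = J" "distinct l" using finite_distinct_list[OF assms(2)] by auto
  have sf: "subfield k field_ring" using assms(1) by (rule is_subfield_subfield)
  have *: "FR.dimension (card J) k (span_over k e J)"
    using FR.dimension_independent[OF independent_map[OF assms(1) l(2), of e]]
    unfolding Span_map[OF assms(1) l(2)]
    using assms(3) l by (simp add: distinct_card[symmetric])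
  show "FR.finite_dimension k (span_over k e J)" using * by (rule FR.finite_dimensionI)
  show "FR.dim k (span_over k e J) = card J" using FR.dimI[OF sf *] by (simp add: over_def)
qed

lemma span_over_mono: "is_subfield k \<Longrightarrow> finite I \<Longrightarrow> J \<subseteq> I \<Longrightarrow> span_over k e J \<subseteq> span_over k e I"
  by (rule span_over_subset) (auto intro: span_over_base)

text \<open>An independent subfamily of the greatest cardinality spans: one more index
  \<open>i\<close> creates a relation, and its coefficient at \<open>i\<close> cannot vanish, so
  \<open>e i\<close> can be solved for.\<close>

lemma ex_basis:
  assumes k: "is_subfield k" and I: "finite I"
  obtains J where "J \<subseteq> I" "lin_indep k e J" "span_over k e J = span_over k e I"
proof -
  let ?P = "\<lambda>J. J \<subseteq> I \<and> lin_indep k e J"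
  have "?P {}" by (simp add: lin_indep_def)
  moreover have "\<forall>J. ?P J \<longrightarrow> card J < Suc (card I)" using card_mono[OF I] by (auto simp: less_Suc_eq_le)
  ultimately obtain J where J: "?P J" "\<forall>J'. ?P J' \<longrightarrow> card J' \<le> card J"
    using ex_has_greatest_nat[of ?P "{}" card "Suc (card I)"] by (meson less_imp_le)
  have fJ: "finite J" using J I finite_subset by blast
  have "e i \<in> span_over k e J" if i: "i \<in> I" for i
  proof (cases "i \<in> J")
    case True then show ?thesis using span_over_base[OF k fJ] by auto
  next
    case False
    have "card (insert i J) > card J" using False fJ by simp
    then have "\<not> lin_indep k e (insert i J)" using J i
      by (metis insert_subset leD)
    then obtain c where c: "\<forall>j\<in>insert i J. c j \<in> k" "(\<Sum>j\<in>insert i J. c j * e j) = 0"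
      "\<exists>j\<in>insert i J. c j \<noteq> 0" unfolding lin_indep_def by auto
    have s: "c i * e i + (\<Sum>j\<in>J. c j * e j) = 0" using c(2) False fJ by simp
    have ci: "c i \<noteq> 0"
    proof
      assume "c i = 0"
      then have "(\<Sum>j\<in>J. c j * e j) = 0" using s by simp
      then have "\<forall>j\<in>J. c j = 0" using J(1) c(1) unfolding lin_indep_def by auto
      then show False using c(3) \<open>c i = 0\<close> by auto
    qed
    have "e i = (- inverse (c i)) * (\<Sum>j\<in>J. c j * e j)"
      using s ci by (simp add: field_simps eq_neg_iff_add_eq_0)
    then show ?thesis using c(1) k
      by (metis span_over_scale span_over_comb is_subfield_uminus is_subfield_inverse insertCI)
  qed
  then have "span_over k e I \<subseteq> span_over k e J" by (rule span_over_subset[OF k])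
  then have "span_over k e J = span_over k e I" using span_over_mono[OF k I] J(1) by blast
  then show ?thesis using that J(1) by blast
qed

lemma finite_dimension_span_over:
  assumes "is_subfield k" "finite I" shows "FR.finite_dimension k (span_over k e I)"
  using ex_basis[OF assms, of e] dim_span_over_indep(1)[OF assms(1)] finite_subset[OF _ assms(2)] by metis

lemma dim_span_over_less:
  assumes "is_subfield k" "finite I" "\<not> lin_indep k e I"
  shows "FR.dim k (span_over k e I) < card I"
proof -
  obtain J where J: "J \<subseteq> I" "lin_indep k e J" "span_over k e J = span_over k e I"
    using ex_basis[OF assms(1,2), of e] by blast
  then have "FR.dim k (span_over k e I) = card J"
    using dim_span_over_indep(2)[OF assms(1) finite_subset[OF J(1) assms(2)] J(2)] by simp
  moreover have "J \<subset> I" using J assms(3) by blast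
  ultimately show ?thesis using psubset_card_mono[OF assms(2)] by simp
qed

text \<open>Multiplication by \<open>v\<close> is injective and \<open>k\<close>-linear, so it
  carries a basis of the span to an independent family in \<open>E\<close>.\<close>

lemma dim_span_over_scale_le:
  assumes "is_subfield k" "finite I" "v \<noteq> 0" "\<And>i. i \<in> I \<Longrightarrow> e i * v \<in> E"
    and "FR.finite_dimension k E"
  shows "FR.dim k (span_over k e I) \<le> FR.dim k E"
proof -
  obtain J where J: "J \<subseteq> I" "lin_indep k e J" "span_over k e J = span_over k e I"
    using ex_basis[OF assms(1,2), of e] by blast
  have fJ: "finite J" using J assms finite_subset by blast
  have "FR.dim k (span_over k e I) = card J"
    using dim_span_over_indep(2)[OF assms(1) fJ J(2)] J by simp
  also have "lin_indep k (\<lambda>i. e i * v) J"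
    unfolding lin_indep_def
  proof safe
    fix c i assume c: "\<forall>i\<in>J. c i \<in> k" "(\<Sum>i\<in>J. c i * (e i * v)) = 0" "i \<in> J"
    have "(\<Sum>i\<in>J. c i * e i) * v = 0" using c(2) by (simp add: sum_distrib_right mult.assoc)
    then show "c i = 0" using J(2) c assms(3) unfolding lin_indep_def by auto
  qed
  then have "card J \<le> FR.dim k E"
    using indep_card_le_dim[OF assms(1) fJ _ _ assms(5), of "\<lambda>i. e i * v"] assms(4) J(1) by blast
  finally show ?thesis .
qed

lemma telescopic_dim:
  assumes "is_subfield k" "is_subfield N" "FR.finite_dimension k N" "FR.finite_dimension N E"
  shows "FR.finite_dimension k E" "FR.dim k E = FR.dim k N * FR.dim N E"
  using FR.telescopic_base_dim[OF is_subfield_subfield[OF assms(1)] is_subfield_subfield[OF assms(2)] assms(3,4)]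
  by (auto simp: over_def)

lemma finite_dimension_subspace:
  assumes "is_subfield k" "FR.finite_dimension k E" "subalgebra k V field_ring" "V \<subseteq> E"
  shows "FR.finite_dimension k V"
  using FR.subalbegra_incl_imp_finite_dimension[OF is_subfield_subfield[OF assms(1)] assms(2-4)] .

section \<open>Purely inseparable extensions of exponent one\<close>

text \<open>The factor \<open>T - x\<close> can only divide the cofactor \<open>w\<close>, as
  \<open>u\<close> does not vanish at \<open>x\<close>; the induction cancels one such factor at a
  time.\<close>

lemma dvd_linear_power_const:
  fixes u :: "'a::field poly"
  assumes "[:-x, 1:] ^ m = u * w" "poly u x \<noteq> 0"
  shows "degree u = 0"
  using assms(1)
proof (induction m arbitrary: w)
  case 0
  then have "is_unit u" by (metis dvd_triv_left power_0)
  moreover have "u \<noteq> 0" using assms(2) by auto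
  ultimately show ?case by (simp add: is_unit_iff_degree)
next
  case (Suc m)
  have "poly (u * w) x = 0" by (simp flip: Suc.prems)
  then have "poly w x = 0" using assms(2) by simp
  then obtain w' where w': "w = [:-x, 1:] * w'" by (auto simp: poly_eq_0_iff_dvd)
  have "[:-x, 1:] * [:-x, 1:] ^ m = [:-x, 1:] * (u * w')" using Suc.prems
    unfolding w' power_Suc by (simp only: mult_ac)
  then have "[:-x, 1:] ^ m = u * w'" by (metis mult_left_cancel pCons_eq_0_iff zero_neq_one)
  then show ?case by (rule Suc.IH)
qed

lemma add_power_char:
  fixes x y :: "'a::comm_ring_1"
  assumes "prime p" "of_nat p = (0::'a)"
  shows "(x + y) ^ p = x ^ p + y ^ p"
proof -
  have p1: "p > 1" using assms(1) prime_gt_1_nat by blast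
  have "(x + y) ^ p = (\<Sum>k\<le>p. of_nat (p choose k) * x ^ k * y ^ (p - k))"
    by (rule binomial_ring)
  also have "\<dots> = (\<Sum>k\<in>{0,p}. of_nat (p choose k) * x ^ k * y ^ (p - k))"
  proof (rule sum.mono_neutral_right)
    show "\<forall>k\<in>{..p} - {0, p}. of_nat (p choose k) * x ^ k * y ^ (p - k) = 0"
    proof
      fix k assume "k \<in> {..p} - {0, p}"
      then have "p dvd p choose k" using assms(1) by (intro dvd_choose_prime) auto
      then show "of_nat (p choose k) * x ^ k * y ^ (p - k) = 0"
        using assms(2) by (auto simp: dvd_def)
    qed
  qed auto
  also have "\<dots> = x ^ p + y ^ p" using p1 by simp
  finally show ?thesis .
qed

lemma sum_power_char:
  fixes f :: "'i \<Rightarrow> 'a::comm_ring_1"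
  assumes "prime p" "of_nat p = (0::'a)"
  shows "(\<Sum>i\<in>J. f i) ^ p = (\<Sum>i\<in>J. f i ^ p)"
  using prime_gt_0_nat[OF assms(1)]
  by (induction J rule: infinite_finite_induct) (auto simp: add_power_char[OF assms] power_0_left)

lemma uminus_power_char:
  fixes x :: "'a::comm_ring_1"
  assumes "prime p" "of_nat p = (0::'a)"
  shows "(- x) ^ p = - (x ^ p)"
  using add_power_char[OF assms, of x "- x"] prime_gt_0_nat[OF assms(1)]
  by (simp add: eq_neg_iff_add_eq_0 add.commute power_0_left)

lemma of_nat_eq_0_char:
  assumes "prime p" "of_nat p = (0::'a::field)" "0 < j" "j < p"
  shows "of_nat j \<noteq> (0::'a)"
proof
  assume j: "of_nat j = (0::'a)"
  have "CHAR('a) dvd p" using assms(2) by (simp add: of_nat_eq_0_iff_char_dvd)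
  moreover have "CHAR('a) \<noteq> 1" by simp
  ultimately have "CHAR('a) = p" using assms(1) by (metis prime_nat_iff)
  then have "p dvd j" using j by (simp add: of_nat_eq_0_iff_char_dvd)
  then show False using assms(3,4) by (simp add: nat_dvd_not_less)
qed

text \<open>A dependence gives a polynomial over \<open>k\<close> of degree below \<open>p\<close>
  that vanishes at \<open>x\<close>. The one of least degree divides
  \<open>T ^ p - x ^ p = (T - x) ^ p\<close> and has \<open>x\<close> as a simple root, so it is
  linear and \<open>x\<close> lies in \<open>k\<close>.\<close>

lemma indep_powers:
  fixes x :: "'a::field"
  assumes p: "prime p" "of_nat p = (0::'a)" and k: "is_subfield k" and x: "x \<notin> k" "x ^ p \<in> k"
  shows "lin_indep k (\<lambda>i. x ^ i) {..<p}"
proof (rule ccontr)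
  define V where "V = {f::'a poly. (\<forall>i. coeff f i \<in> k) \<and> poly f x = 0}"
  assume "\<not> ?thesis"
  then obtain c where c: "\<forall>i<p. c i \<in> k" "(\<Sum>i<p. c i * x ^ i) = 0" "\<exists>i<p. c i \<noteq> 0"
    unfolding lin_indep_def by auto
  define f0 where "f0 = (\<Sum>i<p. monom (c i) i)"
  have cf0: "coeff f0 i = (if i < p then c i else 0)" for i
    by (simp add: f0_def coeff_sum sum.delta)
  have "f0 \<in> V" "f0 \<noteq> 0"
    using c cf0 is_subfield_zero[OF k] by (auto simp: V_def f0_def poly_sum poly_monom dest: arg_cong[of _ _ coeff])
      (metis coeff_0)
  moreover have "degree f0 < p"
    using prime_gt_0_nat[OF p(1)] cf0 by (intro degree_lessI) auto
  ultimately obtain g where g: "g \<in> V" "g \<noteq> 0" "degree g < p"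
    and gmin: "\<And>f. f \<in> V \<Longrightarrow> f \<noteq> 0 \<Longrightarrow> degree g \<le> degree f"
    using ex_has_least_nat[of "\<lambda>f. f \<in> V \<and> f \<noteq> 0" f0 degree] by (metis le_less_trans)
  have gV: "coeff g i \<in> k" "poly g x = 0" for i using g by (auto simp: V_def)
  have degg: "degree g > 0"
  proof (rule ccontr)
    assume "\<not> ?thesis"
    then obtain a where "g = [:a:]" by (metis degree_eq_zeroE gr0I)
    then show False using gV(2) g(2) by simp
  qed
  \<comment> \<open>Division with remainder stays inside \<open>V\<close>: subtracting a multiple of
    \<open>g\<close> with coefficients in \<open>k\<close> lowers the degree.\<close>
  have div: "g dvd f" if "f \<in> V" for f
    using that
  proof (induction "degree f" arbitrary: f rule: less_induct)
    case less
    show ?case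
    proof (cases "f = 0")
      case False
      define a where "a = lead_coeff f / lead_coeff g"
      define h where "h = f - monom a (degree f - degree g) * g"
      have le: "degree g \<le> degree f" using gmin less.prems False by blast
      have ak: "a \<in> k" using less.prems gV k by (auto simp: a_def V_def is_subfield_divide)
      have "h \<in> V" using less.prems gV ak k
        by (auto simp: V_def h_def coeff_monom_mult is_subfield_diff is_subfield_mult)
      moreover have "g dvd h" if "h \<noteq> 0"
      proof -
        have "degree h \<le> degree f"
          unfolding h_def using le
          by (intro degree_diff_le order_trans[OF degree_mult_le])
            (auto intro: order_trans[OF add_right_mono[OF degree_monom_le]])
        moreover have "coeff h (degree f) = 0"
          using le g(2) by (simp add: h_def a_def coeff_monom_mult)
        ultimately have "degree h < degree f"
          using that by (metis le_neq_implies_less leading_coeff_0_iff)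
        then show ?thesis using less.hyps \<open>h \<in> V\<close> by blast
      qed
      ultimately have "g dvd h" by (cases "h = 0") auto
      then have "g dvd h + monom a (degree f - degree g) * g" by (intro dvd_add) auto
      then show ?thesis by (simp add: h_def)
    qed simp
  qed
  have p0: "p > 0" using p prime_gt_0_nat by blast
  have charp: "of_nat p = (0::'a poly)" using p(2) by (simp add: of_nat_poly)
  have "[:-x, 1:] ^ p = [:0,1:] ^ p + [:-x:] ^ p"
    using add_power_char[OF p(1) charp, of "[:0,1:]" "[:-x:]"] by simp
  also have "[:-x:] ^ p = [:- (x ^ p):]"
    using uminus_power_char[OF p, of x] by (simp add: poly_const_pow)
  finally have lin: "[:-x, 1:] ^ p = monom 1 p + [:- (x ^ p):]" by (simp add: monom_altdef)
  have "poly ([:-x, 1:] ^ p) x = 0" using p0 by simp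
  then have "[:-x, 1:] ^ p \<in> V"
    unfolding V_def lin using x(2) k p0
    by (auto simp: coeff_pCons is_subfield_zero is_subfield_one is_subfield_uminus is_subfield_add coeff_monom split: nat.splits)
  then obtain w where w: "[:-x, 1:] ^ p = g * w" using div by (auto elim: dvdE)
  obtain u where u: "g = [:-x, 1:] * u" using gV(2) by (auto simp: poly_eq_0_iff_dvd)
  \<comment> \<open>As \<open>0 < degree g < p\<close>, the derivative is nonzero of smaller degree
    and still over \<open>k\<close>; by minimality it does not vanish at \<open>x\<close>.\<close>
  have g': "coeff (pderiv g) i \<in> k" for i
    using gV(1) k by (simp add: coeff_pderiv is_subfield_mult is_subfield_of_nat del: of_nat_Suc)
  have "coeff (pderiv g) (degree g - 1) \<noteq> 0"
    using of_nat_eq_0_char[OF p degg g(3)] degg g(2) by (simp add: coeff_pderiv del: of_nat_Suc)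
  then have "pderiv g \<noteq> 0" by auto
  moreover have "degree (pderiv g) < degree g"
    using degg by (intro degree_lessI) (auto simp: coeff_pderiv coeff_eq_0)
  ultimately have "pderiv g \<notin> V" using gmin by (meson leD)
  then have "poly (pderiv g) x \<noteq> 0" using g' by (auto simp: V_def)
  then have "poly u x \<noteq> 0" 
    by (subst (asm) u) (auto simp: pderiv_mult simp del: mult_pCons_left)
  moreover have "[:-x, 1:] ^ p = u * ([:-x, 1:] * w)" using w
    unfolding u by (simp only: mult_ac)
  ultimately have du: "degree u = 0" by (metis dvd_linear_power_const)
  then obtain a where a: "u = [:a:]" by (metis degree_eq_zeroE)
  \<comment> \<open>Now \<open>g = a (T - x)\<close>, so both \<open>- (x * a)\<close> and
    \<open>a\<close> are coefficients of \<open>g\<close>.\<close>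
  have "a \<noteq> 0" using a u g(2) by auto
  moreover have "coeff g 0 \<in> k" "coeff g 1 \<in> k" using gV by auto
  then have "- (x * a) \<in> k" "a \<in> k" by (auto simp: u a mult.commute)
  ultimately have "x \<in> k" using is_subfield_divide[OF k, of "- (x * a)" a] is_subfield_uminus[OF k] by fastforce
  then show False using x by simp
qed

text \<open>The span is the field \<open>k(x)\<close>: exponents can be reduced modulo
  \<open>p\<close> because \<open>x ^ p\<close> lies in \<open>k\<close>, which gives closure under
  products.\<close>

lemma is_subfield_span_over_powers:
  fixes k N :: "'a::field set"
  assumes p0: "p > 1" and kk: "is_subfield k" and N: "is_subfield N" "k \<subseteq> N"
    and pow: "\<And>x. x \<in> N \<Longrightarrow> x ^ p \<in> k" and x: "x \<in> N"
  defines "E \<equiv> span_over k (\<lambda>i. x ^ i) {..<p}"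
  shows "is_subfield E" "k \<subseteq> E" "E \<subseteq> N" "x ^ i \<in> E"
proof -
  have xk: "x ^ p \<in> k" using pow x by blast
  have xE: "x ^ i \<in> E" for i
  proof -
    have "x ^ i = (x ^ p) ^ (i div p) * x ^ (i mod p)"
      by (metis power_add power_mult div_mult_mod_eq mult.commute)
    moreover have "x ^ (i mod p) \<in> E"
      unfolding E_def using span_over_base[OF kk, of "{..<p}" "i mod p" "\<lambda>i. x ^ i"] p0 by auto
    ultimately show ?thesis unfolding E_def using xk kk by (simp add: span_over_scale is_subfield_power)
  qed
  have mult: "a * b \<in> E" if "a \<in> E" "b \<in> E" for a b
  proof -
    have s: "x ^ i * b \<in> E" for i
    proof -
      obtain c where c: "b = (\<Sum>j<p. c j * x ^ j)" "\<forall>j<p. c j \<in> k"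
        using \<open>b \<in> E\<close> unfolding E_def span_over_def by auto
      have "x ^ i * b = (\<Sum>j<p. c j * x ^ (i + j))" unfolding c by (simp add: sum_distrib_left power_add mult_ac)
      also have "\<dots> \<in> E" unfolding E_def
        by (rule span_over_sum[OF kk], rule span_over_scale[OF kk]) (use xE c in \<open>auto simp: E_def\<close>)
      finally show ?thesis .
    qed
    obtain c where c: "a = (\<Sum>j<p. c j * x ^ j)" "\<forall>j<p. c j \<in> k"
      using \<open>a \<in> E\<close> unfolding E_def span_over_def by auto
    have "a * b = (\<Sum>j<p. c j * (x ^ j * b))" unfolding c(1) sum_distrib_right mult.assoc ..
    also have "\<dots> \<in> E" unfolding E_def
      by (rule span_over_sum[OF kk], rule span_over_scale[OF kk]) (use s c in \<open>auto simp: E_def\<close>)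
    finally show ?thesis .
  qed
  have E1: "1 \<in> E" using xE[of 0] by simp
  have kE: "k \<subseteq> E" using span_over_scale[OF kk, of 1 _ "{..<p}"] E1 by (auto simp: E_def)
  have EN: "E \<subseteq> N"
    unfolding E_def
    by (rule span_over_least) (use N N(2) x in \<open>auto simp: is_subfield_zero is_subfield_add is_subfield_mult is_subfield_power subsetD\<close>)
  have sE: "is_subfield E"
  proof (rule is_subfieldI_power[OF E1 _ mult kk kE, of p])
    show "a - b \<in> E" if "a \<in> E" "b \<in> E" for a b
      using span_over_diff[OF kk] that unfolding E_def by blast
    show "a ^ p \<in> k" if "a \<in> E" for a using EN pow that by blast
    show "0 < p" using p0 by simp
  qed
  show "is_subfield E" "k \<subseteq> E" "E \<subseteq> N" "x ^ i \<in> E" using sE kE EN xE by auto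
qed

text \<open>Any \<open>x\<close> in \<open>N\<close> outside \<open>k\<close> generates a step
  \<open>E = k(x)\<close> of degree exactly \<open>p\<close>; the tower law reduces the claim to the
  smaller degree of \<open>N\<close> over \<open>E\<close>.\<close>

lemma dim_p_power:
  fixes k N :: "'a::field set"
  assumes p: "prime p" "of_nat p = (0::'a)" and k: "is_subfield k" and N: "is_subfield N" "k \<subseteq> N"
    and pow: "\<And>x. x \<in> N \<Longrightarrow> x ^ p \<in> k" and fin: "FR.finite_dimension k N"
  shows "\<exists>m. FR.dim k N = p ^ m"
  using k N(2) pow fin
proof (induction "FR.dim k N" arbitrary: k rule: less_induct)
  case (less k)
  have p0: "p > 1" using p prime_gt_1_nat by blast
  show ?case
  proof (cases "k = N")
    case True
    have "FR.dim k N = 1"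
      using FR.dimI[OF is_subfield_subfield[OF less.prems(1)] FR.dimension_one[OF is_subfield_subfield[OF less.prems(1)]]]
        True by (simp add: over_def)
    then show ?thesis by (intro exI[of _ 0]) simp
  next
    case False
    then obtain x where x: "x \<in> N" "x \<notin> k" using less.prems(2) by blast
    have xk: "x ^ p \<in> k" using less.prems(3) x by blast
    define E where "E = span_over k (\<lambda>i. x ^ i) {..<p}"
    note kk = less.prems(1)
    have ind: "lin_indep k (\<lambda>i. x ^ i) {..<p}" by (rule indep_powers[OF p kk x(2) xk])
    have sE: "is_subfield E" "k \<subseteq> E" "E \<subseteq> N"
      using is_subfield_span_over_powers[OF p0 kk N(1) less.prems(2,3) x(1)] unfolding E_def by blast+
    note kE = sE(2) and EN = sE(3)
    have dE: "FR.finite_dimension k E" "FR.dim k E = p"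
      using dim_span_over_indep[OF kk _ ind] by (auto simp: E_def)
    obtain l where l: "set l \<subseteq> UNIV" "FR.Span k l = N"
      using FR.exists_base[OF is_subfield_subfield[OF kk] FR.finite_dimensionE[OF is_subfield_subfield[OF kk] less.prems(4)]]
      by auto
    have "FR.Span k (remdups l) = FR.Span k l"
      by (rule FR.Span_same_set[OF is_subfield_subfield[OF kk]]) (simp_all add: field_ring_sel)
    then have "N = span_over k id (set (remdups l))"
      using Span_map[OF kk distinct_remdups, of id l] l(2) by (simp only: list.map_id)
    then have "N = span_over E id (set l)"
    proof -
      assume n: "N = span_over k id (set (remdups l))"
      have lN: "i \<in> N" if "i \<in> set l" for i
        using span_over_base[OF kk, of "set l" i id] that n by simp
      have "span_over E id (set l) \<subseteq> N"
        by (rule span_over_least) (use N EN lN in \<open>auto simp: is_subfield_zero is_subfield_add is_subfield_mult subsetD\<close>)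
      moreover have "span_over k id (set l) \<subseteq> span_over E id (set l)" unfolding span_over_def using kE by blast
      ultimately show ?thesis using n by simp
    qed
    then have fE: "FR.finite_dimension E N" using finite_dimension_span_over[OF sE(1)] by (metis List.finite_set)
    have t: "FR.dim k N = p * FR.dim E N" using telescopic_dim[OF kk sE(1) dE(1) fE] dE by simp
    have "FR.dim k N \<ge> 1"
      using indep_card_le_dim[OF kk, of "{0::nat}" "\<lambda>_. 1" N] N less.prems(4)
      by (auto simp: lin_indep_def is_subfield_one)
    then have "FR.dim E N < FR.dim k N" using t p0
      by (metis One_nat_def mult_1 mult_less_mono1 not_one_le_zero gr0I mult_0_right)
    from less.hyps[OF this sE(1) EN _ fE] obtain m where "FR.dim E N = p ^ m"
      using less.prems(3) kE by blast
    then show ?thesis using t by (intro exI[of _ "Suc m"]) simp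
  qed
qed

section \<open>Relations over a generic inseparable extension\<close>

lemma lin_indepD:
  "lin_indep k e J \<Longrightarrow> (\<And>i. i \<in> J \<Longrightarrow> c i \<in> k) \<Longrightarrow> (\<Sum>i\<in>J. c i * e i) = 0 \<Longrightarrow> i \<in> J \<Longrightarrow> c i = 0"
  unfolding lin_indep_def by blast

text \<open>In the application the ambient field is \<open>F(X)\<close>, \<open>K\<close> is
  \<open>F ^ p (X)\<close>, the \<open>e i\<close> are constants from \<open>F\<close>, and
  \<open>d i\<close> is the partial derivative in the variable attached to \<open>i\<close>. The
  index \<open>i0\<close> carries the normalised coefficient \<open>1\<close> and has no variable,
  hence no derivation.\<close>

locale generic_extension =
  fixes K :: "'g::field set" and p :: nat and \<alpha> :: 'g and I :: "'i set" and i0 :: 'i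
    and e :: "'i \<Rightarrow> 'g" and d :: "'i \<Rightarrow> 'g \<Rightarrow> 'g"
  assumes p: "prime p" "of_nat p = (0::'g)"
    and K: "is_subfield K" and pow_K: "\<And>x. x ^ p \<in> K"
    and I: "finite I" "I \<noteq> {}" "i0 \<notin> I" and e_o: "e i0 = 1"
    and d_add: "\<And>i x y. i \<in> I \<Longrightarrow> d i (x + y) = d i x + d i y"
    and d_mult: "\<And>i x y. i \<in> I \<Longrightarrow> d i (x * y) = x * d i y + d i x * y"
    and d_K: "\<And>i x. i \<in> I \<Longrightarrow> x \<in> K \<Longrightarrow> d i x \<in> K"
    and d_e: "\<And>i j. i \<in> I \<Longrightarrow> j \<in> insert i0 I \<Longrightarrow> d i (e j) = 0"
    and d_alpha: "\<And>i. i \<in> I \<Longrightarrow> d i \<alpha> = e i"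
    and indep_e: "lin_indep K e (insert i0 I)"
begin

text \<open>This is the field \<open>K(\<alpha>)\<close>, as \<open>\<alpha> ^ p\<close> lies in
  \<open>K\<close>.\<close>

definition k1 :: "'g set" where "k1 = span_over K (\<lambda>r. \<alpha> ^ r) {..<p}"

lemma p_gt_1: "p > 1" using p prime_gt_1_nat by blast

text \<open>Otherwise \<open>e i = d i \<alpha>\<close> would lie in \<open>K\<close>, and
  \<open>1 * e i - e i * e i0 = 0\<close> would be a nontrivial relation over
  \<open>K\<close>.\<close>

lemma alpha_notin_K: "\<alpha> \<notin> K"
proof
  assume a: "\<alpha> \<in> K"
  obtain i where i: "i \<in> I" using I by blast
  have nz: "i \<noteq> i0" using i I by blast
  have ei: "e i \<in> K" using d_K[OF i a] d_alpha[OF i] by simp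
  let ?c = "\<lambda>j. if j = i then 1 else if j = i0 then - e i else 0"
  have "(\<Sum>j\<in>insert i0 I. ?c j * e j) = (\<Sum>j\<in>{i,i0}. ?c j * e j)"
    by (rule sum.mono_neutral_right) (use i I in auto)
  also have "\<dots> = 0" using nz e_o by simp
  finally have "(\<Sum>j\<in>insert i0 I. ?c j * e j) = 0" .
  moreover have "?c j \<in> K" for j using ei K by (simp add: is_subfield_one is_subfield_zero is_subfield_uminus)
  ultimately have "?c i = 0" using lin_indepD[OF indep_e, of ?c i] i by blast
  then show False by simp
qed

lemma indep_alpha: "lin_indep K (\<lambda>r. \<alpha> ^ r) {..<p}"
  by (rule indep_powers[OF p K alpha_notin_K pow_K])

lemma k1: "is_subfield k1" "K \<subseteq> k1" "\<alpha> ^ r \<in> k1"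
proof -
  have U: "is_subfield (UNIV :: 'g set)" by (simp add: is_subfield_def)
  show "is_subfield k1" "K \<subseteq> k1" "\<alpha> ^ r \<in> k1"
    using is_subfield_span_over_powers[OF p_gt_1 K U subset_UNIV pow_K, of \<alpha>] unfolding k1_def by blast+
qed

lemma d_0: "i \<in> I \<Longrightarrow> d i 0 = 0"
  by (metis d_add add_0_right add_cancel_right_right)

lemma d_sum: "i \<in> I \<Longrightarrow> d i (sum f J) = (\<Sum>j\<in>J. d i (f j))"
  by (induction J rule: infinite_finite_induct) (auto simp: d_0 d_add)

lemma d_1: "i \<in> I \<Longrightarrow> d i 1 = 0"
  using d_mult[of i 1 1] by (simp only: mult_1 mult_1_right) (metis add_cancel_right_right)

lemma d_of_nat: "i \<in> I \<Longrightarrow> d i (of_nat n) = 0"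
  by (induction n) (auto simp: d_0 d_1 d_add)

lemma d_alpha_power:
  assumes "i \<in> I"
  shows "d i (\<alpha> ^ r) = of_nat r * \<alpha> ^ (r - 1) * e i"
proof (induction r)
  case 0 then show ?case using d_1[OF assms] by simp
next
  case (Suc r)
  have "d i (\<alpha> ^ Suc r) = \<alpha> * (of_nat r * \<alpha> ^ (r - 1) * e i) + e i * \<alpha> ^ r"
    using Suc by (simp add: d_mult[OF assms] d_alpha[OF assms])
  also have "\<dots> = of_nat (Suc r) * \<alpha> ^ (Suc r - 1) * e i"
    by (cases r) (simp_all add: algebra_simps)
  finally show ?case .
qed

section \<open>The derivation \<open>D\<close> and the coordinatewise derivations \<open>DI\<close>
  on \<open>k1\<close>\<close>

definition co :: "'g \<Rightarrow> nat \<Rightarrow> 'g" where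
  "co x = (SOME f. (\<forall>r<p. f r \<in> K) \<and> x = (\<Sum>r<p. f r * \<alpha> ^ r))"

definition D :: "'g \<Rightarrow> 'g" where "D x = (\<Sum>r<p. of_nat r * co x r * \<alpha> ^ (r - 1))"

text \<open>This differentiates the \<open>K\<close>-coordinates and treats \<alpha> as a constant.
  Unlike \<open>d i\<close>, it always preserves \<open>k1\<close>.\<close>

definition DI :: "'i \<Rightarrow> 'g \<Rightarrow> 'g" where "DI i x = (\<Sum>r<p. d i (co x r) * \<alpha> ^ r)"

lemma co:
  assumes "x \<in> k1"
  shows "\<forall>r<p. co x r \<in> K" "x = (\<Sum>r<p. co x r * \<alpha> ^ r)"
proof -
  have "\<exists>f. (\<forall>r<p. f r \<in> K) \<and> x = (\<Sum>r<p. f r * \<alpha> ^ r)"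
    using assms unfolding k1_def span_over_def by auto
  from someI_ex[OF this] show "\<forall>r<p. co x r \<in> K" "x = (\<Sum>r<p. co x r * \<alpha> ^ r)"
    unfolding co_def by auto
qed

lemma co_unique:
  assumes "\<forall>r<p. f r \<in> K" "r < p"
  shows "co (\<Sum>r<p. f r * \<alpha> ^ r) r = f r"
proof -
  let ?x = "\<Sum>r<p. f r * \<alpha> ^ r"
  have x: "?x \<in> k1" unfolding k1_def span_over_def using assms by auto
  have "(\<Sum>r<p. (co ?x r - f r) * \<alpha> ^ r) = 0"
    using co(2)[OF x] by (simp add: left_diff_distrib sum_subtractf)
  moreover have "\<forall>r<p. co ?x r - f r \<in> K" using co(1)[OF x] assms K by (auto simp: is_subfield_diff)
  ultimately have "\<forall>r<p. co ?x r - f r = 0"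
    using indep_alpha[unfolded lin_indep_def, rule_format, of "\<lambda>r. co ?x r - f r"] by simp
  then have "co ?x r - f r = 0" using assms(2) by blast
  then show ?thesis by simp
qed

lemma D_eq: "\<forall>r<p. f r \<in> K \<Longrightarrow> D (\<Sum>r<p. f r * \<alpha> ^ r) = (\<Sum>r<p. of_nat r * f r * \<alpha> ^ (r - 1))"
  unfolding D_def by (intro sum.cong) (auto simp: co_unique)

lemma DI_eq: "\<forall>r<p. f r \<in> K \<Longrightarrow> DI i (\<Sum>r<p. f r * \<alpha> ^ r) = (\<Sum>r<p. d i (f r) * \<alpha> ^ r)"
  unfolding DI_def by (intro sum.cong) (auto simp: co_unique)

lemma D_sum_shift:
  assumes "t \<le> p"
  shows "(\<Sum>r<Suc t. of_nat r * f r * \<alpha> ^ (r - 1)) = (\<Sum>r<t. of_nat (Suc r) * f (Suc r) * \<alpha> ^ r)"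
  by (subst sum.lessThan_Suc_shift) simp

text \<open>The right-hand side is in the normal form of \<open>k1\<close>, with coordinate
  \<open>0\<close> at \<open>\<alpha> ^ (p - 1)\<close>; from it the coordinates of a derivative can
  be read off.\<close>

lemma D_sum_shift_p:
  "(\<Sum>r<p. of_nat r * f r * \<alpha> ^ (r - 1)) =
     (\<Sum>r<p. (if Suc r < p then of_nat (Suc r) * f (Suc r) else 0) * \<alpha> ^ r)"
proof -
  obtain q where q: "p = Suc q" using p_gt_1 by (cases p) auto
  show ?thesis unfolding q by (subst sum.lessThan_Suc_shift) (simp add: sum.lessThan_Suc)
qed

lemma DI_k1: "i \<in> I \<Longrightarrow> x \<in> k1 \<Longrightarrow> DI i x \<in> k1"
  unfolding DI_def k1_def by (rule span_over_comb[OF K]) (use d_K co(1) in \<open>auto simp: k1_def\<close>)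

lemma D_k1: "x \<in> k1 \<Longrightarrow> D x \<in> k1"
  unfolding D_def D_sum_shift_p k1_def
  by (rule span_over_comb[OF K]) (use co(1) K in \<open>auto simp: k1_def is_subfield_zero is_subfield_mult is_subfield_of_nat simp del: of_nat_Suc\<close>)

lemma Dpow_k1: "x \<in> k1 \<Longrightarrow> (D ^^ t) x \<in> k1"
  by (induction t) (auto simp: D_k1)

text \<open>Product and chain rule on the expansion in powers of \<alpha>, with
  \<open>d i \<alpha> = e i\<close>.\<close>

lemma d_k1: 
  assumes "i \<in> I" "x \<in> k1"
  shows "d i x = DI i x + e i * D x"
proof -
  have "d i x = d i (\<Sum>r<p. co x r * \<alpha> ^ r)" using co(2)[OF assms(2)] by simp
  also have "\<dots> = (\<Sum>r<p. co x r * (of_nat r * \<alpha> ^ (r - 1) * e i) + d i (co x r) * \<alpha> ^ r)"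
    using assms by (simp add: d_sum d_mult d_alpha_power)
  also have "\<dots> = DI i x + e i * D x"
    unfolding DI_def D_def by (simp add: sum.distrib sum_distrib_left mult_ac)
  finally show ?thesis .
qed

lemma DI_D: assumes "i \<in> I" "x \<in> k1" shows "DI i (D x) = D (DI i x)"
proof -
  have 1: "DI i (D x) = (\<Sum>r<p. (if Suc r < p then of_nat (Suc r) * d i (co x (Suc r)) else 0) * \<alpha> ^ r)"
    unfolding D_def D_sum_shift_p
    by (subst DI_eq) (use co(1)[OF assms(2)] K assms in
      \<open>auto simp: is_subfield_zero is_subfield_mult is_subfield_of_nat d_mult d_of_nat d_0 simp del: of_nat_Suc intro!: sum.cong\<close>)
  have 2: "D (DI i x) = (\<Sum>r<p. of_nat r * d i (co x r) * \<alpha> ^ (r - 1))"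
    unfolding DI_def by (rule D_eq) (use co(1)[OF assms(2)] d_K assms in auto)
  show ?thesis unfolding 1 2 D_sum_shift_p ..
qed

lemma D_add: assumes "x \<in> k1" "y \<in> k1" shows "D (x + y) = D x + D y"
proof -
  have "x + y = (\<Sum>r<p. (co x r + co y r) * \<alpha> ^ r)"
    using co(2)[OF assms(1)] co(2)[OF assms(2)] by (simp add: distrib_right sum.distrib)
  then show ?thesis
    using D_eq[of "\<lambda>r. co x r + co y r"] co(1)[OF assms(1)] co(1)[OF assms(2)] K
    by (simp add: is_subfield_add D_def distrib_left distrib_right sum.distrib)
qed

lemma D_0: "D 0 = 0" 
  by (metis D_add k1(1) is_subfield_zero add_0_right add_cancel_right_right)

lemma D_sum: "(\<And>j. j \<in> J \<Longrightarrow> f j \<in> k1) \<Longrightarrow> D (sum f J) = (\<Sum>j\<in>J. D (f j))"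
  by (induction J rule: infinite_finite_induct)
    (auto simp: D_0 D_add is_subfield_sum[OF k1(1)])

text \<open>The exponent is unrestricted because products of basis powers exceed
  \<open>p - 1\<close> in the product rule. Surplus factors \<open>\<alpha> ^ p\<close> lie in
  \<open>K\<close> and behave as constants.\<close>

lemma D_monom:
  assumes "a \<in> K"
  shows "D (a * \<alpha> ^ n) = of_nat n * a * \<alpha> ^ (n - 1)"
proof -
  define b where "b = a * (\<alpha> ^ p) ^ (n div p)"
  define f where "f = (\<lambda>r. if r = n mod p then b else 0)"
  have m: "n mod p < p" using p_gt_1 by simp
  have bK: "b \<in> K" unfolding b_def using assms K pow_K by (simp add: is_subfield_mult is_subfield_power)
  have an: "\<alpha> ^ n = (\<alpha> ^ p) ^ (n div p) * \<alpha> ^ (n mod p)"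
    by (metis power_add power_mult div_mult_mod_eq mult.commute)
  have "a * \<alpha> ^ n = b * \<alpha> ^ (n mod p)" by (simp add: an b_def)
  also have "\<dots> = (\<Sum>r<p. f r * \<alpha> ^ r)" using m
    by (simp add: f_def if_distrib[of "\<lambda>x. x * _"] sum.delta cong: if_cong)
  finally have "D (a * \<alpha> ^ n) = (\<Sum>r<p. of_nat r * f r * \<alpha> ^ (r - 1))"
    using D_eq[of f] bK K by (simp add: f_def is_subfield_zero)
  also have "\<dots> = of_nat (n mod p) * b * \<alpha> ^ (n mod p - 1)" using m
    by (simp add: f_def if_distrib[of "\<lambda>x. x * _"] if_distrib[of "\<lambda>x. _ * x"] sum.delta cong: if_cong)
  also have "of_nat (n mod p) = (of_nat n :: 'g)"
    by (metis add_0 div_mult_mod_eq mult_zero_right of_nat_add of_nat_mult p(2))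
  also have "of_nat n * b * \<alpha> ^ (n mod p - 1) = of_nat n * a * \<alpha> ^ (n - 1)"
  \<comment> \<open>If \<open>p\<close> divides \<open>n\<close>, the truncated exponents on the two
    sides do not correspond, but the scalar \<open>n\<close> is zero.\<close>
  proof (cases "n mod p = 0")
    case True
    then have "of_nat n = (0::'g)" using p(2) by (auto simp: dvd_def)
    then show ?thesis by simp
  next
    case False
    then have "n - 1 = n div p * p + (n mod p - 1)"
      by (metis Nat.add_diff_assoc One_nat_def Suc_leI div_mult_mod_eq gr0I)
    then have "\<alpha> ^ (n - 1) = (\<alpha> ^ p) ^ (n div p) * \<alpha> ^ (n mod p - 1)"
      by (metis power_add power_mult mult.commute)
    then show ?thesis by (simp add: b_def)
  qed
  finally show ?thesis .
qed

lemma nat_power_leibniz: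
  "of_nat (r + s) * \<alpha> ^ (r + s - 1) =
     \<alpha> ^ r * (of_nat s * \<alpha> ^ (s - 1)) + (of_nat r * \<alpha> ^ (r - 1)) * \<alpha> ^ s"
  by (cases r; cases s) (simp_all add: algebra_simps power_add)

lemma D_mult: assumes x: "x \<in> k1" and y: "y \<in> k1" shows "D (x * y) = x * D y + D x * y"
proof -
  have m: "co x r * \<alpha> ^ r * (co y s * \<alpha> ^ s) = (co x r * co y s) * \<alpha> ^ (r + s)" for r s
    by (simp add: power_add mult_ac)
  have mK: "co x r * co y s \<in> K" if "r < p" "s < p" for r s
    using co(1)[OF x] co(1)[OF y] K that by (simp add: is_subfield_mult)
  have k: "(co x r * co y s) * \<alpha> ^ (r + s) \<in> k1" if "r < p" "s < p" for r s
    using mK[OF that] k1 by (meson is_subfield_mult subsetD)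
  have "x * y = (\<Sum>r<p. \<Sum>s<p. (co x r * co y s) * \<alpha> ^ (r + s))"
    by (subst co(2)[OF x], subst co(2)[OF y]) (simp add: sum_product m)
  then have "D (x * y) = (\<Sum>r<p. D (\<Sum>s<p. (co x r * co y s) * \<alpha> ^ (r + s)))"
    by (simp only:) (rule D_sum, use k in \<open>auto intro!: is_subfield_sum[OF k1(1)]\<close>)
  also have "\<dots> = (\<Sum>r<p. \<Sum>s<p. D ((co x r * co y s) * \<alpha> ^ (r + s)))"
    by (rule sum.cong[OF refl], rule D_sum) (use k in auto)
  also have "\<dots> = (\<Sum>r<p. \<Sum>s<p. (co x r * co y s) * (of_nat (r + s) * \<alpha> ^ (r + s - 1)))"
    
  proof (intro sum.cong refl)
    fix r s assume "r \<in> {..<p}" "s \<in> {..<p}"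
    then show "D (co x r * co y s * \<alpha> ^ (r + s)) = co x r * co y s * (of_nat (r + s) * \<alpha> ^ (r + s - 1))"
      using D_monom[OF mK, of r s "r + s"] by (simp only: lessThan_iff mult_ac)
  qed
  also have "\<dots> = (\<Sum>r<p. \<Sum>s<p. (co x r * \<alpha> ^ r) * (of_nat s * co y s * \<alpha> ^ (s - 1))) +
      (\<Sum>r<p. \<Sum>s<p. (of_nat r * co x r * \<alpha> ^ (r - 1)) * (co y s * \<alpha> ^ s))"
    unfolding nat_power_leibniz by (simp add: algebra_simps sum.distrib)
  also have "\<dots> = x * D y + D x * y"
    unfolding D_def by (subst (2) co(2)[OF x], subst (4) co(2)[OF y]) (simp add: sum_product)
  finally show ?thesis .
qed

text \<open>Each application of \<open>D\<close> lowers the bound on the degree in \<alpha> by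
  one.\<close>

lemma Dpow_p:
  assumes "x \<in> k1" shows "(D ^^ p) x = 0"
proof -
  have "(D ^^ s) x \<in> span_over K (\<lambda>r. \<alpha> ^ r) {..<p - s}" for s
  proof (induction s)
    case 0 then show ?case using assms by (simp add: k1_def)
  next
    case (Suc s)
    then obtain f where f: "\<forall>r<p - s. f r \<in> K" "(D ^^ s) x = (\<Sum>r<p - s. f r * \<alpha> ^ r)"
      unfolding span_over_def by auto
    have "f r * \<alpha> ^ r \<in> k1" if "r < p - s" for r using f(1) that k1 by (meson is_subfield_mult subsetD)
    then have *: "(D ^^ Suc s) x = (\<Sum>r<p - s. of_nat r * f r * \<alpha> ^ (r - 1))"
      unfolding funpow.simps o_def f(2) by (subst D_sum) (use f(1) in \<open>auto simp: D_monom\<close>)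
    show ?case
    proof (cases "p - s")
      case 0 then show ?thesis using * by (simp add: span_over_zero[OF K])
    next
      case (Suc t)
      have "(D ^^ Suc s) x = (\<Sum>r<t. of_nat (Suc r) * f (Suc r) * \<alpha> ^ r)"
        using * D_sum_shift[of t f] Suc by simp
      also have "\<dots> \<in> span_over K (\<lambda>r. \<alpha> ^ r) {..<t}"
        by (rule span_over_comb[OF K])
          (use f Suc K in \<open>auto simp: is_subfield_mult is_subfield_of_nat simp del: of_nat_Suc\<close>)
      moreover have "t = p - Suc s" using Suc by simp
      ultimately show ?thesis by (simp only:)
    qed
  qed
  from this[of p] show ?thesis by (simp add: span_over_def)
qed

text \<open>The scalars \<open>r\<close> with \<open>0 < r < p\<close> are invertible, so a zero
  derivative kills every coordinate except the constant one.\<close>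

lemma D_eq_0:
  assumes "x \<in> k1" "D x = 0" shows "x \<in> K"
proof -
  have c: "\<forall>r<p. co x r \<in> K" using co(1)[OF assms(1)] .
  have "(\<Sum>r<p. (if Suc r < p then of_nat (Suc r) * co x (Suc r) else 0) * \<alpha> ^ r) = 0"
    using assms(2) unfolding D_def D_sum_shift_p .
  moreover have "(if Suc r < p then of_nat (Suc r) * co x (Suc r) else 0) \<in> K" for r
    using c K by (simp add: is_subfield_zero is_subfield_mult is_subfield_of_nat del: of_nat_Suc)
  ultimately have *: "(if Suc r < p then of_nat (Suc r) * co x (Suc r) else 0) = 0" if "r < p" for r
    using that by (intro lin_indepD[OF indep_alpha, of "\<lambda>r. if Suc r < p then of_nat (Suc r) * co x (Suc r) else 0"])
      (simp_all only: lessThan_iff)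
  have z: "co x r = 0" if "0 < r" "r < p" for r
  proof -
    have "of_nat r * co x r = 0" using *[of "r - 1"] that by (simp split: if_splits)
    then show ?thesis using of_nat_eq_0_char[OF p that] by simp
  qed
  have "x = (\<Sum>r<p. co x r * \<alpha> ^ r)" by (rule co(2)[OF assms(1)])
  also have "\<dots> = (\<Sum>r\<in>{0}. co x r * \<alpha> ^ r)"
    using p_gt_1 z by (intro sum.mono_neutral_right) auto
  also have "\<dots> = co x 0" by simp
  finally show ?thesis using c p_gt_1 by (metis gr_implies_not0 gr0I)
qed

text \<open>\<open>D\<close> is nilpotent, and a relation killed by \<open>D\<close> has coefficients in \<open>K\<close>, hence is trivial.\<close>

lemma derived_relation_fails:
  assumes "lin_indep K b W" "\<And>w. w \<in> W \<Longrightarrow> c w \<in> k1" "(\<Sum>w\<in>W. c w * b w) = 0" "\<exists>w\<in>W. c w \<noteq> 0"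
  obtains t where "\<And>s. s \<le> t \<Longrightarrow> (\<Sum>w\<in>W. (D ^^ s) (c w) * b w) = 0"
    "(\<Sum>w\<in>W. (D ^^ Suc t) (c w) * b w) \<noteq> 0"
proof -
  have "\<exists>t. (\<forall>s\<le>t. (\<Sum>w\<in>W. (D ^^ s) (c w) * b w) = 0) \<and>
    (\<Sum>w\<in>W. (D ^^ Suc t) (c w) * b w) \<noteq> 0"
  proof (rule ccontr)
    assume n: "\<not> ?thesis"
    have all: "(\<Sum>w\<in>W. (D ^^ s) (c w) * b w) = 0" for s
    proof (induction s rule: less_induct)
      case (less s)
      show ?case
      proof (cases s)
        case 0 then show ?thesis using assms(3) by simp
      next
        case (Suc t)
        then have "\<forall>s\<le>t. (\<Sum>w\<in>W. (D ^^ s) (c w) * b w) = 0" using less by auto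
        then show ?thesis using n unfolding Suc by blast
      qed
    qed
    let ?P = "\<lambda>t. \<forall>w\<in>W. (D ^^ t) (c w) = 0"
    have "?P p" using assms(2) Dpow_p by blast
    then obtain t where t: "?P t" "\<And>s. s < t \<Longrightarrow> \<not> ?P s"
      using exists_least_iff[of ?P] by blast
    have "t \<noteq> 0" using t(1) assms(4) by (cases t) auto
    then obtain s where s: "t = Suc s" by (cases t) auto
    have "(D ^^ s) (c w) \<in> K" if "w \<in> W" for w
      using t(1) that s by (intro D_eq_0 Dpow_k1 assms(2)) auto
    then have "?P s"
      using assms(1)[unfolded lin_indep_def, rule_format, of "\<lambda>w. (D ^^ s) (c w)"] all[of s] by simp
    then show False using t(2)[of s] s by blast
  qed
  then show ?thesis using that by blast
qed

text \<open>Apply \<open>d i\<close> to the relation: the \<open>b w\<close> are constants for it,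
  and \<open>d_k1\<close> splits the derivative of each coefficient into the two sums.\<close>

lemma relation_derivative:
  assumes W: "\<And>i w. i \<in> I \<Longrightarrow> w \<in> W \<Longrightarrow> d i (b w) = 0"
    and c: "\<And>w. w \<in> W \<Longrightarrow> c w \<in> k1" "(\<Sum>w\<in>W. c w * b w) = 0" and i: "i \<in> I"
  shows "e i * (\<Sum>w\<in>W. D (c w) * b w) = - (\<Sum>w\<in>W. DI i (c w) * b w)"
proof -
  have "0 = d i (\<Sum>w\<in>W. c w * b w)" using c d_0 i by simp
  also have "\<dots> = (\<Sum>w\<in>W. DI i (c w) * b w + e i * (D (c w) * b w))"
    unfolding d_sum[OF i] by (intro sum.cong refl) (simp add: d_mult i W d_k1 c algebra_simps)
  finally show ?thesis by (simp add: sum.distrib sum_distrib_left eq_neg_iff_add_eq_0 add.commute)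
qed

text \<open>For \<open>i\<close> in \<open>I\<close> the product is a combination of the
  \<open>b w\<close> by \<open>relation_derivative\<close>; at \<open>i0\<close>, where no
  derivation exists, \<open>e i0 = 1\<close> makes it one as well.\<close>

lemma e_relation_derivative:
  assumes W: "\<And>i w. i \<in> I \<Longrightarrow> w \<in> W \<Longrightarrow> d i (b w) = 0"
    and c: "\<And>w. w \<in> W \<Longrightarrow> c w \<in> k1" "(\<Sum>w\<in>W. c w * b w) = 0" and i: "i \<in> insert i0 I"
  shows "e i * (\<Sum>w\<in>W. D (c w) * b w) \<in> span_over k1 b W"
proof (cases "i = i0")
  case True
  then show ?thesis using c(1) by (simp add: e_o span_over_comb[OF k1(1)] D_k1)
next
  case False
  then have "i \<in> I" using i by simp
  then show ?thesis using c(1)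
    unfolding relation_derivative[OF W c \<open>i \<in> I\<close>, simplified]
    by (intro span_over_uminus[OF k1(1)] span_over_comb[OF k1(1)]) (simp add: DI_k1)
qed

section \<open>The span \<open>A'\<close> of the coefficients and its stabilizer field
  \<open>N\<close>\<close>

abbreviation "A \<equiv> insert i0 I"
definition "A' = span_over k1 e A"
definition "N = {x. \<forall>i\<in>A. e i * x \<in> A'}"

lemma fin_A: "finite A" using I by simp

lemma A'_mult_N: assumes "x \<in> N" "y \<in> A'" shows "x * y \<in> A'"
proof -
  obtain c where y: "y = (\<Sum>i\<in>A. c i * e i)" "\<forall>i\<in>A. c i \<in> k1"
    using assms(2) unfolding A'_def span_over_def by auto
  have "x * y = (\<Sum>i\<in>A. c i * (e i * x))" unfolding y(1) sum_distrib_left by (simp only: mult_ac)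
  also have "\<dots> \<in> A'" unfolding A'_def
    by (rule span_over_sum[OF k1(1)], rule span_over_scale[OF k1(1)]) (use y assms in \<open>auto simp: N_def A'_def\<close>)
  finally show ?thesis .
qed

lemma e_A': "i \<in> A \<Longrightarrow> e i \<in> A'"
  unfolding A'_def using span_over_base[OF k1(1) fin_A] .

lemma one_A': "1 \<in> A'" using e_A'[of i0] e_o by simp

text \<open>Stability under products is formal, \<open>N \<subseteq> A'\<close> comes from
  \<open>e i0 = 1\<close>, and inverses come from p-th powers lying in \<open>K\<close>.\<close>

lemma N: "is_subfield N" "k1 \<subseteq> N" "N \<subseteq> A'"
proof -
  show kN: "k1 \<subseteq> N"
  proof
    fix x assume "x \<in> k1"
    have "x * e i \<in> A'" if "i \<in> A" for i
      using span_over_scale[OF k1(1) e_A'[OF that, unfolded A'_def] \<open>x \<in> k1\<close>] unfolding A'_def .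
    then show "x \<in> N" unfolding N_def by (simp only: mem_Collect_eq mult.commute) blast
  qed
  show NA: "N \<subseteq> A'" using e_o by (auto simp: N_def)
  show "is_subfield N"
  proof (rule is_subfieldI_power[OF _ _ _ K _ pow_K])
    show "1 \<in> N" using kN k1(1) is_subfield_one by blast
    show "x - y \<in> N" if "x \<in> N" "y \<in> N" for x y
      using that unfolding N_def A'_def by (auto simp: right_diff_distrib intro: span_over_diff[OF k1(1)])
    show "x * y \<in> N" if "x \<in> N" "y \<in> N" for x y
    proof -
      have "x * (e i * y) \<in> A'" if "i \<in> A" for i
        using A'_mult_N[OF \<open>x \<in> N\<close>] \<open>y \<in> N\<close> that unfolding N_def by blast
      then show ?thesis unfolding N_def by (simp add: mult_ac)
    qed
    show "K \<subseteq> N" using kN k1(2) by blast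
    show "0 < p" using p_gt_1 by simp
  qed
qed

text \<open>\<open>A'\<close> is a nonzero vector space over \<open>N\<close>, so the tower law
  makes its dimension a positive multiple of the degree of \<open>N\<close>, which is a power of
  \<open>p\<close> by \<open>dim_p_power\<close>.\<close>

lemma N_dim: 
  obtains m s where "FR.finite_dimension k1 N" "FR.dim k1 N = p ^ m" "FR.finite_dimension k1 A'"
    "FR.dim k1 A' = p ^ m * s" "s > 0"
proof -
  have fA: "FR.finite_dimension k1 A'" unfolding A'_def by (rule finite_dimension_span_over[OF k1(1) fin_A])
  have fN: "FR.finite_dimension k1 N"
  proof (rule finite_dimension_subspace[OF k1(1) fA _ N(3)])
    show "subalgebra k1 N field_ring"
      by (rule subalgebraI[OF _ _ _ k1(1)])
        (use N in \<open>auto simp: is_subfield_zero is_subfield_add is_subfield_mult subsetD\<close>)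
  qed
  have "x ^ p \<in> k1" for x using pow_K k1(2) by blast
  then obtain m where m: "FR.dim k1 N = p ^ m"
    using dim_p_power[OF p k1(1) N(1,2) _ fN] by blast
  have "A' = span_over N e A"
  proof
    show "A' \<subseteq> span_over N e A" unfolding A'_def span_over_def using N(2) by blast
    show "span_over N e A \<subseteq> A'"
      by (rule span_over_least) (use e_A' A'_mult_N span_over_zero[OF k1(1)] span_over_add[OF k1(1)] in \<open>auto simp: A'_def\<close>)
  qed
  then have fNA: "FR.finite_dimension N A'" using finite_dimension_span_over[OF N(1) fin_A] by metis
  have t: "FR.dim k1 A' = p ^ m * FR.dim N A'" using telescopic_dim(2)[OF k1(1) N(1) fN fNA] m by simp
  have "FR.dim k1 A' \<ge> card {i0}"
    by (rule indep_card_le_dim[OF k1(1) _ _ _ fA, of _ e]) (auto simp: lin_indep_def e_o one_A')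
  then have "FR.dim N A' > 0" using t by (cases "FR.dim N A'") auto
  then show ?thesis using that fN m fA t by blast
qed

text \<open>With \<open>v = \<Sum> D(D(c\<^sub>w)) e\<^sub>w\<close>, applying \<open>\<partial>\<^sub>i\<close> and \<open>\<partial>\<^sub>j\<close> to the relation \<open>c\<close> shows \<open>e\<^sub>i e\<^sub>j v \<in> A'\<close>, and \<open>v\<close> is
  a unit of \<open>N\<close>.\<close>

lemma mult_closed_of_second_order_relation:
  assumes c: "\<And>w. w \<in> A \<Longrightarrow> c w \<in> k1" "(\<Sum>w\<in>A. c w * e w) = 0" "(\<Sum>w\<in>A. D (c w) * e w) = 0"
    and v: "(\<Sum>w\<in>A. D (D (c w)) * e w) \<noteq> 0"
  shows "A' = N"
proof -
  define v where "v = (\<Sum>w\<in>A. D (D (c w)) * e w)"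
  have vN: "v \<in> N" unfolding v_def N_def A'_def
    using e_relation_derivative[OF d_e _ c(3)] c(1) D_k1 by blast
  have eN: "e i * e j * v \<in> A'" if i: "i \<in> A" and j: "j \<in> A" for i j
  proof (cases "i = i0 \<or> j = i0")
    case True
    then show ?thesis using i j vN by (auto simp: e_o N_def)
  next
    case False
    then have i: "i \<in> I" and j: "j \<in> I" using i j by auto
    have *: "(\<Sum>w\<in>A. DI j (c w) * e w) = 0"
      using relation_derivative[OF d_e c(1,2) j] c(3) by simp
    have "e j * v = - (\<Sum>w\<in>A. D (DI j (c w)) * e w)"
      unfolding v_def using relation_derivative[OF d_e _ c(3) j] c(1) D_k1 DI_D[OF j]
      by (simp del: sum.insert)
    then have "e i * e j * v = - (e i * (\<Sum>w\<in>A. D (DI j (c w)) * e w))"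
      by (simp only: mult.assoc mult_minus_right)
    also have "\<dots> \<in> A'" unfolding A'_def
      using e_relation_derivative[OF d_e _ * ] i c(1) DI_k1[OF j] span_over_uminus[OF k1(1)] by blast
    finally show ?thesis .
  qed
  have "inverse v \<in> N" using vN N(1) is_subfield_inverse by blast
  have "e i * e j \<in> A'" if "i \<in> A" "j \<in> A" for i j
    using A'_mult_N[OF \<open>inverse v \<in> N\<close> eN[OF that]] v by (simp add: v_def field_simps del: sum.insert)
  then have "e j \<in> N" if "j \<in> A" for j using that by (simp add: N_def)
  then have "A' \<subseteq> N" unfolding A'_def
    by (intro span_over_least) (use N in \<open>auto simp: is_subfield_zero is_subfield_add is_subfield_mult subsetD\<close>)
  then show ?thesis using N(3) by blast
qed

text \<open>The \<open>e i\<close>, independent over \<open>K\<close>, all lie in \<open>N\<close>,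
  whose degree over \<open>K\<close> is \<open>p * p ^ m\<close>.\<close>

lemma card_le_of_field:
  assumes "A' = N" "FR.dim k1 N = p ^ m" "FR.finite_dimension k1 N"
  shows "card A \<le> p ^ Suc m"
proof -
  have d: "FR.finite_dimension K k1" "FR.dim K k1 = p"
    unfolding k1_def using dim_span_over_indep[OF K _ indep_alpha] by auto
  have "card A \<le> FR.dim K N"
    using telescopic_dim(1)[OF K k1(1) d(1) assms(3)] e_A' assms(1)
    by (intro indep_card_le_dim[OF K fin_A indep_e]) auto
  also have "\<dots> = p * p ^ m" using telescopic_dim(2)[OF K k1(1) d(1) assms(3)] d(2) assms(2) by simp
  finally show ?thesis by simp
qed

text \<open>The relations over \<open>k1\<close> among the \<open>e w\<close> form a space of
  dimension \<open>card A - dim A'\<close>. The map from a relation \<open>c\<close> to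
  \<open>\<Sum> D(c\<^sub>w) e\<^sub>w\<close> is \<open>k1\<close>-linear on it, takes values in
  \<open>N\<close>, and is injective by \<open>no\<close>.\<close>

lemma card_le_of_first_order:
  assumes no: "\<And>c. (\<And>w. w \<in> A \<Longrightarrow> c w \<in> k1) \<Longrightarrow> (\<Sum>w\<in>A. c w * e w) = 0 \<Longrightarrow>
      (\<Sum>w\<in>A. D (c w) * e w) = 0 \<Longrightarrow> (\<Sum>w\<in>A. D (D (c w)) * e w) = 0"
    and fin: "FR.finite_dimension k1 N"
  shows "card A \<le> FR.dim k1 A' + FR.dim k1 N"
proof -
  \<comment> \<open>For nonzero \<open>c\<close>, let order \<open>t\<close> be the last before the
    derived relations first fail. Here \<open>t > 0\<close>, and the derivative of order
    \<open>t - 1\<close> contradicts \<open>no\<close>.\<close>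
  have inj: "\<forall>w\<in>A. c w = 0"
    if c: "\<And>w. w \<in> A \<Longrightarrow> c w \<in> k1" "(\<Sum>w\<in>A. c w * e w) = 0" "(\<Sum>w\<in>A. D (c w) * e w) = 0" for c
  proof (rule ccontr)
    assume "\<not> ?thesis"
    then obtain t where t: "\<And>s. s \<le> t \<Longrightarrow> (\<Sum>w\<in>A. (D ^^ s) (c w) * e w) = 0"
      "(\<Sum>w\<in>A. (D ^^ Suc t) (c w) * e w) \<noteq> 0"
      using derived_relation_fails[OF indep_e c(1,2)] by blast
    have "t \<noteq> 0" using t(2) c(3) by (cases t) auto
    then obtain s where s: "t = Suc s" by (cases t) auto
    have "(\<Sum>w\<in>A. D (D ((D ^^ s) (c w))) * e w) = 0"
      using t(1)[of s] t(1)[of t] s by (intro no Dpow_k1 c(1)) (simp_all del: sum.insert)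
    then show False using t(2) s by (simp del: sum.insert)
  qed
  obtain J where J: "J \<subseteq> A" "lin_indep k1 e J" "span_over k1 e J = A'"
    using ex_basis[OF k1(1) fin_A, of e] unfolding A'_def by blast
  have fJ: "finite J" using J fin_A finite_subset by blast
  have "\<exists>c. (\<forall>j\<in>J. c j \<in> k1) \<and> e i = (\<Sum>j\<in>J. c j * e j)" if "i \<in> A" for i
    using e_A'[OF that] unfolding J(3)[symmetric] span_over_def by auto
  then obtain c where c: "\<And>i j. i \<in> A \<Longrightarrow> j \<in> J \<Longrightarrow> c i j \<in> k1" "\<And>i. i \<in> A \<Longrightarrow> e i = (\<Sum>j\<in>J. c i j * e j)"
    by metis
  \<comment> \<open>The relation expressing \<open>e i\<close> through the basis \<open>J\<close>.
    The entry \<open>- 1\<close> at \<open>i\<close> lets a combination of these relations recover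
    its coefficients.\<close>
  define r where "r i w = (if w \<in> J then c i w else if w = i then - 1 else 0)" for i w
  define v where "v i = (\<Sum>w\<in>A. D (r i w) * e w)" for i
  let ?L = "A - J"
  have rk: "r i w \<in> k1" if "i \<in> A" for i w
    using c(1) that k1(1) by (auto simp: r_def is_subfield_zero is_subfield_one is_subfield_uminus)
  have rel: "(\<Sum>w\<in>A. r i w * e w) = 0" if "i \<in> ?L" for i
  proof -
    have "(\<Sum>w\<in>A. r i w * e w) = (\<Sum>w\<in>J. r i w * e w) + (\<Sum>w\<in>?L. r i w * e w)"
      using fin_A J(1) by (metis (no_types, lifting) add.commute sum.subset_diff)
    also have "(\<Sum>w\<in>J. r i w * e w) = e i" using c(2)[of i] that by (simp add: r_def)
    also have "(\<Sum>w\<in>?L. r i w * e w) = (\<Sum>w\<in>?L. if w = i then - e i else 0)"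
      by (intro sum.cong) (auto simp: r_def)
    also have "\<dots> = - e i" using that fin_A by (subst sum.delta) auto
    finally show ?thesis by simp
  qed
  have vN: "v i \<in> N" if "i \<in> ?L" for i
    unfolding v_def N_def A'_def
    using e_relation_derivative[OF d_e rk rel[OF that]] that by (auto simp del: sum.insert)
  have "lin_indep k1 v ?L"
    unfolding lin_indep_def
  proof (intro allI impI)
    fix f assume f: "\<forall>i\<in>?L. f i \<in> k1" "(\<Sum>i\<in>?L. f i * v i) = 0"
    define g where "g w = (\<Sum>i\<in>?L. f i * r i w)" for w
    have gk: "g w \<in> k1" for w unfolding g_def
      using f(1) rk k1(1) by (intro is_subfield_sum[OF k1(1)]) (auto simp: is_subfield_mult)
    have "(\<Sum>w\<in>A. g w * e w) = (\<Sum>i\<in>?L. f i * (\<Sum>w\<in>A. r i w * e w))"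
      unfolding g_def sum_distrib_right sum_distrib_left mult.assoc by (rule sum.swap)
    also have "\<dots> = 0" using rel by (intro sum.neutral) auto
    finally have 1: "(\<Sum>w\<in>A. g w * e w) = 0" .
    \<comment> \<open>Leibniz rule: the terms with \<open>D (f i)\<close> sum to zero because every
      \<open>r i\<close> is itself a relation, which is the linearity of the map.\<close>
    have "D (g w) = (\<Sum>i\<in>?L. f i * D (r i w) + D (f i) * r i w)" for w
      unfolding g_def
      by (subst D_sum) (use f(1) rk k1(1) in \<open>auto simp: is_subfield_mult D_mult\<close>)
    then have "(\<Sum>w\<in>A. D (g w) * e w) = (\<Sum>w\<in>A. \<Sum>i\<in>?L. f i * (D (r i w) * e w) + D (f i) * (r i w * e w))"
      by (simp only: sum_distrib_right distrib_right mult.assoc)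
    also have "\<dots> = (\<Sum>i\<in>?L. \<Sum>w\<in>A. f i * (D (r i w) * e w) + D (f i) * (r i w * e w))"
      by (rule sum.swap)
    also have "\<dots> = (\<Sum>i\<in>?L. f i * v i + D (f i) * (\<Sum>w\<in>A. r i w * e w))"
      by (simp only: sum.distrib sum_distrib_left v_def)
    also have "\<dots> = (\<Sum>i\<in>?L. f i * v i)"
      using rel by (intro sum.cong refl) (simp del: sum.insert)
    finally have 2: "(\<Sum>w\<in>A. D (g w) * e w) = 0" using f(2) by simp
    have z: "\<forall>w\<in>A. g w = 0" using inj[of g] gk 1 2 by blast
    show "\<forall>i\<in>?L. f i = 0"
    proof
      fix i assume i: "i \<in> ?L"
      have "g i = (\<Sum>j\<in>?L. if j = i then - f i else 0)"
        unfolding g_def by (intro sum.cong refl) (use i in \<open>auto simp: r_def\<close>)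
      also have "\<dots> = - f i" using i fin_A by (subst sum.delta) auto
      finally show "f i = 0" using z i by (metis DiffD1 neg_equal_0_iff_equal)
    qed
  qed
  then have "card ?L \<le> FR.dim k1 N"
    using vN fin_A by (intro indep_card_le_dim[OF k1(1) _ _ _ fin]) auto
  moreover have "card J = FR.dim k1 A'" using dim_span_over_indep(2)[OF k1(1) fJ J(2)] J(3) by simp
  moreover have "card A = card J + card ?L"
    using fin_A J(1) by (metis card_Diff_subset card_mono fJ le_add_diff_inverse)
  ultimately show ?thesis by simp
qed

theorem indep_over_k1:
  assumes W: "finite W" "\<And>i w. i \<in> I \<Longrightarrow> w \<in> W \<Longrightarrow> d i (b w) = 0" "lin_indep K b W"
    and card: "card W \<le> p ^ n" "p ^ n < card A"
  shows "lin_indep k1 b W"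
proof (rule ccontr)
  assume dep: "\<not> ?thesis"
  then obtain c where c: "\<And>w. w \<in> W \<Longrightarrow> c w \<in> k1" "(\<Sum>w\<in>W. c w * b w) = 0" "\<exists>w\<in>W. c w \<noteq> 0"
    unfolding lin_indep_def by blast
  \<comment> \<open>The derivative of order \<open>t\<close> is the suitable relation: it still
    holds, and its own derivative gives a nonzero \<open>v\<close>.\<close>
  obtain t where t: "(\<Sum>w\<in>W. (D ^^ t) (c w) * b w) = 0" "(\<Sum>w\<in>W. (D ^^ Suc t) (c w) * b w) \<noteq> 0"
    using derived_relation_fails[OF W(3) c(1) c(2,3)] by (metis order_refl)
  have "FR.dim k1 A' \<le> FR.dim k1 (span_over k1 b W)"
    unfolding A'_def
  proof (rule dim_span_over_scale_le[OF k1(1) fin_A])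
    show "(\<Sum>w\<in>W. D ((D ^^ t) (c w)) * b w) \<noteq> 0" using t(2) by simp
    show "e i * (\<Sum>w\<in>W. D ((D ^^ t) (c w)) * b w) \<in> span_over k1 b W" if "i \<in> A" for i
      by (rule e_relation_derivative[OF W(2) Dpow_k1 t(1) that]) (auto simp: c(1))
    show "FR.finite_dimension k1 (span_over k1 b W)" by (rule finite_dimension_span_over[OF k1(1) W(1)])
  qed
  also have "\<dots> < card W" by (rule dim_span_over_less[OF k1(1) W(1) dep])
  finally have lt: "FR.dim k1 A' < p ^ n" using card(1) by simp
  obtain m s where ms: "FR.finite_dimension k1 N" "FR.dim k1 N = p ^ m" "FR.finite_dimension k1 A'"
    "FR.dim k1 A' = p ^ m * s" "s > 0" by (rule N_dim)
  have "p ^ m \<le> p ^ m * s" using ms(5) by simp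
  then have "p ^ m < p ^ n" using lt ms(4) by linarith
  then have mn: "m < n" using p_gt_1 by (meson nat_power_less_imp_less leI leD power_increasing less_imp_le)
  show False
  proof (cases "\<exists>c. (\<forall>w\<in>A. c w \<in> k1) \<and> (\<Sum>w\<in>A. c w * e w) = 0 \<and>
      (\<Sum>w\<in>A. D (c w) * e w) = 0 \<and> (\<Sum>w\<in>A. D (D (c w)) * e w) \<noteq> 0")
    case True
    then have "A' = N" using mult_closed_of_second_order_relation by blast
    then have "card A \<le> p ^ Suc m" by (rule card_le_of_field[OF _ ms(2,1)])
    also have "\<dots> \<le> p ^ n" using mn p_gt_1 by (intro power_increasing) auto
    finally show False using card(2) by simp
  next
    case False
    then have "card A \<le> FR.dim k1 A' + FR.dim k1 N"
      by (intro card_le_of_first_order ms(1)) blast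
    also have "\<dots> = p ^ m * (s + 1)" using ms by simp
    also have "\<dots> \<le> p ^ m * p ^ (n - m)"
    proof -
      \<comment> \<open>Cancelling \<open>p ^ m\<close> turns the strict inequality into
        \<open>s + 1 \<le> p ^ (n - m)\<close>; this is where the bound has to be a power of
        \<open>p\<close>.\<close>
      have "p ^ m * s < p ^ m * p ^ (n - m)" using lt ms(4) mn by (simp flip: power_add)
      then show ?thesis by (intro mult_le_mono2) simp
    qed
    also have "\<dots> = p ^ n" using mn by (simp flip: power_add)
    finally show False using card(2) by simp
  qed
qed

end

section \<open>The generic field\<close>

abbreviation "single \<equiv> Poly_Mapping.single"
abbreviation "lookup \<equiv> Poly_Mapping.lookup"
abbreviation "keys \<equiv> Poly_Mapping.keys"

lemma sum_single_lookup: "(\<Sum>m\<in>keys f. single m (lookup f m)) = f"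
proof (rule poly_mapping_eqI)
  fix k
  have "lookup (\<Sum>m\<in>keys f. single m (lookup f m)) k = (\<Sum>m\<in>keys f. if m = k then lookup f m else 0)"
    unfolding lookup_sum by (intro sum.cong refl) (simp add: lookup_single when_def)
  also have "\<dots> = lookup f k" by (simp add: sum.delta in_keys_iff)
  finally show "lookup (\<Sum>m\<in>keys f. single m (lookup f m)) k = lookup f k" .
qed

lemma poly_mapping_sum_induct [case_names zero single_add]:
  assumes "P 0" "\<And>m c f. P f \<Longrightarrow> P (single m c + f)"
  shows "P (f :: 'a \<Rightarrow>\<^sub>0 'b::comm_monoid_add)"
proof -
  have "P (\<Sum>m\<in>S. single m (lookup f m))" if "finite S" for S
    using that by (induction S) (auto intro: assms)
  from this[of "keys f"] show ?thesis by (simp add: sum_single_lookup)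
qed

text \<open>The common pattern behind evaluation of polynomials and formal partial derivatives: a
  map prescribed on single terms and additive in the coefficient.\<close>

locale additive_on_coeffs =
  fixes T :: "'m \<Rightarrow> 'c::comm_monoid_add \<Rightarrow> 'r::comm_monoid_add"
  assumes T_0: "T m 0 = 0" and T_add: "T m (c + c') = T m c + T m c'"
begin

definition lin :: "('m \<Rightarrow>\<^sub>0 'c) \<Rightarrow> 'r" where "lin f = (\<Sum>m\<in>keys f. T m (lookup f m))"

lemma lin_superset: "finite S \<Longrightarrow> keys f \<subseteq> S \<Longrightarrow> lin f = (\<Sum>m\<in>S. T m (lookup f m))"
  unfolding lin_def by (rule sum.mono_neutral_left) (auto simp: in_keys_iff T_0)

lemma lin_add: "lin (f + g) = lin f + lin g"
proof -
  let ?S = "keys f \<union> keys g"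
  have "lin (f + g) = (\<Sum>m\<in>?S. T m (lookup (f + g) m))"
    by (rule lin_superset) (use Poly_Mapping.keys_add[of f g] in auto)
  also have "\<dots> = lin f + lin g"
    by (simp add: lookup_add T_add sum.distrib lin_superset[of ?S])
  finally show ?thesis .
qed

lemma lin_0: "lin 0 = 0" by (simp add: lin_def)

lemma lin_single: "lin (single m c) = T m c"
  by (cases "c = 0") (auto simp: lin_def T_0)

lemma lin_sum: "lin (sum f J) = (\<Sum>j\<in>J. lin (f j))"
  by (induction J rule: infinite_finite_induct) (auto simp: lin_0 lin_add)

end

definition eval_monomial :: "('v \<Rightarrow> 'r::comm_semiring_1) \<Rightarrow> ('v \<Rightarrow>\<^sub>0 nat) \<Rightarrow> 'r" where
  "eval_monomial \<xi> m = (\<Prod>b\<in>keys m. \<xi> b ^ lookup m b)"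

lemma eval_monomial_superset: "finite S \<Longrightarrow> keys m \<subseteq> S \<Longrightarrow> eval_monomial \<xi> m = (\<Prod>b\<in>S. \<xi> b ^ lookup m b)"
  unfolding eval_monomial_def by (rule prod.mono_neutral_left) (auto simp: in_keys_iff)

lemma eval_monomial_add: "eval_monomial \<xi> (m + n) = eval_monomial \<xi> m * eval_monomial \<xi> n"
proof -
  let ?S = "keys m \<union> keys n"
  have "eval_monomial \<xi> (m + n) = (\<Prod>b\<in>?S. \<xi> b ^ lookup (m + n) b)"
    by (rule eval_monomial_superset) (use Poly_Mapping.keys_add[of m n] in auto)
  also have "\<dots> = eval_monomial \<xi> m * eval_monomial \<xi> n"
    by (simp add: lookup_add power_add prod.distrib eval_monomial_superset[of ?S])
  finally show ?thesis .
qed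

lemma eval_monomial_0 [simp]: "eval_monomial \<xi> 0 = 1" by (simp add: eval_monomial_def)

lemma eval_monomial_single: "eval_monomial \<xi> (single b k) = \<xi> b ^ k"
  by (cases "k = 0") (auto simp: eval_monomial_def)

lemma eval_monomial_in:
  assumes "1 \<in> S" "\<And>x y. x \<in> S \<Longrightarrow> y \<in> S \<Longrightarrow> x * y \<in> S" "\<And>b. b \<in> keys m \<Longrightarrow> \<xi> b \<in> S"
  shows "eval_monomial \<xi> m \<in> S"
proof -
  have "x ^ k \<in> S" if "x \<in> S" for x k using that assms by (induction k) auto
  then have "(\<Prod>b\<in>L. \<xi> b ^ lookup m b) \<in> S" if "L \<subseteq> keys m" for L
    using that by (induction L rule: infinite_finite_induct) (use assms in auto)
  then show ?thesis unfolding eval_monomial_def by auto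
qed

locale coeff_hom =
  fixes \<sigma> :: "'c::comm_ring_1 \<Rightarrow> 'r::comm_ring_1"
  assumes s_0: "\<sigma> 0 = 0" and s_1: "\<sigma> 1 = 1" and s_add: "\<sigma> (a + b) = \<sigma> a + \<sigma> b"
    and s_mult: "\<sigma> (a * b) = \<sigma> a * \<sigma> b"

definition eval_mpoly :: "('c::zero \<Rightarrow> 'r::comm_ring_1) \<Rightarrow> ('v \<Rightarrow> 'r) \<Rightarrow> (('v \<Rightarrow>\<^sub>0 nat) \<Rightarrow>\<^sub>0 'c) \<Rightarrow> 'r" where
  "eval_mpoly \<sigma> \<xi> f = (\<Sum>m\<in>keys f. \<sigma> (lookup f m) * eval_monomial \<xi> m)"

context coeff_hom
begin

interpretation L: additive_on_coeffs "\<lambda>m c. \<sigma> c * eval_monomial \<xi> m" for \<xi> :: "'v \<Rightarrow> 'r"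
  by standard (auto simp: s_0 s_add distrib_right)

lemma eval_mpoly_lin: "eval_mpoly \<sigma> \<xi> f = L.lin \<xi> f" by (simp add: eval_mpoly_def L.lin_def)

lemma eval_mpoly_0 [simp]: "eval_mpoly \<sigma> \<xi> 0 = 0" by (simp add: eval_mpoly_lin L.lin_0)

lemma eval_mpoly_add: "eval_mpoly \<sigma> \<xi> (f + g) = eval_mpoly \<sigma> \<xi> f + eval_mpoly \<sigma> \<xi> g" by (simp add: eval_mpoly_lin L.lin_add)

lemma eval_mpoly_sum: "eval_mpoly \<sigma> \<xi> (sum f J) = (\<Sum>j\<in>J. eval_mpoly \<sigma> \<xi> (f j))" by (simp add: eval_mpoly_lin L.lin_sum)

lemma eval_mpoly_single: "eval_mpoly \<sigma> \<xi> (single m c) = \<sigma> c * eval_monomial \<xi> m" by (simp add: eval_mpoly_lin L.lin_single)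

lemma eval_mpoly_1 [simp]: "eval_mpoly \<sigma> \<xi> 1 = 1"
  using eval_mpoly_single[of \<xi> 0 1] by (simp add: s_1)

lemma eval_mpoly_mult: "eval_mpoly \<sigma> \<xi> (f * g) = eval_mpoly \<sigma> \<xi> f * eval_mpoly \<sigma> \<xi> g"
proof (induction f rule: poly_mapping_sum_induct)
  case (single_add m c f)
  have "eval_mpoly \<sigma> \<xi> (single m c * g) = eval_mpoly \<sigma> \<xi> (single m c) * eval_mpoly \<sigma> \<xi> g"
  proof (induction g rule: poly_mapping_sum_induct)
    case (single_add n c' g)
    have "eval_mpoly \<sigma> \<xi> (single m c * single n c') = eval_mpoly \<sigma> \<xi> (single m c) * eval_mpoly \<sigma> \<xi> (single n c')"
      by (simp add: mult_single eval_mpoly_single eval_monomial_add s_mult mult_ac)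
    then show ?case by (simp add: distrib_left eval_mpoly_add single_add)
  qed simp
  then show ?case by (simp add: distrib_right eval_mpoly_add single_add)
qed simp

lemma eval_mpoly_uminus: "eval_mpoly \<sigma> \<xi> (- f) = - eval_mpoly \<sigma> \<xi> f"
  using eval_mpoly_add[of \<xi> f "- f"] by (simp add: eq_neg_iff_add_eq_0 add.commute)

lemma eval_mpoly_diff: "eval_mpoly \<sigma> \<xi> (f - g) = eval_mpoly \<sigma> \<xi> f - eval_mpoly \<sigma> \<xi> g"
  using eval_mpoly_add[of \<xi> f "- g"] by (simp add: eval_mpoly_uminus)

lemma eval_mpoly_power: "eval_mpoly \<sigma> \<xi> (f ^ n) = eval_mpoly \<sigma> \<xi> f ^ n"
  by (induction n) (auto simp: eval_mpoly_mult)

end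

text \<open>The variables are indexed by \<open>nat\<close> because \<open>_ \<Rightarrow>\<^sub>0 _\<close> is known to be an integral domain only
  for linearly ordered exponents.\<close>

type_synonym 'f npoly = "(nat \<Rightarrow>\<^sub>0 nat) \<Rightarrow>\<^sub>0 'f"

section \<open>Formal partial derivatives\<close>

interpretation PD: additive_on_coeffs
  "\<lambda>m c. single (m - single n 1) (of_nat (lookup m n) * c) :: 'f::field npoly" for n
  by standard (auto simp: distrib_left single_add)

definition partial_deriv :: "nat \<Rightarrow> 'f::field npoly \<Rightarrow> 'f npoly" where "partial_deriv n = PD.lin n"

lemma partial_deriv_add: "partial_deriv n (f + g) = partial_deriv n f + partial_deriv n g" unfolding partial_deriv_def by (rule PD.lin_add)
lemma partial_deriv_0 [simp]: "partial_deriv n 0 = 0" unfolding partial_deriv_def by (rule PD.lin_0)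
lemma partial_deriv_single: "partial_deriv n (single m c) = single (m - single n 1) (of_nat (lookup m n) * c)"
  unfolding partial_deriv_def by (rule PD.lin_single)

lemma partial_deriv_mult_single:
  "partial_deriv n (single m c * single m' c' :: 'f::field npoly) =
     single m c * partial_deriv n (single m' c') + partial_deriv n (single m c) * single m' c'"
proof -
  \<comment> \<open>Exponent subtraction is truncated, so it commutes with addition only if the
    variable \<open>n\<close> occurs in \<open>a\<close>; otherwise the coefficient vanishes and the
    exponent is irrelevant.\<close>
  have *: "of_nat (lookup a n) \<noteq> (0::'f) \<Longrightarrow> a - single n 1 + b = a + b - single n 1" for a b :: "nat \<Rightarrow>\<^sub>0 nat"
    by (rule poly_mapping_eqI, cases "lookup a n") (auto simp: lookup_add lookup_minus lookup_single when_def)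
  have A: "single m c * partial_deriv n (single m' c') = single (m + m' - single n 1) (of_nat (lookup m' n) * (c * c'))"
    using *[of m' m] by (cases "of_nat (lookup m' n) = (0::'f)")
      (auto simp: partial_deriv_single mult_single mult_ac add.commute)
  have B: "partial_deriv n (single m c) * single m' c' = single (m + m' - single n 1) (of_nat (lookup m n) * (c * c'))"
    using *[of m m'] by (cases "of_nat (lookup m n) = (0::'f)")
      (auto simp: partial_deriv_single mult_single mult_ac add.commute)
  show ?thesis unfolding A B
    by (simp add: mult_single partial_deriv_single lookup_add distrib_right single_add[symmetric] add.commute)
qed

lemma partial_deriv_mult: "partial_deriv n (f * g) = f * partial_deriv n g + partial_deriv n f * g"
proof (induction f rule: poly_mapping_sum_induct)
  case (single_add m c f)
  have "partial_deriv n (single m c * g) = single m c * partial_deriv n g + partial_deriv n (single m c) * g"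
    by (induction g rule: poly_mapping_sum_induct) (auto simp: distrib_left partial_deriv_add partial_deriv_mult_single)
  then show ?case by (simp add: distrib_right partial_deriv_add single_add)
qed simp

locale char_p =
  fixes p :: nat and F :: "'f::field itself"
  assumes p: "prime p" and p_0: "of_nat p = (0::'f)"
begin

lemma p_gt_0: "p > 0" using p by (rule prime_gt_0_nat)

lemma p_npoly: "of_nat p = (0 :: ('v::comm_monoid_add) \<Rightarrow>\<^sub>0 'f)"
  using p_0 by (metis of_nat_single single_of_nat single_zero)

lemma p_fract: "of_nat p = (0 :: 'f npoly fract)"
  by (simp add: of_nat_fract p_npoly fract_collapse)

lemma partial_deriv_power_p: "partial_deriv n (f ^ p :: 'f npoly) = 0"
proof -
  have "partial_deriv n (f ^ k :: 'f npoly) = of_nat k * f ^ (k - 1) * partial_deriv n f" for k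
  proof (induction k)
    case 0 then show ?case using partial_deriv_single[of n 0 1] by simp
  next
    case (Suc k) then show ?case by (cases k) (auto simp: partial_deriv_mult algebra_simps)
  qed
  then show ?thesis by (simp add: p_npoly)
qed

section \<open>Polynomials over \<open>F ^ p\<close> and their fractions\<close>

definition kX :: "'f npoly set" where "kX = {f. \<forall>m. lookup f m \<in> range (\<lambda>c. c ^ p)}"

lemma frob_add: "(a + b :: 'f) ^ p = a ^ p + b ^ p" by (rule add_power_char[OF p p_0])

lemma kX_0: "0 \<in> kX" using p_gt_0 by (auto simp: kX_def intro!: image_eqI[of _ _ 0] simp: power_0_left)

lemma kX_add: assumes "f \<in> kX" "g \<in> kX" shows "f + g \<in> kX"
proof -
  have "lookup (f + g) m \<in> range (\<lambda>c. c ^ p)" for m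
  proof -
    obtain a b where "lookup f m = a ^ p" "lookup g m = b ^ p"
      using assms unfolding kX_def by blast
    then have "lookup (f + g) m = (a + b) ^ p" by (simp add: lookup_add frob_add)
    then show ?thesis by blast
  qed
  then show ?thesis unfolding kX_def by blast
qed

lemma kX_single: "single m (c ^ p) \<in> kX"
  using p_gt_0 by (auto simp: kX_def lookup_single when_def intro: image_eqI[of _ _ 0] simp: power_0_left)

lemma kX_single_1: "single m 1 \<in> kX" using kX_single[of m 1] by simp

lemma kX_1: "1 \<in> kX" using kX_single_1[of 0] by simp

lemma kX_sum: "(\<And>j. j \<in> J \<Longrightarrow> f j \<in> kX) \<Longrightarrow> sum f J \<in> kX"
  by (induction J rule: infinite_finite_induct) (auto simp: kX_0 kX_add)

lemma kX_mult: assumes "f \<in> kX" "g \<in> kX" shows "f * g \<in> kX"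
proof -
  have "\<exists>c. \<forall>m. lookup f m = c m ^ p" "\<exists>c. \<forall>m. lookup g m = c m ^ p"
    using assms unfolding kX_def by (auto simp: image_iff) metis+
  then obtain a b where a: "\<And>m. lookup f m = a m ^ p" and b: "\<And>m. lookup g m = b m ^ p" by blast
  have "f * g = (\<Sum>m\<in>keys f. \<Sum>n\<in>keys g. single m (lookup f m) * single n (lookup g n))"
    by (simp flip: sum_product add: sum_single_lookup)
  also have "\<dots> = (\<Sum>m\<in>keys f. \<Sum>n\<in>keys g. single (m + n) ((a m * b n) ^ p))"
    by (simp add: mult_single a b power_mult_distrib)
  also have "\<dots> \<in> kX" by (intro kX_sum kX_single)
  finally show ?thesis .
qed

lemma kX_uminus: assumes "f \<in> kX" shows "- f \<in> kX"
proof -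
  have "single 0 ((- 1 :: 'f) ^ p) = (- 1 :: 'f npoly)"
    using uminus_power_char[OF p p_0, of 1] by (simp add: single_uminus)
  then show ?thesis using kX_mult[OF kX_single[of 0 "- 1"] assms] by simp
qed

lemma kX_power: "f \<in> kX \<Longrightarrow> f ^ n \<in> kX"
  by (induction n) (auto simp: kX_1 kX_mult)

lemma single_power: "\<exists>k. (single m c :: 'f npoly) ^ n = single k (c ^ n)"
  by (induction n) (auto simp: mult_single intro: exI[of _ 0] simp flip: single_one)

lemma kX_power_p: "(f :: 'f npoly) ^ p \<in> kX"
proof -
  have "f ^ p = (\<Sum>m\<in>keys f. single m (lookup f m)) ^ p" by (simp add: sum_single_lookup)
  also have "\<dots> = (\<Sum>m\<in>keys f. single m (lookup f m) ^ p)" by (rule sum_power_char[OF p p_npoly])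
  also have "\<dots> \<in> kX" 
    by (intro kX_sum) (metis kX_single single_power)
  finally show ?thesis .
qed

text \<open>Differentiation multiplies coefficients by natural numbers, which are themselves p-th
  powers since Frobenius is additive and fixes \<open>1\<close>.\<close>

lemma partial_deriv_kX: assumes "f \<in> kX" shows "partial_deriv n f \<in> kX"
proof -
  have nat: "\<exists>a::'f. of_nat k = a ^ p" for k
  proof (induction k)
    case 0 then show ?case using p_gt_0 by (intro exI[of _ 0]) (simp add: power_0_left)
  next
    case (Suc k)
    then obtain a :: 'f where "of_nat k = a ^ p" by blast
    then show ?case by (intro exI[of _ "1 + a"]) (simp add: frob_add)
  qed
  have "single (m - single n 1) (of_nat (lookup m n) * lookup f m) \<in> kX" for m
  proof -
    obtain a b where "lookup f m = a ^ p" "of_nat (lookup m n) = (b ^ p :: 'f)"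
      using assms nat unfolding kX_def by blast
    then show ?thesis using kX_single[of "m - single n 1" "b * a"] by (simp add: power_mult_distrib)
  qed
  then show ?thesis unfolding partial_deriv_def PD.lin_def by (intro kX_sum)
qed

text \<open>The field \<open>k(X)\<close> for \<open>k = F ^ p\<close>: every denominator can be made a \<open>p\<close>-th power, which is
  a constant for all derivations.\<close>

definition K :: "'f npoly fract set" where "K = {Fract f (g ^ p) | f g. f \<in> kX \<and> g \<noteq> 0}"

lemma K_I: "f \<in> kX \<Longrightarrow> g \<noteq> 0 \<Longrightarrow> Fract f (g ^ p) \<in> K" unfolding K_def by blast

lemma Fract_power: "Fract a b ^ n = Fract (a ^ n) (b ^ n)"
  by (induction n) (auto simp: One_fract_def)

lemma fract_cases_p: obtains f g where "x = Fract f (g ^ p)" "(g :: 'f npoly) \<noteq> 0"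
proof -
  obtain a b where ab: "x = Fract a b" "b \<noteq> 0" by (cases x) auto
  have "x = Fract (a * b ^ (p - 1)) (b ^ p)"
    using ab p_gt_0 by (simp add: eq_fract mult.assoc flip: power_Suc2)
  then show ?thesis using that ab by blast
qed

lemma pow_K: "x ^ p \<in> K"
  by (cases x) (auto simp: Fract_power intro!: K_I kX_power_p)

lemma K_is_subfield: "is_subfield K"
  unfolding is_subfield_def
proof (intro conjI ballI)
  show "1 \<in> K" using K_I[OF kX_1, of 1] by (simp add: One_fract_def)
  fix x assume "x \<in> K"
  then obtain f g where x: "x = Fract f (g ^ p)" "f \<in> kX" "g \<noteq> 0" unfolding K_def by blast
  show "inverse x \<in> K"
  proof (cases "f = 0")
    case True then show ?thesis using x \<open>1 \<in> K\<close> K_I[OF kX_0 x(3)] by (simp add: fract_collapse)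
  next
    case False
    then have "inverse x = Fract (g ^ p * f ^ (p - 1)) (f ^ p)"
      using x p_gt_0 by (simp add: eq_fract mult.assoc flip: power_Suc2 power_Suc)
    then show ?thesis using K_I[OF kX_mult[OF kX_power_p kX_power[OF x(2)]] False] by simp
  qed
  fix y assume "y \<in> K"
  then obtain f' g' where y: "y = Fract f' (g' ^ p)" "f' \<in> kX" "g' \<noteq> 0" unfolding K_def by blast
  have "x - y = Fract (f * g' ^ p + - f' * g ^ p) ((g * g') ^ p)"
    using x y by (simp add: power_mult_distrib)
  then show "x - y \<in> K"
    using K_I[of "f * g' ^ p + - f' * g ^ p" "g * g'"] x y
    by (simp add: kX_add kX_mult kX_uminus kX_power_p del: mult_minus_left)
  have "x * y = Fract (f * f') ((g * g') ^ p)" using x y by (simp add: power_mult_distrib)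
  then show "x * y \<in> K" using K_I[of "f * f'" "g * g'"] x y by (simp add: kX_mult)
qed

text \<open>Over a denominator \<open>g ^ p\<close> the quotient rule loses its second term, since
  \<open>g ^ p\<close> has derivative zero. The same fact makes the choice of representative
  immaterial.\<close>

definition fract_deriv :: "nat \<Rightarrow> 'f npoly fract \<Rightarrow> 'f npoly fract" where
  "fract_deriv n x = (let (f, g) = (SOME (f, g). g \<noteq> 0 \<and> x = Fract f (g ^ p)) in Fract (partial_deriv n f) (g ^ p))"

lemma fract_deriv_Fract:
  assumes "g \<noteq> 0" shows "fract_deriv n (Fract f (g ^ p)) = Fract (partial_deriv n f) (g ^ p)"
proof -
  let ?P = "\<lambda>(f', g'). g' \<noteq> 0 \<and> Fract f (g ^ p) = Fract f' (g' ^ p)"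
  obtain f' g' where s: "(SOME q. ?P q) = (f', g')" by (cases "SOME q. ?P q")
  have "?P (f, g)" using assms by simp
  then have "?P (f', g')" using someI[of ?P "(f, g)"] s by simp
  then have g': "g' \<noteq> 0" and "f * g' ^ p = f' * g ^ p" using assms by (auto simp: eq_fract)
  then have "partial_deriv n (f * g' ^ p) = partial_deriv n (f' * g ^ p)" by simp
  then have "partial_deriv n f' * g ^ p = partial_deriv n f * g' ^ p" by (simp add: partial_deriv_mult partial_deriv_power_p)
  then show ?thesis unfolding fract_deriv_def s using assms g' by (simp add: eq_fract)
qed

lemma fract_deriv_add: "fract_deriv n (x + y) = fract_deriv n x + fract_deriv n y"
proof -
  obtain f g where x: "x = Fract f (g ^ p)" "g \<noteq> 0" by (rule fract_cases_p)
  obtain f' g' where y: "y = Fract f' (g' ^ p)" "g' \<noteq> 0" by (rule fract_cases_p)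
  have "x + y = Fract (f * g' ^ p + f' * g ^ p) ((g * g') ^ p)"
    using x y by (simp add: power_mult_distrib)
  also have "fract_deriv n \<dots> = Fract (partial_deriv n (f * g' ^ p + f' * g ^ p)) ((g * g') ^ p)"
    using x y by (intro fract_deriv_Fract) auto
  finally show ?thesis using x y
    by (simp add: fract_deriv_Fract partial_deriv_add partial_deriv_mult partial_deriv_power_p power_mult_distrib)
qed

lemma fract_deriv_mult: "fract_deriv n (x * y) = x * fract_deriv n y + fract_deriv n x * y"
proof -
  obtain f g where x: "x = Fract f (g ^ p)" "g \<noteq> 0" by (rule fract_cases_p)
  obtain f' g' where y: "y = Fract f' (g' ^ p)" "g' \<noteq> 0" by (rule fract_cases_p)
  have "x * y = Fract (f * f') ((g * g') ^ p)"
    using x y by (simp add: power_mult_distrib)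
  also have "fract_deriv n \<dots> = Fract (partial_deriv n (f * f')) ((g * g') ^ p)"
    using x y by (intro fract_deriv_Fract) auto
  finally show ?thesis using x y
    by (simp add: fract_deriv_Fract partial_deriv_mult power_mult_distrib eq_fract algebra_simps)
qed

lemma fract_deriv_K: "x \<in> K \<Longrightarrow> fract_deriv n x \<in> K"
  unfolding K_def by (auto simp: fract_deriv_Fract) (use partial_deriv_kX in blast)

lemma fract_deriv_to_fract: "fract_deriv n (to_fract f) = to_fract (partial_deriv n f)"
  using fract_deriv_Fract[of 1 n f] by (simp add: to_fract_def)

definition fract_const :: "'f \<Rightarrow> 'f npoly fract" where "fract_const c = to_fract (single 0 c)"

definition X :: "nat \<Rightarrow> 'f npoly fract" where "X n = to_fract (single (single n 1) 1)"

lemma fract_deriv_cst: "fract_deriv n (fract_const c) = 0"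
  by (simp add: fract_const_def fract_deriv_to_fract partial_deriv_single)

lemma fract_deriv_X: "fract_deriv n (X m) = (if n = m then 1 else 0)"
  by (simp add: X_def fract_deriv_to_fract partial_deriv_single lookup_single when_def)

lemma fract_const_1: "fract_const 1 = 1" by (simp add: fract_const_def)

lemma fract_const_pow_K: "fract_const (c ^ p) \<in> K"
  using K_I[OF kX_single[of 0 c], of 1] by (simp add: fract_const_def to_fract_def)

lemma X_K: "X n \<in> K"
  using K_I[OF kX_single_1, of 1] by (simp add: X_def to_fract_def)

text \<open>Linear independence over \<open>F ^ p\<close>, with the coefficients written as p-th
  powers; for the values of a form on a basis it is anisotropy in coordinates.\<close>

definition frob_indep :: "('i \<Rightarrow> 'f) \<Rightarrow> 'i set \<Rightarrow> bool" where
  "frob_indep u S \<longleftrightarrow> (\<forall>c. (\<Sum>b\<in>S. c b ^ p * u b) = 0 \<longrightarrow> (\<forall>b\<in>S. c b = 0))"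

lemma lookup_const_mult: "lookup (single 0 u * (f :: 'f npoly)) m = u * lookup f m"
  by (simp flip: mult_map_scale_conv_mult add: map.rep_eq when_def)

lemma common_denominator:
  assumes "finite S" "\<And>b. b \<in> S \<Longrightarrow> c b \<in> K"
  obtains f g where "g \<noteq> 0" "\<And>b. b \<in> S \<Longrightarrow> f b \<in> kX \<and> c b = Fract (f b) (g ^ p)"
proof -
  have "\<exists>f g. g \<noteq> 0 \<and> (\<forall>b\<in>S. f b \<in> kX \<and> c b = Fract (f b) (g ^ p))"
    using assms
  proof (induction S)
    case empty then show ?case by (intro exI[of _ "\<lambda>_. 0"] exI[of _ 1]) auto
  next
    case (insert a S)
    then obtain f g where fg: "g \<noteq> 0" "\<forall>b\<in>S. f b \<in> kX \<and> c b = Fract (f b) (g ^ p)" by auto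
    obtain f' g' where a: "c a = Fract f' (g' ^ p)" "f' \<in> kX" "g' \<noteq> 0"
      using insert.prems[of a] unfolding K_def by auto
    let ?f = "\<lambda>b. if b = a then f' * g ^ p else f b * g' ^ p"
    have "\<forall>b\<in>insert a S. ?f b \<in> kX \<and> c b = Fract (?f b) ((g * g') ^ p)"
      using fg a by (auto simp: kX_mult kX_power_p eq_fract power_mult_distrib mult_ac)
    then show ?case using fg a by (intro exI[of _ ?f] exI[of _ "g * g'"]) auto
  qed
  then show ?thesis using that by blast
qed

text \<open>After clearing a common denominator \<open>g ^ p\<close>, a relation over
  \<open>K\<close> becomes one over \<open>F ^ p\<close> for each monomial separately.\<close>

lemma indep_K:
  assumes "finite S" "frob_indep u S"
  shows "lin_indep K (\<lambda>b. fract_const (u b)) S"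
  unfolding lin_indep_def
proof (intro allI impI)
  fix c assume c: "\<forall>b\<in>S. c b \<in> K" "(\<Sum>b\<in>S. c b * fract_const (u b)) = 0"
  obtain f g where fg: "g \<noteq> 0" "\<And>b. b \<in> S \<Longrightarrow> f b \<in> kX \<and> c b = Fract (f b) (g ^ p)"
    using common_denominator[OF assms(1)] c(1) by metis
  have "0 = to_fract (g ^ p) * (\<Sum>b\<in>S. c b * fract_const (u b))" using c(2) by simp
  also have "\<dots> = (\<Sum>b\<in>S. to_fract (single 0 (u b) * f b))"
    unfolding sum_distrib_left
  proof (intro sum.cong refl)
    fix b assume "b \<in> S"
    then have "c b = Fract (f b) (g ^ p)" using fg by blast
    then show "to_fract (g ^ p) * (c b * fract_const (u b)) = to_fract (single 0 (u b) * f b)"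
      using fg(1) by (simp add: fract_const_def to_fract_def eq_fract mult_ac)
  qed
  also have "\<dots> = to_fract (\<Sum>b\<in>S. single 0 (u b) * f b)" by simp
  finally have z: "(\<Sum>b\<in>S. single 0 (u b) * f b) = 0" by (simp del: to_fract_sum)
  have "f b = 0" if b: "b \<in> S" for b
  proof (rule poly_mapping_eqI)
    fix m
    have "\<forall>b. \<exists>a. b \<in> S \<longrightarrow> lookup (f b) m = a ^ p" using fg(2) unfolding kX_def by blast
    then obtain a where a: "\<And>b. b \<in> S \<Longrightarrow> lookup (f b) m = a b ^ p" by metis
    have "(\<Sum>b\<in>S. a b ^ p * u b) = lookup (\<Sum>b\<in>S. single 0 (u b) * f b) m"
      unfolding lookup_sum 
      by (intro sum.cong refl) (simp add: lookup_const_mult a mult.commute[of "_ ^ p"])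
    also have "\<dots> = 0" by (simp only: z lookup_zero)
    finally have "a b = 0" using assms(2) b unfolding frob_indep_def by blast
    then show "lookup (f b) m = lookup 0 m" using a[OF b] p_gt_0 by (simp add: power_0_left)
  qed
  then show "\<forall>b\<in>S. c b = 0" using fg by (simp add: fract_collapse)
qed

text \<open>The instance of \<open>generic_extension\<close> in \<open>F(X)\<close>, with variables
  numbered by \<open>h\<close>. Of \<open>k1\<close> only the generators are exposed: they suffice
  to locate the coordinates of the generic point in it.\<close>

theorem indep_generic:
  fixes h :: "'i \<Rightarrow> nat" and e :: "'i \<Rightarrow> 'f" and w :: "'w \<Rightarrow> 'f"
  assumes I: "finite I" "I \<noteq> {}" "i0 \<notin> I" "inj_on h I" and e: "e i0 = 1" "frob_indep e (insert i0 I)"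
    and W: "finite W" "frob_indep w W" and card: "card W \<le> p ^ n" "p ^ n < card (insert i0 I)"
  obtains k1 where "is_subfield k1" "\<And>c. fract_const (c ^ p) \<in> k1" "\<And>n. X n \<in> k1"
    "(\<Sum>i\<in>I. fract_const (e i) * X (h i)) \<in> k1" "lin_indep k1 (\<lambda>b. fract_const (w b)) W"
proof -
  define \<alpha> where "\<alpha> = (\<Sum>i\<in>I. fract_const (e i) * X (h i))"
  have fract_deriv_0: "fract_deriv n 0 = 0" for n using fract_deriv_cst[of n 0] by (simp add: fract_const_def)
  have fract_deriv_sum: "fract_deriv n (sum f J) = (\<Sum>j\<in>J. fract_deriv n (f j))" for n and f :: "'i \<Rightarrow> _" and J
    by (induction J rule: infinite_finite_induct) (auto simp: fract_deriv_0 fract_deriv_add)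
  have indep_e: "lin_indep K (\<lambda>i. fract_const (e i)) (insert i0 I)" using I e by (intro indep_K) auto
  interpret G: generic_extension K p \<alpha> I i0 "\<lambda>i. fract_const (e i)" "\<lambda>i. fract_deriv (h i)"
  proof unfold_locales
    fix i assume i: "i \<in> I"
    have "fract_deriv (h i) \<alpha> = (\<Sum>j\<in>I. if j = i then fract_const (e i) else 0)"
      unfolding \<alpha>_def fract_deriv_sum using i I(4)
      by (intro sum.cong refl) (auto simp: fract_deriv_mult fract_deriv_cst fract_deriv_X inj_on_def)
    also have "\<dots> = fract_const (e i)" using i I(1) by simp
    finally show "fract_deriv (h i) \<alpha> = fract_const (e i)" .
  qed (use p p_fract K_is_subfield pow_K I e fract_const_1 fract_deriv_add fract_deriv_mult fract_deriv_K fract_deriv_cst indep_e in auto)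
  show ?thesis
  proof (rule that[of G.k1])
    show "is_subfield G.k1" by (rule G.k1)
    show "fract_const (c ^ p) \<in> G.k1" for c using fract_const_pow_K G.k1(2) by blast
    show "X n \<in> G.k1" for n using X_K G.k1(2) by blast
    show "(\<Sum>i\<in>I. fract_const (e i) * X (h i)) \<in> G.k1" using G.k1(3)[of 1] by (simp add: \<alpha>_def)
    show "lin_indep G.k1 (\<lambda>b. fract_const (w b)) W"
      by (rule G.indep_over_k1[OF W(1) _ indep_K[OF W] card]) (simp add: fract_deriv_cst)
  qed
qed

end

section \<open>Rational morphisms between Proj schemes at the generic point\<close>

locale graded_cring = cring S for S :: "'a ring" (structure) +
  fixes Gr :: "nat \<Rightarrow> 'a set"
  assumes Gr_carrier: "Gr d \<subseteq> carrier S"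
    and Gr_add: "a \<in> Gr d \<Longrightarrow> b \<in> Gr d \<Longrightarrow> a \<oplus> b \<in> Gr d"
    and Gr_mult: "a \<in> Gr d \<Longrightarrow> b \<in> Gr e \<Longrightarrow> a \<otimes> b \<in> Gr (d + e)"
    and Gr_one: "\<one> \<in> Gr 0"
begin

lemma Gr_closed: "a \<in> Gr d \<Longrightarrow> a \<in> carrier S" using Gr_carrier by blast

lemma homog_carrier: "a \<in> homog Gr \<Longrightarrow> a \<in> carrier S" using Gr_carrier by (auto simp: homog_def)

lemma Gr_homog: "a \<in> Gr d \<Longrightarrow> a \<in> homog Gr" by (auto simp: homog_def)

lemma homog_mult: "a \<in> homog Gr \<Longrightarrow> b \<in> homog Gr \<Longrightarrow> a \<otimes> b \<in> homog Gr"
  unfolding homog_def using Gr_mult by blast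

lemma Gr_pow: "a \<in> Gr 1 \<Longrightarrow> a [^] d \<in> Gr d"
  by (induction d) (use Gr_one Gr_mult[of _ _ a 1] in auto)

lemma prime_mult_notin:
  "primeideal \<pp> S \<Longrightarrow> a \<in> carrier S \<Longrightarrow> b \<in> carrier S \<Longrightarrow> a \<notin> \<pp> \<Longrightarrow> b \<notin> \<pp> \<Longrightarrow> a \<otimes> b \<notin> \<pp>"
  using primeideal.I_prime by fast

lemma prime_one_notin: "primeideal \<pp> S \<Longrightarrow> \<one> \<notin> \<pp>"
  using ideal.one_imp_carrier primeideal.I_notcarr primeideal.axioms(1) by metis

lemma prime_pow_notin: "primeideal \<pp> S \<Longrightarrow> a \<in> carrier S \<Longrightarrow> a \<notin> \<pp> \<Longrightarrow> a [^] (n::nat) \<notin> \<pp>"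
  by (induction n) (auto simp: prime_one_notin prime_mult_notin)

text \<open>Transitivity of equality of fractions through the middle term \<open>a / b\<close>; the
  new witness is the product of the two given ones with the middle denominator.\<close>

lemma hfrac_subset:
  assumes \<pp>: "primeideal \<pp> S"
    and ab: "a \<in> Gr d" "b \<in> Gr d" "b \<notin> \<pp>" and ab': "a' \<in> Gr d'" "b' \<in> Gr d'" "b' \<notin> \<pp>"
    and t: "t \<in> homog Gr" "t \<notin> \<pp>" "t \<otimes> (a \<otimes> b') = t \<otimes> (a' \<otimes> b)"
  shows "hfrac S Gr \<pp> a b \<subseteq> hfrac S Gr \<pp> a' b'"
proof
  fix q assume "q \<in> hfrac S Gr \<pp> a b"
  then obtain c e k u where q: "q = (c, e)" "c \<in> Gr k" "e \<in> Gr k" "e \<notin> \<pp>"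
    and u: "u \<in> homog Gr" "u \<notin> \<pp>" "u \<otimes> (a \<otimes> e) = u \<otimes> (c \<otimes> b)"
    unfolding hfrac_def by auto
  note car = Gr_closed[OF ab(1)] Gr_closed[OF ab(2)] Gr_closed[OF ab'(1)] Gr_closed[OF ab'(2)]
    Gr_closed[OF q(2)] Gr_closed[OF q(3)] homog_carrier[OF t(1)] homog_carrier[OF u(1)]
  let ?w = "t \<otimes> (u \<otimes> b)"
  have "?w \<otimes> (a' \<otimes> e) = (t \<otimes> (a' \<otimes> b)) \<otimes> (u \<otimes> e)" using car by (simp add: m_ac)
  also have "\<dots> = (t \<otimes> b') \<otimes> (u \<otimes> (a \<otimes> e))" unfolding t(3)[symmetric] using car by (simp add: m_ac)
  also have "\<dots> = ?w \<otimes> (c \<otimes> b')" unfolding u(3) using car by (simp add: m_ac)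
  finally have "?w \<otimes> (a' \<otimes> e) = ?w \<otimes> (c \<otimes> b')" .
  moreover have "?w \<in> homog Gr - \<pp>"
    using t u ab car \<pp> by (simp add: homog_mult Gr_homog prime_mult_notin)
  ultimately show "q \<in> hfrac S Gr \<pp> a' b'" using q unfolding hfrac_def by blast
qed

lemma hfrac_eq:
  assumes \<pp>: "primeideal \<pp> S"
    and ab: "a \<in> Gr d" "b \<in> Gr d" "b \<notin> \<pp>" and ab': "a' \<in> Gr d'" "b' \<in> Gr d'" "b' \<notin> \<pp>"
    and t: "t \<in> homog Gr" "t \<notin> \<pp>" "t \<otimes> (a \<otimes> b') = t \<otimes> (a' \<otimes> b)"
  shows "hfrac S Gr \<pp> a b = hfrac S Gr \<pp> a' b'"
  using hfrac_subset[OF \<pp> ab ab' t] hfrac_subset[OF \<pp> ab' ab t(1,2) t(3)[symmetric]] by blast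

lemma hfrac_eq_1:
  assumes "primeideal \<pp> S" "a \<in> Gr d" "b \<in> Gr d" "b \<notin> \<pp>" "a' \<in> Gr d'" "b' \<in> Gr d'" "b' \<notin> \<pp>"
    and "a \<otimes> b' = a' \<otimes> b"
  shows "hfrac S Gr \<pp> a b = hfrac S Gr \<pp> a' b'"
  using hfrac_eq[OF assms(1-7), of \<one>] assms(8) Gr_homog[OF Gr_one] prime_one_notin[OF assms(1)] by simp

lemma hfrac_self:
  assumes "primeideal \<pp> S" "a \<in> Gr d" "b \<in> Gr d" "b \<notin> \<pp>"
  shows "(a, b) \<in> hfrac S Gr \<pp> a b"
  using assms Gr_homog[OF Gr_one] prime_one_notin[OF assms(1)] unfolding hfrac_def by auto

lemma hfrac_memD:
  assumes "(c, e) \<in> hfrac S Gr \<pp> a b"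
  obtains k t where "c \<in> Gr k" "e \<in> Gr k" "e \<notin> \<pp>" "t \<in> homog Gr" "t \<notin> \<pp>"
    "t \<otimes> (a \<otimes> e) = t \<otimes> (c \<otimes> b)"
  using assms unfolding hfrac_def by auto

text \<open>The unions in the definition of \<open>hloc\<close> run over all representatives. They
  collapse to one class because each pair gives the same class and both index sets are
  nonempty.\<close>

lemma hloc_mult:
  assumes \<pp>: "primeideal \<pp> S"
    and ab: "a \<in> Gr d" "b \<in> Gr d" "b \<notin> \<pp>" and ce: "c \<in> Gr k" "e \<in> Gr k" "e \<notin> \<pp>"
  shows "hfrac S Gr \<pp> a b \<otimes>\<^bsub>hloc S Gr \<pp>\<^esub> hfrac S Gr \<pp> c e = hfrac S Gr \<pp> (a \<otimes> c) (b \<otimes> e)"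
proof -
  have *: "hfrac S Gr \<pp> (a' \<otimes> c') (b' \<otimes> e') = hfrac S Gr \<pp> (a \<otimes> c) (b \<otimes> e)"
    if "(a', b') \<in> hfrac S Gr \<pp> a b" "(c', e') \<in> hfrac S Gr \<pp> c e" for a' b' c' e'
  proof -
    from hfrac_memD[OF that(1)] obtain d' t where A: "a' \<in> Gr d'" "b' \<in> Gr d'" "b' \<notin> \<pp>"
      and t: "t \<in> homog Gr" "t \<notin> \<pp>" "t \<otimes> (a \<otimes> b') = t \<otimes> (a' \<otimes> b)" .
    from hfrac_memD[OF that(2)] obtain k' u where C: "c' \<in> Gr k'" "e' \<in> Gr k'" "e' \<notin> \<pp>"
      and u: "u \<in> homog Gr" "u \<notin> \<pp>" "u \<otimes> (c \<otimes> e') = u \<otimes> (c' \<otimes> e)" .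
    note car = Gr_closed[OF ab(1)] Gr_closed[OF ab(2)] Gr_closed[OF ce(1)] Gr_closed[OF ce(2)]
      Gr_closed[OF A(1)] Gr_closed[OF A(2)] Gr_closed[OF C(1)] Gr_closed[OF C(2)]
      homog_carrier[OF t(1)] homog_carrier[OF u(1)]
    have "(t \<otimes> u) \<otimes> ((a' \<otimes> c') \<otimes> (b \<otimes> e)) = (t \<otimes> (a' \<otimes> b)) \<otimes> (u \<otimes> (c' \<otimes> e))"
      using car by (simp add: m_ac)
    also have "\<dots> = (t \<otimes> (a \<otimes> b')) \<otimes> (u \<otimes> (c \<otimes> e'))" using t u by simp
    also have "\<dots> = (t \<otimes> u) \<otimes> ((a \<otimes> c) \<otimes> (b' \<otimes> e'))" using car by (simp add: m_ac)
    finally show ?thesis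
      by (intro hfrac_eq[OF \<pp>, of _ "d' + k'" _ _ "d + k" _ "t \<otimes> u"])
        (use A C ab ce t u car \<pp> in \<open>simp_all add: Gr_mult homog_mult prime_mult_notin\<close>)
  qed
  have "hfrac S Gr \<pp> a b \<otimes>\<^bsub>hloc S Gr \<pp>\<^esub> hfrac S Gr \<pp> c e =
      (\<Union>(a', b')\<in>hfrac S Gr \<pp> a b. \<Union>(c', e')\<in>hfrac S Gr \<pp> c e. hfrac S Gr \<pp> (a' \<otimes> c') (b' \<otimes> e'))"
    by (simp add: hloc_def)
  also have "\<dots> = (\<Union>x\<in>hfrac S Gr \<pp> a b. \<Union>y\<in>hfrac S Gr \<pp> c e. hfrac S Gr \<pp> (a \<otimes> c) (b \<otimes> e))"
    using * by (intro SUP_cong refl) auto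
  also have "\<dots> = hfrac S Gr \<pp> (a \<otimes> c) (b \<otimes> e)"
    using hfrac_self[OF \<pp> ab] hfrac_self[OF \<pp> ce] by blast
  finally show ?thesis .
qed

lemma hloc_add:
  assumes \<pp>: "primeideal \<pp> S"
    and ab: "a \<in> Gr d" "b \<in> Gr d" "b \<notin> \<pp>" and ce: "c \<in> Gr k" "e \<in> Gr k" "e \<notin> \<pp>"
  shows "hfrac S Gr \<pp> a b \<oplus>\<^bsub>hloc S Gr \<pp>\<^esub> hfrac S Gr \<pp> c e =
    hfrac S Gr \<pp> ((a \<otimes> e) \<oplus> (c \<otimes> b)) (b \<otimes> e)"
proof -
  have *: "hfrac S Gr \<pp> ((a' \<otimes> e') \<oplus> (c' \<otimes> b')) (b' \<otimes> e') =
      hfrac S Gr \<pp> ((a \<otimes> e) \<oplus> (c \<otimes> b)) (b \<otimes> e)"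
    if "(a', b') \<in> hfrac S Gr \<pp> a b" "(c', e') \<in> hfrac S Gr \<pp> c e" for a' b' c' e'
  proof -
    from hfrac_memD[OF that(1)] obtain d' t where A: "a' \<in> Gr d'" "b' \<in> Gr d'" "b' \<notin> \<pp>"
      and t: "t \<in> homog Gr" "t \<notin> \<pp>" "t \<otimes> (a \<otimes> b') = t \<otimes> (a' \<otimes> b)" .
    from hfrac_memD[OF that(2)] obtain k' u where C: "c' \<in> Gr k'" "e' \<in> Gr k'" "e' \<notin> \<pp>"
      and u: "u \<in> homog Gr" "u \<notin> \<pp>" "u \<otimes> (c \<otimes> e') = u \<otimes> (c' \<otimes> e)" .
    note car = Gr_closed[OF ab(1)] Gr_closed[OF ab(2)] Gr_closed[OF ce(1)] Gr_closed[OF ce(2)]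
      Gr_closed[OF A(1)] Gr_closed[OF A(2)] Gr_closed[OF C(1)] Gr_closed[OF C(2)]
      homog_carrier[OF t(1)] homog_carrier[OF u(1)]
    have "(t \<otimes> u) \<otimes> (((a' \<otimes> e') \<oplus> (c' \<otimes> b')) \<otimes> (b \<otimes> e)) =
        (t \<otimes> (a' \<otimes> b)) \<otimes> (u \<otimes> e' \<otimes> e) \<oplus> (u \<otimes> (c' \<otimes> e)) \<otimes> (t \<otimes> b' \<otimes> b)"
      using car by (simp add: m_ac l_distr r_distr)
    also have "\<dots> = (t \<otimes> (a \<otimes> b')) \<otimes> (u \<otimes> e' \<otimes> e) \<oplus> (u \<otimes> (c \<otimes> e')) \<otimes> (t \<otimes> b' \<otimes> b)"
      using t u by simp
    also have "\<dots> = (t \<otimes> u) \<otimes> (((a \<otimes> e) \<oplus> (c \<otimes> b)) \<otimes> (b' \<otimes> e'))"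
      using car by (simp add: m_ac l_distr r_distr)
    finally show ?thesis
      by (intro hfrac_eq[OF \<pp>, of _ "d' + k'" _ _ "d + k" _ "t \<otimes> u"])
        (use A C ab ce t u car \<pp> Gr_mult[OF C(1) A(2)] Gr_mult[OF ce(1) ab(2)] in
          \<open>simp_all add: Gr_mult Gr_add homog_mult prime_mult_notin add.commute[of k'] add.commute[of k]\<close>)
  qed
  have "hfrac S Gr \<pp> a b \<oplus>\<^bsub>hloc S Gr \<pp>\<^esub> hfrac S Gr \<pp> c e =
      (\<Union>(a', b')\<in>hfrac S Gr \<pp> a b. \<Union>(c', e')\<in>hfrac S Gr \<pp> c e.
        hfrac S Gr \<pp> ((a' \<otimes> e') \<oplus> (c' \<otimes> b')) (b' \<otimes> e'))"
    by (simp add: hloc_def)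
  also have "\<dots> = (\<Union>x\<in>hfrac S Gr \<pp> a b. \<Union>y\<in>hfrac S Gr \<pp> c e.
      hfrac S Gr \<pp> ((a \<otimes> e) \<oplus> (c \<otimes> b)) (b \<otimes> e))"
    using * by (intro SUP_cong refl) auto
  also have "\<dots> = hfrac S Gr \<pp> ((a \<otimes> e) \<oplus> (c \<otimes> b)) (b \<otimes> e)"
    using hfrac_self[OF \<pp> ab] hfrac_self[OF \<pp> ce] by blast
  finally show ?thesis .
qed

section \<open>Points of Proj, the generic point, and sections over basic open sets\<close>

lemma proj_pointsD: "\<pp> \<in> proj_points S Gr \<Longrightarrow> primeideal \<pp> S"
  unfolding proj_points_def by blast

lemma topspace_proj: "topspace (proj_topology S Gr) = proj_points S Gr"
proof -
  have "\<exists>h\<in>homog Gr. h \<notin> \<pp>" if "\<pp> \<in> proj_points S Gr" for \<pp>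
    using that unfolding proj_points_def homog_def by blast
  then show ?thesis unfolding proj_topology_def topology_generated_by_topspace by blast
qed

lemma openin_basic: "h \<in> homog Gr \<Longrightarrow> openin (proj_topology S Gr) {\<pp> \<in> proj_points S Gr. h \<notin> \<pp>}"
  unfolding proj_topology_def by (rule topology_generated_by_Basis) blast

text \<open>A nilpotent element lies in every prime. So if the basic open set of \<open>h\<close> is
  nonempty, then \<open>h\<close> is not nilpotent and hence not in \<eta>; intersections and unions
  follow by induction on the generated topology.\<close>

lemma generic_point:
  assumes \<eta>: "\<eta> \<in> proj_points S Gr" and nil: "\<And>h. h \<in> homog Gr \<Longrightarrow> h \<in> \<eta> \<Longrightarrow> \<exists>n::nat. h [^] n = \<zero>"
    and U: "openin (proj_topology S Gr) U" "U \<noteq> {}"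
  shows "\<eta> \<in> U"
proof -
  have "generate_topology_on {{\<pp> \<in> proj_points S Gr. h \<notin> \<pp>} | h. h \<in> homog Gr} U"
    using U(1) unfolding proj_topology_def openin_topology_generated_by_iff .
  then have "U \<noteq> {} \<longrightarrow> \<eta> \<in> U"
  proof induction
    case (Basis s)
    then obtain h where h: "h \<in> homog Gr" "s = {\<pp> \<in> proj_points S Gr. h \<notin> \<pp>}" by blast
    show ?case
    proof
      assume "s \<noteq> {}"
      then obtain \<pp> where \<pp>: "\<pp> \<in> proj_points S Gr" "h \<notin> \<pp>" using h by blast
      have "h [^] n \<noteq> \<zero>" for n :: nat
        using prime_pow_notin[OF proj_pointsD[OF \<pp>(1)] homog_carrier[OF h(1)] \<pp>(2), of n]
          additive_subgroup.zero_closed[OF ideal.axioms(1)[OF primeideal.axioms(1)[OF proj_pointsD[OF \<pp>(1)]]]]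
        by metis
      then show "\<eta> \<in> s" using nil h \<eta> by blast
    qed
  qed auto
  then show ?thesis using U(2) by blast
qed

lemma section_value:
  assumes "s \<in> carrier (proj_sections S Gr U)" "\<pp> \<in> U"
  obtains a b d where "a \<in> Gr d" "b \<in> Gr d" "b \<notin> \<pp>" "s \<pp> = hfrac S Gr \<pp> a b"
proof -
  have "s \<pp> \<in> carrier (hloc S Gr \<pp>)" using assms unfolding proj_sections_def by (auto simp: PiE_def Pi_def)
  then show ?thesis using that unfolding hloc_def by auto
qed

text \<open>The dehomogenised section \<open>f / y ^ d\<close> over the open set where
  \<open>y\<close>, of degree one in all uses, does not vanish.\<close>

definition fraction_section :: "'a \<Rightarrow> nat \<Rightarrow> 'a \<Rightarrow> 'a set \<Rightarrow> ('a \<times> 'a) set" where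
  "fraction_section y d f = (\<lambda>\<qq>\<in>{\<qq> \<in> proj_points S Gr. y \<notin> \<qq>}. hfrac S Gr \<qq> f (y [^] d))"

abbreviation "basic y \<equiv> {\<qq> \<in> proj_points S Gr. y \<notin> \<qq>}"

lemma fraction_section_carrier:
  assumes "y \<in> Gr 1" "f \<in> Gr d"
  shows "fraction_section y d f \<in> carrier (proj_sections S Gr (basic y))"
proof -
  have nin: "y [^] d \<notin> \<qq>" if "\<qq> \<in> basic y" for \<qq>
    using that prime_pow_notin proj_pointsD Gr_closed[OF assms(1)] by blast
  have "fraction_section y d f \<in> (\<Pi>\<^sub>E \<pp>\<in>basic y. carrier (hloc S Gr \<pp>))"
    unfolding fraction_section_def hloc_def using assms(2) Gr_pow[OF assms(1)] nin
    by (auto intro!: restrict_PiE_iff[THEN iffD2]) blast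
  moreover have "\<exists>V a b d. openin (proj_topology S Gr) V \<and> \<pp> \<in> V \<and> V \<subseteq> basic y \<and>
      a \<in> Gr d \<and> b \<in> Gr d \<and> (\<forall>\<qq>\<in>V. b \<notin> \<qq> \<and> fraction_section y d' f \<qq> = hfrac S Gr \<qq> a b)"
    if "\<pp> \<in> basic y" "d' = d" for \<pp> d'
    using that openin_basic[OF Gr_homog[OF assms(1)]] assms(2) Gr_pow[OF assms(1), of d] nin
    by (intro exI[of _ "basic y"] exI[of _ f] exI[of _ "y [^] d"] exI[of _ d])
      (auto simp: fraction_section_def)
  ultimately show ?thesis unfolding proj_sections_def by auto
qed

lemma fraction_section_add:
  assumes y: "y \<in> Gr 1" and f: "f \<in> Gr d" "g \<in> Gr d"
  shows "fraction_section y d (f \<oplus> g) =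
    fraction_section y d f \<oplus>\<^bsub>proj_sections S Gr (basic y)\<^esub> fraction_section y d g"
proof -
  note car = Gr_closed[OF f(1)] Gr_closed[OF f(2)] Gr_closed[OF Gr_pow[OF y, of d]]
  have "hfrac S Gr \<qq> (f \<oplus> g) (y [^] d) =
      hfrac S Gr \<qq> f (y [^] d) \<oplus>\<^bsub>hloc S Gr \<qq>\<^esub> hfrac S Gr \<qq> g (y [^] d)" if "\<qq> \<in> basic y" for \<qq>
  proof -
    have q: "primeideal \<qq> S" "y [^] d \<notin> \<qq>"
      using that prime_pow_notin proj_pointsD Gr_closed[OF y] by blast+
    show ?thesis unfolding hloc_add[OF q(1) f(1) Gr_pow[OF y] q(2) f(2) Gr_pow[OF y] q(2)]
      by (rule hfrac_eq_1[OF q(1), of _ d _ _ "d + d"])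
        (use f q car Gr_pow[OF y, of d] in
          \<open>simp_all add: Gr_add Gr_mult prime_mult_notin m_ac l_distr r_distr\<close>)
  qed
  then show ?thesis by (auto simp: fraction_section_def proj_sections_def fun_eq_iff)
qed

lemma fraction_section_mult:
  assumes y: "y \<in> Gr 1" and f: "f \<in> Gr d" "g \<in> Gr e"
  shows "fraction_section y (d + e) (f \<otimes> g) =
    fraction_section y d f \<otimes>\<^bsub>proj_sections S Gr (basic y)\<^esub> fraction_section y e g"
proof -
  have "hfrac S Gr \<qq> (f \<otimes> g) (y [^] (d + e)) =
      hfrac S Gr \<qq> f (y [^] d) \<otimes>\<^bsub>hloc S Gr \<qq>\<^esub> hfrac S Gr \<qq> g (y [^] e)" if "\<qq> \<in> basic y" for \<qq>
  proof -
    have q: "primeideal \<qq> S" "y [^] d \<notin> \<qq>" "y [^] e \<notin> \<qq>"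
      using that prime_pow_notin proj_pointsD Gr_closed[OF y] by blast+
    show ?thesis unfolding hloc_mult[OF q(1) f(1) Gr_pow[OF y] q(2) f(2) Gr_pow[OF y] q(3)]
      using Gr_closed[OF y] by (simp add: nat_pow_mult)
  qed
  then show ?thesis by (auto simp: fraction_section_def proj_sections_def fun_eq_iff)
qed

end

text \<open>\<Theta> evaluates at the generic point with values in a field. A nil kernel is what
  \<open>generic_point\<close> asks for, so the kernel lies in every nonempty open set.\<close>

locale graded_specialization = graded_cring S Gr for S :: "'a ring" (structure) and Gr +
  fixes \<Theta> :: "'a \<Rightarrow> 'g::field"
  assumes Th_1: "\<Theta> \<one> = 1"
    and Th_add: "a \<in> carrier S \<Longrightarrow> b \<in> carrier S \<Longrightarrow> \<Theta> (a \<oplus> b) = \<Theta> a + \<Theta> b"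
    and Th_mult: "a \<in> carrier S \<Longrightarrow> b \<in> carrier S \<Longrightarrow> \<Theta> (a \<otimes> b) = \<Theta> a * \<Theta> b"
    and Th_nil: "a \<in> carrier S \<Longrightarrow> \<Theta> a = 0 \<Longrightarrow> \<exists>n::nat. a [^] n = \<zero>"
    and Th_point: "{a \<in> carrier S. \<Theta> a = 0} \<in> proj_points S Gr"
begin

definition "\<eta> = {a \<in> carrier S. \<Theta> a = 0}"

lemma eta: "\<eta> \<in> proj_points S Gr" "primeideal \<eta> S"
  using Th_point proj_pointsD unfolding \<eta>_def by auto

lemma notin_eta: "a \<in> carrier S \<Longrightarrow> a \<notin> \<eta> \<longleftrightarrow> \<Theta> a \<noteq> 0" by (auto simp: \<eta>_def)

lemma eta_in_open: "openin (proj_topology S Gr) U \<Longrightarrow> U \<noteq> {} \<Longrightarrow> \<eta> \<in> U"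
  by (rule generic_point[OF eta(1)]) (auto simp: \<eta>_def Th_nil)

definition val :: "('a \<times> 'a) set \<Rightarrow> 'g" where
  "val C = (let (a, b) = (SOME q. q \<in> C) in \<Theta> a / \<Theta> b)"

lemma val_hfrac:
  assumes "a \<in> Gr d" "b \<in> Gr d" "b \<notin> \<eta>"
  shows "val (hfrac S Gr \<eta> a b) = \<Theta> a / \<Theta> b"
proof -
  let ?q = "SOME q. q \<in> hfrac S Gr \<eta> a b"
  obtain c e where q1: "?q = (c, e)" by (cases ?q)
  have "(c, e) \<in> hfrac S Gr \<eta> a b" unfolding q1[symmetric] using hfrac_self[OF eta(2) assms] by (rule someI)
  then obtain k t where q: "c \<in> Gr k" "e \<in> Gr k" "e \<notin> \<eta>"
    and t: "t \<in> homog Gr" "t \<notin> \<eta>" "t \<otimes> (a \<otimes> e) = t \<otimes> (c \<otimes> b)" by (rule hfrac_memD)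
  note car = Gr_closed[OF assms(1)] Gr_closed[OF assms(2)] Gr_closed[OF q(1)] Gr_closed[OF q(2)]
    homog_carrier[OF t(1)]
  have "\<Theta> t * (\<Theta> a * \<Theta> e) = \<Theta> t * (\<Theta> c * \<Theta> b)"
    using arg_cong[OF t(3), of \<Theta>] car by (simp add: Th_mult)
  then have "\<Theta> a * \<Theta> e = \<Theta> c * \<Theta> b" using t(2) car notin_eta by simp
  moreover have "\<Theta> e \<noteq> 0" "\<Theta> b \<noteq> 0" using notin_eta car q(3) assms(3) by auto
  ultimately show ?thesis unfolding val_def q1 by (simp add: field_simps)
qed

end

text \<open>A rational morphism is defined at the generic point, being defined on a nonempty open
  set. If \<open>y b\<close> does not vanish at the image point, \<open>H d f\<close> is the value
  at the generic point of the pullback of \<open>f / (y b) ^ d\<close>; the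
  \<open>H 1 (y b')\<close> are homogeneous coordinates of the image, normalised to \<open>1\<close>
  at \<open>b\<close>.\<close>

lemma rational_morphism_point:
  assumes X: "graded_specialization S Gr \<Theta>" and Y: "graded_cring T Gr'"
    and gens: "\<And>b. b \<in> W \<Longrightarrow> y b \<in> Gr' 1"
      "\<And>\<qq>. \<qq> \<in> proj_points T Gr' \<Longrightarrow> \<exists>b\<in>W. y b \<notin> \<qq>"
    and \<iota>: "\<And>c. \<iota> c \<in> Gr 0" "\<And>c. \<iota>' c \<in> Gr' 0"
    and ne: "rational_morphisms (Proj S Gr \<iota>) (Proj T Gr' \<iota>') \<noteq> {}"
  obtains b H where "b \<in> W" "H 1 (y b) = (1::'g::field)"
    "\<And>d f g. f \<in> Gr' d \<Longrightarrow> g \<in> Gr' d \<Longrightarrow> H d (f \<oplus>\<^bsub>T\<^esub> g) = H d f + H d g"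
    "\<And>d e f g. f \<in> Gr' d \<Longrightarrow> g \<in> Gr' e \<Longrightarrow> H (d + e) (f \<otimes>\<^bsub>T\<^esub> g) = H d f * H e g"
    "\<And>c. H 0 (\<iota>' c) = \<Theta> (\<iota> c)"
    "\<And>d f. f \<in> Gr' d \<Longrightarrow> \<exists>a\<in>carrier S. \<exists>b\<in>carrier S. H d f = \<Theta> a / \<Theta> b"
proof -
  interpret X: graded_specialization S Gr \<Theta> by (rule X)
  interpret Y: graded_cring T Gr' by (rule Y)
  let ?X = "Proj S Gr \<iota>" and ?Y = "Proj T Gr' \<iota>'"
  obtain C where "C \<in> partial_morphisms ?X ?Y // same_rational ?X ?Y"
    using ne unfolding rational_morphisms_def by (meson ex_in_conv)
  then obtain U g \<gamma> where "(U, g, \<gamma>) \<in> partial_morphisms ?X ?Y"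
    unfolding quotient_def by auto
  then have U: "openin (points ?X) U" "points ?X closure_of U = topspace (points ?X)"
    and m: "lrs_morphism (open_subspace ?X U) ?Y g \<gamma>"
    unfolding partial_morphisms_def dense_open_def by auto
  have pts: "points ?X = proj_topology S Gr" "points ?Y = proj_topology T Gr'"
    by (simp_all add: Proj_def)
  \<comment> \<open>The empty set has empty closure, whereas the whole space contains the point
    \<eta>.\<close>
  have "U \<noteq> {}" using U(2) X.eta(1) X.topspace_proj pts by auto
  then have etaU: "X.\<eta> \<in> U" using X.eta_in_open U(1) pts by auto
  have ts: "topspace (points (open_subspace ?X U)) = proj_points S Gr \<inter> U"
    using X.topspace_proj pts by (simp add: open_subspace_def)
  have "g X.\<eta> \<in> proj_points T Gr'"
    using m etaU X.eta(1) ts Y.topspace_proj pts unfolding lrs_morphism_def continuous_map_def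
    by (metis IntI PiE)
  then obtain b where b: "b \<in> W" "y b \<notin> g X.\<eta>" using gens(2) by blast
  let ?y = "y b"
  have yb: "?y \<in> Gr' 1" using gens(1) b by blast
  let ?V = "Y.basic ?y"
  have Vo: "openin (points ?Y) ?V" unfolding pts by (rule Y.openin_basic[OF Y.Gr_homog[OF yb]])
  let ?P = "preimage (open_subspace ?X U) g ?V"
  have etaP: "X.\<eta> \<in> ?P" unfolding preimage_def ts
    using etaU X.eta(1) b(2) \<open>g X.\<eta> \<in> proj_points T Gr'\<close> by auto
  have secX: "sections (open_subspace ?X U) = proj_sections S Gr" by (simp add: open_subspace_def Proj_def)
  have secY: "sections ?Y = proj_sections T Gr'" by (simp add: Proj_def)
  note mV = m[unfolded lrs_morphism_def secX secY, THEN conjunct2, THEN spec, THEN mp, OF Vo]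
  note hom = mV[THEN conjunct1] and str = mV[THEN conjunct2, THEN conjunct1, THEN spec]
  let ?s = "\<lambda>d f. Y.fraction_section ?y d f"
  define H where "H d f = X.val (\<gamma> ?V (?s d f) X.\<eta>)" for d f
  have sc: "?s d f \<in> carrier (proj_sections T Gr' ?V)" if "f \<in> Gr' d" for d f
    by (rule Y.fraction_section_carrier[OF yb that])
  have gc: "\<gamma> ?V (?s d f) \<in> carrier (proj_sections S Gr ?P)" if "f \<in> Gr' d" for d f
    using ring_hom_closed[OF hom sc[OF that]] .
  have val: "\<exists>a b k. a \<in> Gr k \<and> b \<in> Gr k \<and> b \<notin> X.\<eta> \<and> \<gamma> ?V (?s d f) X.\<eta> = hfrac S Gr X.\<eta> a b"
    if f: "f \<in> Gr' d" for d f
  proof -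
    obtain a b k where "a \<in> Gr k" "b \<in> Gr k" "b \<notin> X.\<eta>" "\<gamma> ?V (?s d f) X.\<eta> = hfrac S Gr X.\<eta> a b"
      by (rule X.section_value[OF gc[OF f] etaP])
    then show ?thesis by blast
  qed
  show ?thesis
  proof (rule that[of b H])
    show "b \<in> W" by (rule b)
    have one: "?s 1 ?y = \<one>\<^bsub>proj_sections T Gr' ?V\<^esub>"
    proof -
      have "hfrac T Gr' \<qq> ?y (?y [^]\<^bsub>T\<^esub> (1::nat)) = hfrac T Gr' \<qq> \<one>\<^bsub>T\<^esub> \<one>\<^bsub>T\<^esub>" if "\<qq> \<in> ?V" for \<qq>
      proof (rule Y.hfrac_eq_1[of _ _ 1 _ _ 0])
        show "primeideal \<qq> T" using that Y.proj_pointsD by blast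
        then show "\<one>\<^bsub>T\<^esub> \<notin> \<qq>" by (rule Y.prime_one_notin)
      qed (use that yb Y.Gr_one Y.Gr_closed[OF yb] in auto)
      then show ?thesis by (auto simp: Y.fraction_section_def proj_sections_def hloc_def fun_eq_iff)
    qed
    show "H 1 (y b) = 1"
      unfolding H_def one ring_hom_one[OF hom] using etaP
      by (simp add: proj_sections_def hloc_def X.val_hfrac[OF X.Gr_one X.Gr_one X.prime_one_notin[OF X.eta(2)]] X.Th_1)
    show "H d (f \<oplus>\<^bsub>T\<^esub> f') = H d f + H d f'" if f: "f \<in> Gr' d" "f' \<in> Gr' d" for d f f'
    proof -
      obtain a b k where 1: "a \<in> Gr k" "b \<in> Gr k" "b \<notin> X.\<eta>" "\<gamma> ?V (?s d f) X.\<eta> = hfrac S Gr X.\<eta> a b"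
        using val[OF f(1)] by blast
      obtain a' b' k' where 2: "a' \<in> Gr k'" "b' \<in> Gr k'" "b' \<notin> X.\<eta>"
        "\<gamma> ?V (?s d f') X.\<eta> = hfrac S Gr X.\<eta> a' b'"
        using val[OF f(2)] by blast
      note car = X.Gr_closed[OF 1(1)] X.Gr_closed[OF 1(2)] X.Gr_closed[OF 2(1)] X.Gr_closed[OF 2(2)]
      have "\<gamma> ?V (?s d (f \<oplus>\<^bsub>T\<^esub> f')) X.\<eta> =
          hfrac S Gr X.\<eta> a b \<oplus>\<^bsub>hloc S Gr X.\<eta>\<^esub> hfrac S Gr X.\<eta> a' b'"
        unfolding Y.fraction_section_add[OF yb f] ring_hom_add[OF hom sc[OF f(1)] sc[OF f(2)]]
        using etaP 1(4) 2(4) by (simp add: proj_sections_def)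
      also have "\<dots> = hfrac S Gr X.\<eta> ((a \<otimes>\<^bsub>S\<^esub> b') \<oplus>\<^bsub>S\<^esub> (a' \<otimes>\<^bsub>S\<^esub> b)) (b \<otimes>\<^bsub>S\<^esub> b')"
        by (rule X.hloc_add[OF X.eta(2) 1(1-3) 2(1-3)])
      also have "X.val \<dots> = \<Theta> ((a \<otimes>\<^bsub>S\<^esub> b') \<oplus>\<^bsub>S\<^esub> (a' \<otimes>\<^bsub>S\<^esub> b)) / \<Theta> (b \<otimes>\<^bsub>S\<^esub> b')"
        by (rule X.val_hfrac[of _ "k + k'"])
          (use 1 2 car X.eta(2) X.Gr_mult[OF 2(1) 1(2)] in
            \<open>simp_all add: X.Gr_add X.Gr_mult X.prime_mult_notin add.commute[of k']\<close>)
      also have "\<dots> = \<Theta> a / \<Theta> b + \<Theta> a' / \<Theta> b'"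
        using car 1(3) 2(3) X.notin_eta by (simp add: X.Th_add X.Th_mult field_simps)
      finally show ?thesis unfolding H_def 1(4) 2(4) by (simp add: X.val_hfrac[OF 1(1-3)] X.val_hfrac[OF 2(1-3)])
    qed
    show "H (d + e) (f \<otimes>\<^bsub>T\<^esub> f') = H d f * H e f'" if f: "f \<in> Gr' d" "f' \<in> Gr' e" for d e f f'
    proof -
      obtain a b k where 1: "a \<in> Gr k" "b \<in> Gr k" "b \<notin> X.\<eta>" "\<gamma> ?V (?s d f) X.\<eta> = hfrac S Gr X.\<eta> a b"
        using val[OF f(1)] by blast
      obtain a' b' k' where 2: "a' \<in> Gr k'" "b' \<in> Gr k'" "b' \<notin> X.\<eta>"
        "\<gamma> ?V (?s e f') X.\<eta> = hfrac S Gr X.\<eta> a' b'"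
        using val[OF f(2)] by blast
      note car = X.Gr_closed[OF 1(1)] X.Gr_closed[OF 1(2)] X.Gr_closed[OF 2(1)] X.Gr_closed[OF 2(2)]
      have "\<gamma> ?V (?s (d + e) (f \<otimes>\<^bsub>T\<^esub> f')) X.\<eta> =
          hfrac S Gr X.\<eta> a b \<otimes>\<^bsub>hloc S Gr X.\<eta>\<^esub> hfrac S Gr X.\<eta> a' b'"
        unfolding Y.fraction_section_mult[OF yb f] ring_hom_mult[OF hom sc[OF f(1)] sc[OF f(2)]]
        using etaP 1(4) 2(4) by (simp add: proj_sections_def)
      also have "\<dots> = hfrac S Gr X.\<eta> (a \<otimes>\<^bsub>S\<^esub> a') (b \<otimes>\<^bsub>S\<^esub> b')"
        by (rule X.hloc_mult[OF X.eta(2) 1(1-3) 2(1-3)])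
      also have "X.val \<dots> = \<Theta> (a \<otimes>\<^bsub>S\<^esub> a') / \<Theta> (b \<otimes>\<^bsub>S\<^esub> b')"
        by (rule X.val_hfrac[of _ "k + k'"])
          (use 1 2 car X.eta(2) in \<open>simp_all add: X.Gr_mult X.prime_mult_notin\<close>)
      also have "\<dots> = (\<Theta> a / \<Theta> b) * (\<Theta> a' / \<Theta> b')"
        using car by (simp add: X.Th_mult)
      finally show ?thesis unfolding H_def 1(4) 2(4) by (simp add: X.val_hfrac[OF 1(1-3)] X.val_hfrac[OF 2(1-3)])
    qed
    show "H 0 (\<iota>' c) = \<Theta> (\<iota> c)" for c
    proof -
      have "?s 0 (\<iota>' c) = struct_map ?Y ?V c"
        by (simp add: Y.fraction_section_def Proj_def)
      then have "\<gamma> ?V (?s 0 (\<iota>' c)) = struct_map (open_subspace ?X U) ?P c" using str[of c] by simp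
      also have "\<dots> = (\<lambda>\<pp>\<in>?P. hfrac S Gr \<pp> (\<iota> c) \<one>\<^bsub>S\<^esub>)"
        unfolding open_subspace_def by (simp add: Proj_def)
      finally have "\<gamma> ?V (?s 0 (\<iota>' c)) X.\<eta> = hfrac S Gr X.\<eta> (\<iota> c) \<one>\<^bsub>S\<^esub>" using etaP by simp
      then show ?thesis unfolding H_def
        by (simp add: X.Th_1 X.val_hfrac[OF \<iota>(1) X.Gr_one X.prime_one_notin[OF X.eta(2)]])
    qed
    show "\<exists>a\<in>carrier S. \<exists>b\<in>carrier S. H d f = \<Theta> a / \<Theta> b" if f: "f \<in> Gr' d" for d f
    proof -
      obtain a b k where 1: "a \<in> Gr k" "b \<in> Gr k" "b \<notin> X.\<eta>" "\<gamma> ?V (?s d f) X.\<eta> = hfrac S Gr X.\<eta> a b"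
        using val[OF f] by blast
      then show ?thesis unfolding H_def 1(4)
        using X.val_hfrac[OF 1(1-3)] X.Gr_closed[OF 1(1)] X.Gr_closed[OF 1(2)] by blast
    qed
  qed
qed

section \<open>Coordinate rings of quasilinear hypersurfaces\<close>

lemma poly_ring_sel [simp]:
  "x \<otimes>\<^bsub>poly_ring B\<^esub> y = x * y" "\<one>\<^bsub>poly_ring B\<^esub> = 1"
  "\<zero>\<^bsub>poly_ring B\<^esub> = 0" "x \<oplus>\<^bsub>poly_ring B\<^esub> y = x + y"
  by (simp_all add: poly_ring_def)

lemma poly_ring_carrier: "f \<in> carrier (poly_ring B) \<longleftrightarrow> (\<forall>m\<in>keys f. keys m \<subseteq> B)"
  by (simp add: poly_ring_def)

lemma keys_add_nat: "keys (m + n :: 'v \<Rightarrow>\<^sub>0 nat) = keys m \<union> keys n"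
  by (auto simp: in_keys_iff lookup_add)

lemma poly_ring_closed:
  shows poly_ring_0: "0 \<in> carrier (poly_ring B)" and poly_ring_1: "1 \<in> carrier (poly_ring B)"
    and poly_ring_add: "f \<in> carrier (poly_ring B) \<Longrightarrow> g \<in> carrier (poly_ring B) \<Longrightarrow> f + g \<in> carrier (poly_ring B)"
    and poly_ring_mult: "f \<in> carrier (poly_ring B) \<Longrightarrow> g \<in> carrier (poly_ring B) \<Longrightarrow> f * g \<in> carrier (poly_ring B)"
    and poly_ring_uminus: "f \<in> carrier (poly_ring B) \<Longrightarrow> - f \<in> carrier (poly_ring B)"
proof -
  show "f * g \<in> carrier (poly_ring B)" if "f \<in> carrier (poly_ring B)" "g \<in> carrier (poly_ring B)"
    unfolding poly_ring_carrier
  proof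
    fix m assume "m \<in> keys (f * g)"
    then obtain a b where "m = a + b" "a \<in> keys f" "b \<in> keys g"
      using Poly_Mapping.keys_mult[of f g] by blast
    then show "keys m \<subseteq> B" using that by (simp add: poly_ring_carrier keys_add_nat)
  qed
qed (use Poly_Mapping.keys_add[of f g] in \<open>auto simp: poly_ring_carrier\<close>)

lemma poly_ring_single: "keys m \<subseteq> B \<Longrightarrow> single m c \<in> carrier (poly_ring B)"
  by (simp add: poly_ring_carrier)

lemma poly_ring_power: "f \<in> carrier (poly_ring B) \<Longrightarrow> f ^ n \<in> carrier (poly_ring B)"
  by (induction n) (auto simp: poly_ring_1 poly_ring_mult)

lemma poly_ring_cring: "cring (poly_ring B :: ('v, 'f::field) mpoly ring)"
proof (rule cringI)
  show "abelian_group (poly_ring B :: ('v, 'f) mpoly ring)"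
  proof (rule abelian_groupI)
    fix x :: "('v, 'f) mpoly" assume "x \<in> carrier (poly_ring B)"
    then show "\<exists>y\<in>carrier (poly_ring B). y \<oplus>\<^bsub>poly_ring B\<^esub> x = \<zero>\<^bsub>poly_ring B\<^esub>"
      by (intro bexI[of _ "- x"]) (auto simp: poly_ring_uminus)
  qed (auto simp: poly_ring_closed add_ac)
  show "comm_monoid (poly_ring B :: ('v, 'f) mpoly ring)"
    by (rule comm_monoidI) (auto simp: poly_ring_closed mult_ac)
qed (auto simp: distrib_right)

section \<open>Total degree and homogeneous parts\<close>

definition total_degree :: "('v \<Rightarrow>\<^sub>0 nat) \<Rightarrow> nat" where "total_degree m = (\<Sum>b\<in>keys m. lookup m b)"

lemma total_degree_add: "total_degree (m + n) = total_degree m + total_degree n"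
proof -
  let ?S = "keys m \<union> keys n"
  have s: "total_degree k = (\<Sum>b\<in>?S. lookup k b)" if "keys k \<subseteq> ?S" for k
    unfolding total_degree_def by (rule sum.mono_neutral_left) (use that in \<open>auto simp: in_keys_iff\<close>)
  show ?thesis by (simp add: s keys_add_nat lookup_add sum.distrib)
qed

lemma total_degree_0 [simp]: "total_degree 0 = 0" by (simp add: total_degree_def)

lemma total_degree_single [simp]: "total_degree (single b k) = k"
  by (cases "k = 0") (auto simp: total_degree_def)

definition homogeneous :: "nat \<Rightarrow> (('v \<Rightarrow>\<^sub>0 nat) \<Rightarrow>\<^sub>0 'c::zero) \<Rightarrow> bool" where
  "homogeneous d f \<longleftrightarrow> (\<forall>m\<in>keys f. total_degree m = d)"

lemma homog_polys_iff: "f \<in> homog_polys B d \<longleftrightarrow> f \<in> carrier (poly_ring B) \<and> homogeneous d f"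
  by (simp add: homog_polys_def homogeneous_def total_degree_def)

lemma homogeneous_add: "homogeneous d f \<Longrightarrow> homogeneous d g \<Longrightarrow> homogeneous d (f + g)"
  using Poly_Mapping.keys_add[of f g] by (auto simp: homogeneous_def)

lemma homogeneous_mult: "homogeneous d f \<Longrightarrow> homogeneous e g \<Longrightarrow> homogeneous (d + e) (f * g)"
  using Poly_Mapping.keys_mult[of f g] by (fastforce simp: homogeneous_def total_degree_add)

lemma homogeneous_0: "homogeneous d 0" by (simp add: homogeneous_def)

lemma homogeneous_single: "total_degree m = d \<Longrightarrow> homogeneous d (single m c)" by (simp add: homogeneous_def)

lemma homogeneous_1: "homogeneous 0 (1 :: ('v \<Rightarrow>\<^sub>0 nat) \<Rightarrow>\<^sub>0 'c::zero_neq_one)" by (simp add: homogeneous_def)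

lemma homogeneous_sum: "(\<And>j. j \<in> J \<Longrightarrow> homogeneous d (f j)) \<Longrightarrow> homogeneous d (sum f J)"
  by (induction J rule: infinite_finite_induct) (auto simp: homogeneous_0 homogeneous_add)

lemma homogeneous_power: "homogeneous d (f :: ('v \<Rightarrow>\<^sub>0 nat) \<Rightarrow>\<^sub>0 'c::comm_ring_1) \<Longrightarrow> homogeneous (k * d) (f ^ k)"
  by (induction k) (auto simp: homogeneous_1 homogeneous_mult)

lemma homogeneous_mon:
  fixes \<xi> :: "'w \<Rightarrow> ('v \<Rightarrow>\<^sub>0 nat) \<Rightarrow>\<^sub>0 'c::comm_ring_1"
  assumes "\<And>b. b \<in> keys m \<Longrightarrow> homogeneous 1 (\<xi> b)"
  shows "homogeneous (total_degree m) (eval_monomial \<xi> m)"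
proof -
  have "homogeneous (\<Sum>b\<in>L. lookup m b) (\<Prod>b\<in>L. \<xi> b ^ lookup m b)" if "L \<subseteq> keys m" for L
    using that
  proof (induction L rule: infinite_finite_induct)
    case (insert b L)
    have "homogeneous (lookup m b) (\<xi> b ^ lookup m b)"
      using homogeneous_power[OF assms, of b "lookup m b"] insert.prems by simp
    then show ?case using insert by (simp add: homogeneous_mult)
  qed (auto simp: homogeneous_1)
  from this[of "keys m"] show ?thesis by (simp add: eval_monomial_def total_degree_def)
qed

lemma homogeneous_sum_eq_0:
  assumes "finite D" "\<And>d. d \<in> D \<Longrightarrow> homogeneous d (g d)" "(\<Sum>d\<in>D. g d) = 0" "d \<in> D"
  shows "g d = 0"
proof (rule poly_mapping_eqI)
  fix m
  show "lookup (g d) m = lookup 0 m"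
  proof (cases "total_degree m = d")
    case True
    have "0 = (\<Sum>d\<in>D. lookup (g d) m)" by (simp flip: lookup_sum add: assms(3))
    also have "\<dots> = (\<Sum>k\<in>D. if k = d then lookup (g d) m else 0)"
    proof (intro sum.cong refl)
      fix k assume "k \<in> D"
      then have "lookup (g k) m \<noteq> 0 \<Longrightarrow> k = d" using assms(2) True by (auto simp: homogeneous_def in_keys_iff)
      then show "lookup (g k) m = (if k = d then lookup (g d) m else 0)" by auto
    qed
    also have "\<dots> = lookup (g d) m" using assms by (simp add: sum.delta)
    finally show ?thesis by simp
  next
    case False
    then have "m \<notin> keys (g d)" using assms(2)[OF assms(4)] unfolding homogeneous_def by blast
    then show ?thesis by (simp add: in_keys_iff)
  qed
qed

definition homogeneous_part :: "nat \<Rightarrow> (('v \<Rightarrow>\<^sub>0 nat) \<Rightarrow>\<^sub>0 'c::comm_monoid_add) \<Rightarrow> ('v \<Rightarrow>\<^sub>0 nat) \<Rightarrow>\<^sub>0 'c" where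
  "homogeneous_part d f = (\<Sum>m\<in>{m\<in>keys f. total_degree m = d}. single m (lookup f m))"

lemma homogeneous_homogeneous_part: "homogeneous d (homogeneous_part d f)"
  unfolding homogeneous_part_def by (rule homogeneous_sum) (auto intro: homogeneous_single)

lemma sum_homogeneous_part: "(\<Sum>d\<in>total_degree ` keys f. homogeneous_part d f) = f"
  unfolding homogeneous_part_def by (subst sum.image_gen[symmetric]) (auto simp: sum_single_lookup)

lemma poly_ring_sum: "(\<And>j. j \<in> J \<Longrightarrow> f j \<in> carrier (poly_ring B)) \<Longrightarrow> sum f J \<in> carrier (poly_ring B)"
  by (induction J rule: infinite_finite_induct) (auto simp: poly_ring_0 poly_ring_add)

lemma homogeneous_part_homog: "f \<in> carrier (poly_ring B) \<Longrightarrow> homogeneous_part d f \<in> homog_polys B d"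
  unfolding homog_polys_iff homogeneous_part_def
  by (intro conjI poly_ring_sum poly_ring_single homogeneous_homogeneous_part[unfolded homogeneous_part_def]) (auto simp: poly_ring_carrier)

section \<open>The graded quotient by the form\<close>

locale coordinate_ring =
  fixes p :: nat and B :: "'v set" and \<phi> :: "'v \<Rightarrow> 'f::field"
begin

abbreviation "P \<equiv> poly_ring B :: ('v, 'f) mpoly ring"
abbreviation "I \<equiv> form_ideal p B \<phi>"
abbreviation "S \<equiv> P Quot I"
abbreviation "coset f \<equiv> I +>\<^bsub>P\<^esub> f"
abbreviation "Gr \<equiv> (\<lambda>d. coset ` homog_polys B d)"

sublocale P: cring P by (rule poly_ring_cring)

lemma form_poly_homog: "form_poly p B \<phi> \<in> homog_polys B p"
  unfolding homog_polys_iff form_poly_def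
  by (intro conjI homogeneous_sum homogeneous_single poly_ring_sum poly_ring_single) auto

lemma form_poly_carrier: "form_poly p B \<phi> \<in> carrier P"
  using form_poly_homog by (simp add: homog_polys_iff)

sublocale I: ideal I P
  unfolding form_ideal_def using form_poly_carrier by (intro P.genideal_ideal) auto

lemma form_poly_I: "form_poly p B \<phi> \<in> I"
  unfolding form_ideal_def using form_poly_carrier P.genideal_self[of "{form_poly p B \<phi>}"] by auto

sublocale S: cring S by (rule I.quotient_is_cring[OF poly_ring_cring])

lemma coset_hom: "coset \<in> ring_hom P S" by (rule I.rcos_ring_hom)

lemma coset_mult: "f \<in> carrier P \<Longrightarrow> g \<in> carrier P \<Longrightarrow> coset (f * g) = coset f \<otimes>\<^bsub>S\<^esub> coset g"
  using ring_hom_mult[OF coset_hom] by simp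

lemma coset_add: "f \<in> carrier P \<Longrightarrow> g \<in> carrier P \<Longrightarrow> coset (f + g) = coset f \<oplus>\<^bsub>S\<^esub> coset g"
  using ring_hom_add[OF coset_hom] by simp

lemma coset_1: "coset 1 = \<one>\<^bsub>S\<^esub>" using ring_hom_one[OF coset_hom] by simp

lemma coset_carrier: "f \<in> carrier P \<Longrightarrow> coset f \<in> carrier S"
  using ring_hom_closed[OF coset_hom] .

lemma S_carrierE: assumes "C \<in> carrier S" obtains f where "f \<in> carrier P" "C = coset f"
  using assms by (auto simp: FactRing_def A_RCOSETS_def')

lemma S_zero: "\<zero>\<^bsub>S\<^esub> = I" by (simp add: FactRing_def)

lemma coset_eq_0: "f \<in> I \<Longrightarrow> coset f = \<zero>\<^bsub>S\<^esub>"
  unfolding S_zero using I.a_rcos_const by blast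

lemma coset_0: "coset 0 = \<zero>\<^bsub>S\<^esub>" using coset_eq_0 I.zero_closed by simp

lemma coset_eqD: assumes "f \<in> carrier P" "g \<in> carrier P" "coset f = coset g" shows "f - g \<in> I"
proof -
  have "f \<in> coset g" using I.a_rcos_self[OF assms(1)] assms(3) by simp
  then obtain i where "i \<in> I" "f = i + g" unfolding a_r_coset_def' by auto
  then show ?thesis by simp
qed

lemma coset_pow: "f \<in> carrier P \<Longrightarrow> coset f [^]\<^bsub>S\<^esub> (n::nat) = coset (f ^ n)"
  by (induction n) (simp_all add: coset_1 coset_mult poly_ring_power power_Suc2 del: power_Suc)

lemma graded: "graded_cring S Gr"
proof unfold_locales
  show "Gr d \<subseteq> carrier S" for d using coset_carrier by (auto simp: homog_polys_iff)
  show "a \<oplus>\<^bsub>S\<^esub> b \<in> Gr d" if "a \<in> Gr d" "b \<in> Gr d" for a b d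
    using that by (auto simp: homog_polys_iff coset_add[symmetric] intro!: imageI poly_ring_add homogeneous_add)
  show "a \<otimes>\<^bsub>S\<^esub> b \<in> Gr (d + e)" if "a \<in> Gr d" "b \<in> Gr e" for a b d e
    using that by (auto simp: homog_polys_iff coset_mult[symmetric] intro!: imageI poly_ring_mult homogeneous_mult)
  show "\<one>\<^bsub>S\<^esub> \<in> Gr 0" unfolding coset_1[symmetric]
    by (auto simp: homog_polys_iff intro!: imageI poly_ring_1 homogeneous_1)
qed

lemma hypersurface_eq: "quasilinear_hypersurface p B \<phi> = Proj S Gr (\<lambda>c. coset (const_poly c))"
  by (simp add: quasilinear_hypersurface_def Let_def)

definition x :: "'v \<Rightarrow> ('v, 'f) mpoly" where "x b = single (single b 1) 1"

lemma x_homog: "b \<in> B \<Longrightarrow> x b \<in> homog_polys B 1"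
  by (auto simp: x_def homog_polys_iff intro!: poly_ring_single homogeneous_single)

lemma const_homog: "const_poly c \<in> homog_polys B 0"
  by (auto simp: const_poly_def homog_polys_iff intro!: poly_ring_single homogeneous_single)

lemma x_power: "x b ^ n = single (single b n) 1"
  by (induction n) (auto simp: x_def mult_single single_add[symmetric])

lemma single_eq_mon: "single m c = const_poly c * eval_monomial x m"
proof -
  have "(\<Prod>b\<in>L. single (single b (lookup m b)) (1::'f)) = single (\<Sum>b\<in>L. single b (lookup m b)) 1" for L
    by (induction L rule: infinite_finite_induct) (auto simp: mult_single)
  then have "eval_monomial x m = single m (1::'f)"
    by (simp add: eval_monomial_def x_power sum_single_lookup)
  then show ?thesis by (simp add: const_poly_def mult_single)
qed

text \<open>A prime containing all variables contains every monomial of positive degree, hence the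
  whole irrelevant ideal.\<close>

lemma some_variable_notin:
  assumes "\<qq> \<in> proj_points S Gr"
  shows "\<exists>b\<in>B. coset (x b) \<notin> \<qq>"
proof (rule ccontr)
  assume n: "\<not> ?thesis"
  interpret graded_cring S Gr by (rule graded)
  interpret q: primeideal \<qq> S by (rule proj_pointsD[OF assms])
  have s: "coset (single m c) \<in> \<qq>" if m0: "m \<noteq> 0" "keys m \<subseteq> B" for m c
  proof -
    obtain b where b: "b \<in> keys m" using m0(1) by (metis Poly_Mapping.keys_eq_empty ex_in_conv)
    have m: "m = (m - single b 1) + single b 1"
      by (rule poly_mapping_eqI) (use b in \<open>auto simp: lookup_add lookup_minus lookup_single when_def in_keys_iff\<close>)
    have k: "keys (m - single b 1) \<subseteq> B"
      using that(2) by (auto simp: in_keys_iff lookup_minus)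
    have "single m c = single (m - single b 1) c * x b"
      unfolding x_def mult_single m[symmetric] by simp
    then have "coset (single m c) = coset (single (m - single b 1) c) \<otimes>\<^bsub>S\<^esub> coset (x b)"
      using coset_mult[OF poly_ring_single[OF k]] x_homog[of b] b that(2) by (auto simp: homog_polys_iff)
    moreover have "coset (x b) \<in> \<qq>" using n b that(2) by blast
    ultimately show ?thesis using q.I_l_closed coset_carrier[OF poly_ring_single[OF k]] by simp
  qed
  have "coset f \<in> \<qq>" if f: "f \<in> homog_polys B d" "d > 0" for f d
  proof -
    have k: "keys m \<subseteq> B" "m \<noteq> 0" if "m \<in> keys f" for m
      using that f by (auto simp: homog_polys_iff homogeneous_def poly_ring_carrier)
    have "coset (\<Sum>m\<in>L. single m (lookup f m)) \<in> \<qq>" if "L \<subseteq> keys f" for L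
      using that
    proof (induction L rule: infinite_finite_induct)
      case (insert m L)
      have "(\<Sum>m\<in>L. single m (lookup f m)) \<in> carrier P"
        using insert.prems k by (intro poly_ring_sum poly_ring_single) auto
      then show ?case using insert k s
        by (simp add: coset_add poly_ring_single q.a_closed)
    qed (auto simp: coset_0)
    from this[of "keys f"] show ?thesis by (simp add: sum_single_lookup)
  qed
  then have "(\<Union>d\<in>{0<..}. Gr d) \<subseteq> \<qq>" by auto
  then show False using assms unfolding proj_points_def by blast
qed

text \<open>The form is zero in the coordinate ring, and its terms all have degree \<open>p\<close>,
  so additivity of \<open>H p\<close> applies to their sum and multiplicativity to each
  term.\<close>

lemma form_relation:
  fixes H :: "nat \<Rightarrow> ('v, 'f) mpoly set \<Rightarrow> 'g::field"
  assumes B: "finite B"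
    and add: "\<And>d f g. f \<in> Gr d \<Longrightarrow> g \<in> Gr d \<Longrightarrow> H d (f \<oplus>\<^bsub>S\<^esub> g) = H d f + H d g"
    and mult: "\<And>d e f g. f \<in> Gr d \<Longrightarrow> g \<in> Gr e \<Longrightarrow> H (d + e) (f \<otimes>\<^bsub>S\<^esub> g) = H d f * H e g"
    and one: "H 0 (coset (const_poly 1)) = 1"
  shows "(\<Sum>b\<in>B. H 0 (coset (const_poly (\<phi> b))) * H 1 (coset (x b)) ^ p) = 0"
proof -
  have z: "H d (coset 0) = 0" for d
  proof -
    have "coset 0 \<in> Gr d" by (auto simp: homog_polys_iff intro!: imageI poly_ring_0 homogeneous_0)
    from add[OF this this] show ?thesis
      using coset_add[OF poly_ring_0 poly_ring_0] by (metis add_0_right add_cancel_right_right)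
  qed
  have pw: "H n (coset (x b ^ n)) = H 1 (coset (x b)) ^ n \<and> x b ^ n \<in> homog_polys B n" if "b \<in> B" for n b
  proof (induction n)
    case 0
    then show ?case using one
      by (auto simp: const_poly_def homog_polys_iff poly_ring_1 homogeneous_1)
  next
    case (Suc n)
    have "coset (x b ^ Suc n) = coset (x b ^ n) \<otimes>\<^bsub>S\<^esub> coset (x b)"
      using Suc x_homog[OF that] by (simp add: coset_mult homog_polys_iff power_Suc2 del: power_Suc)
    then have "H (Suc n) (coset (x b ^ Suc n)) = H n (coset (x b ^ n)) * H 1 (coset (x b))"
      using mult[of "coset (x b ^ n)" n "coset (x b)" 1] Suc x_homog[OF that] by simp
    moreover have "x b ^ Suc n \<in> homog_polys B (Suc n)"
      using Suc x_homog[OF that] homogeneous_mult[of 1 "x b" n "x b ^ n"] by (simp add: homog_polys_iff poly_ring_mult)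
    ultimately show ?case using Suc by simp
  qed
  have t: "H p (coset (single (single b p) (\<phi> b))) = H 0 (coset (const_poly (\<phi> b))) * H 1 (coset (x b)) ^ p"
    "single (single b p) (\<phi> b) \<in> homog_polys B p" if "b \<in> B" for b
  proof -
    have eq: "single (single b p) (\<phi> b) = const_poly (\<phi> b) * x b ^ p"
      by (simp add: const_poly_def x_power mult_single)
    note h = const_homog[of "\<phi> b"] pw[OF that, of p, THEN conjunct2]
    have "coset (single (single b p) (\<phi> b)) = coset (const_poly (\<phi> b)) \<otimes>\<^bsub>S\<^esub> coset (x b ^ p)"
      unfolding eq using h by (intro coset_mult) (auto simp: homog_polys_iff)
    then show "H p (coset (single (single b p) (\<phi> b))) = H 0 (coset (const_poly (\<phi> b))) * H 1 (coset (x b)) ^ p"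
      using mult[of "coset (const_poly (\<phi> b))" 0 "coset (x b ^ p)" p] h pw[OF that, of p] by simp
    show "single (single b p) (\<phi> b) \<in> homog_polys B p"
      using that unfolding homog_polys_iff by (intro conjI poly_ring_single homogeneous_single) auto
  qed
  have "H p (coset (\<Sum>b\<in>L. single (single b p) (\<phi> b))) =
      (\<Sum>b\<in>L. H 0 (coset (const_poly (\<phi> b))) * H 1 (coset (x b)) ^ p)" if "L \<subseteq> B" for L
    using that
  proof (induction L rule: infinite_finite_induct)
    case (insert b L)
    have L: "(\<Sum>b\<in>L. single (single b p) (\<phi> b)) \<in> homog_polys B p"
      using insert.prems t(2) by (auto simp: homog_polys_iff intro!: poly_ring_sum homogeneous_sum)
    have b: "b \<in> B" using insert.prems by simp
    have "coset (single (single b p) (\<phi> b) + (\<Sum>b\<in>L. single (single b p) (\<phi> b))) =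
        coset (single (single b p) (\<phi> b)) \<oplus>\<^bsub>S\<^esub> coset (\<Sum>b\<in>L. single (single b p) (\<phi> b))"
      using L t(2)[OF b] by (intro coset_add) (auto simp: homog_polys_iff)
    then show ?case
      using insert add[OF imageI[OF t(2)[OF b]] imageI[OF L]] t(1)[OF b] by simp
  qed (use z in auto)
  from this[of B] show ?thesis
    using coset_eq_0[OF form_poly_I] z[of p] by (simp add: form_poly_def coset_0)
qed

end

text \<open>The variable of \<open>i0\<close> is the one eliminated by the equation; the others
  become the transcendentals numbered by \<open>h\<close>. A second basis vector guarantees that at
  least one of them is present.\<close>

locale generic_hypersurface = coordinate_ring p B \<phi> + char_p p F
  for p and B :: "'v set" and \<phi> :: "'v \<Rightarrow> 'f::field" and F :: "'f itself" +
  fixes i0 :: 'v and h :: "'v \<Rightarrow> nat"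
  assumes B: "finite B" "i0 \<in> B" "inj_on h B" and phi: "\<phi> i0 \<noteq> 0" and B2: "\<exists>b\<in>B. b \<noteq> i0"
begin

text \<open>Coefficients of the equation solved for the eliminated variable: on the hypersurface
  \<open>x\<^sub>i\<^sub>0 ^ p\<close> is the sum of the \<open>e b * x\<^sub>b ^ p\<close> over
  \<open>b \<noteq> i0\<close>.\<close>

definition e :: "'v \<Rightarrow> 'f" where "e b = (if b = i0 then 1 else - \<phi> b / \<phi> i0)"

definition \<xi> :: "'v \<Rightarrow> 'f npoly" where
  "\<xi> b = (if b = i0 then \<Sum>b\<in>B - {i0}. single (single (h b) 1) (e b) else single (single (h b) 1) 1)"

text \<open>The p-th power map of the coordinate ring, with \<open>x\<^sub>b ^ p\<close> renamed as
  a fresh variable for \<open>b \<noteq> i0\<close> and the p-th power of the eliminated variable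
  rewritten by the equation.\<close>

definition \<theta> :: "('v, 'f) mpoly \<Rightarrow> 'f npoly" where "\<theta> = eval_mpoly (\<lambda>c. single 0 (c ^ p)) \<xi>"

text \<open>This undoes the renaming, so that \<rho> after \<theta> is the p-th power map modulo the
  form.\<close>

definition \<rho> :: "'f npoly \<Rightarrow> ('v, 'f) mpoly" where
  "\<rho> = eval_mpoly (single 0) (\<lambda>n. x (inv_into B h n) ^ p)"

interpretation frob: coeff_hom "\<lambda>c::'f. single 0 (c ^ p) :: 'f npoly"
  by standard (use p_gt_0 in \<open>auto simp: frob_add single_add mult_single power_mult_distrib power_0_left\<close>)

interpretation const: coeff_hom "\<lambda>c::'f. single 0 c :: ('v, 'f) mpoly"
  by standard (auto simp: single_add mult_single)

lemma theta: "\<theta> 0 = 0" "\<theta> 1 = 1" "\<theta> (f + g) = \<theta> f + \<theta> g" "\<theta> (f - g) = \<theta> f - \<theta> g"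
  "\<theta> (f * g) = \<theta> f * \<theta> g"
  "\<theta> (sum u J) = (\<Sum>j\<in>J. \<theta> (u j))" "\<theta> (f ^ n) = \<theta> f ^ n"
  unfolding \<theta>_def
  by (simp_all add: frob.eval_mpoly_add frob.eval_mpoly_mult frob.eval_mpoly_diff frob.eval_mpoly_sum frob.eval_mpoly_power)

lemma theta_const: "\<theta> (const_poly c) = single 0 (c ^ p)"
  by (simp add: \<theta>_def const_poly_def frob.eval_mpoly_single)

lemma theta_x: "\<theta> (x b) = \<xi> b"
  by (simp add: \<theta>_def x_def frob.eval_mpoly_single eval_monomial_single)

text \<open>The p-th root of the equation: \<theta> sends the form to the p-th power of this
  sum.\<close>

lemma xi_relation: "(\<Sum>b\<in>B. single 0 (\<phi> b) * \<xi> b) = 0"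
proof -
  have "(\<Sum>b\<in>B. single 0 (\<phi> b) * \<xi> b) =
      single 0 (\<phi> i0) * \<xi> i0 + (\<Sum>b\<in>B - {i0}. single 0 (\<phi> b) * \<xi> b)"
    using B by (simp add: sum.remove)
  also have "single 0 (\<phi> i0) * \<xi> i0 = (\<Sum>b\<in>B - {i0}. - (single 0 (\<phi> b) * \<xi> b))"
    unfolding \<xi>_def using phi
    by (auto simp: sum_distrib_left mult_single e_def single_uminus intro!: sum.cong)
  finally show ?thesis by (simp add: sum_negf)
qed

lemma theta_form: "\<theta> (form_poly p B \<phi>) = 0"
proof -
  have "\<theta> (form_poly p B \<phi>) = (\<Sum>b\<in>B. \<theta> (const_poly (\<phi> b) * x b ^ p))"
    by (simp add: form_poly_def theta(6) const_poly_def x_power mult_single)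
  also have "\<dots> = (\<Sum>b\<in>B. (single 0 (\<phi> b) * \<xi> b) ^ p)"
  proof (intro sum.cong refl)
    fix b
    have "(single 0 c :: 'f npoly) ^ n = single 0 (c ^ n)" for c n
      by (induction n) (auto simp: mult_single)
    then show "\<theta> (const_poly (\<phi> b) * x b ^ p) = (single 0 (\<phi> b) * \<xi> b) ^ p"
      by (simp add: theta theta_const theta_x power_mult_distrib)
  qed
  also have "\<dots> = (\<Sum>b\<in>B. single 0 (\<phi> b) * \<xi> b) ^ p"
    by (rule sum_power_char[OF p p_npoly, symmetric])
  also have "\<dots> = 0" using xi_relation p_gt_0 by (simp add: power_0_left)
  finally show ?thesis .
qed

lemma theta_I: assumes "f \<in> I" shows "\<theta> f = 0"
proof -
  have "I = PIdl\<^bsub>P\<^esub> (form_poly p B \<phi>)"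
    unfolding form_ideal_def using P.cgenideal_eq_genideal[OF form_poly_carrier] by simp
  then have "f \<in> PIdl\<^bsub>P\<^esub> (form_poly p B \<phi>)" using assms by blast
  then obtain g where "f = g * form_poly p B \<phi>" unfolding cgenideal_def by auto
  then show ?thesis by (simp only: theta theta_form mult_zero_right)
qed

lemma rho: "\<rho> 0 = 0" "\<rho> (f + g) = \<rho> f + \<rho> g" "\<rho> (f * g) = \<rho> f * \<rho> g" "\<rho> (sum u J) = (\<Sum>j\<in>J. \<rho> (u j))"
  unfolding \<rho>_def by (simp_all add: const.eval_mpoly_add const.eval_mpoly_mult const.eval_mpoly_sum)

lemma I_sum: "(\<And>j. j \<in> J \<Longrightarrow> f j \<in> I) \<Longrightarrow> sum f J \<in> I"
  using I.zero_closed I.a_closed by (induction J rule: infinite_finite_induct) auto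

lemma I_add: "f \<in> I \<Longrightarrow> g \<in> I \<Longrightarrow> f + g \<in> I" using I.a_closed by simp
lemma I_mult: "f \<in> carrier P \<Longrightarrow> g \<in> I \<Longrightarrow> f * g \<in> I" using I.I_l_closed by simp
lemma I_carrier: "f \<in> I \<Longrightarrow> f \<in> carrier P" using I.a_subset by blast

text \<open>The kernel of \<open>\<theta>\<close> is nilpotent modulo the form: \<open>f ^ p\<close> is obtained from \<open>\<theta> f\<close> by
  substituting \<open>x\<^sub>b ^ p\<close> for the variables, up to a multiple of the form.\<close>

lemma power_p_rho_theta:
  assumes "f \<in> carrier P"
  shows "f ^ p - \<rho> (\<theta> f) \<in> I"
proof -
  define J where "J = {f \<in> carrier P. f ^ p - \<rho> (\<theta> f) \<in> I}"
  have J_mult: "f * g \<in> J" if "f \<in> J" "g \<in> J" for f g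
  proof -
    have fg: "f \<in> carrier P" "g \<in> carrier P" "f ^ p - \<rho> (\<theta> f) \<in> I" "g ^ p - \<rho> (\<theta> g) \<in> I"
      using that by (auto simp: J_def)
    have "\<rho> (\<theta> g) = g ^ p + - (g ^ p - \<rho> (\<theta> g))" by simp
    moreover have "g ^ p + - (g ^ p - \<rho> (\<theta> g)) \<in> carrier P"
      by (intro poly_ring_add poly_ring_uminus poly_ring_power I_carrier fg)
    ultimately have rg: "\<rho> (\<theta> g) \<in> carrier P" by (simp only:)
    have "(f * g) ^ p - \<rho> (\<theta> (f * g)) = f ^ p * (g ^ p - \<rho> (\<theta> g)) + \<rho> (\<theta> g) * (f ^ p - \<rho> (\<theta> f))"
      by (simp add: theta rho power_mult_distrib algebra_simps)
    moreover have "\<dots> \<in> I" by (intro I_add I_mult poly_ring_power fg rg)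
    ultimately have "(f * g) ^ p - \<rho> (\<theta> (f * g)) \<in> I" by (simp only:)
    then show ?thesis using poly_ring_mult[OF fg(1,2)] unfolding J_def by blast
  qed
  have J_const: "const_poly c \<in> J" for c
  proof -
    have "\<rho> (single 0 (c ^ p)) = single 0 (c ^ p)" by (simp add: \<rho>_def const.eval_mpoly_single)
    moreover have "(single 0 c :: ('v, 'f) mpoly) ^ n = single 0 (c ^ n)" for n
      by (induction n) (auto simp: mult_single)
    ultimately show ?thesis
      using const_homog[of c] I.zero_closed theta_const[of c]
      by (simp add: J_def homog_polys_iff const_poly_def)
  qed
  have J_x: "x b \<in> J" if b: "b \<in> B" for b
  proof -
    have rX: "\<rho> (single (single (h b) 1) c) = single (single b p) c" if "b \<in> B" for b c
      using that B by (simp add: \<rho>_def const.eval_mpoly_single eval_monomial_single x_power mult_single)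
    have "x b ^ p - \<rho> (\<xi> b) \<in> I"
    proof (cases "b = i0")
      case False
      then show ?thesis using rX[OF b, of 1] I.zero_closed by (simp add: \<xi>_def x_power)
    next
      case True
      have "\<rho> (\<xi> b) = (\<Sum>b\<in>B - {i0}. single (single b p) (e b))"
        using True rX by (simp add: \<xi>_def rho)
      also have "\<dots> = - (const_poly (inverse (\<phi> i0)) * (\<Sum>b\<in>B - {i0}. single (single b p) (\<phi> b)))"
        unfolding sum_distrib_left sum_negf[symmetric]
        by (intro sum.cong) (auto simp: const_poly_def mult_single e_def divide_inverse mult.commute simp flip: single_uminus)
      \<comment> \<open>For the eliminated variable the difference is the form divided by
        \<open>\<phi> i0\<close>; for the other variables it is zero.\<close>
      finally have "x b ^ p - \<rho> (\<xi> b) = const_poly (inverse (\<phi> i0)) *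
          (single (single i0 p) (\<phi> i0) + (\<Sum>b\<in>B - {i0}. single (single b p) (\<phi> b)))"
        using True phi by (simp add: const_poly_def x_power mult_single distrib_left)
      also have "single (single i0 p) (\<phi> i0) + (\<Sum>b\<in>B - {i0}. single (single b p) (\<phi> b)) = form_poly p B \<phi>"
        unfolding form_poly_def using B by (simp add: sum.remove)
      finally show ?thesis
        using I_mult[OF _ form_poly_I] const_homog[of "inverse (\<phi> i0)"] by (simp add: homog_polys_iff)
    qed
    then show ?thesis using x_homog[OF b] by (simp add: J_def homog_polys_iff theta_x)
  qed
  have "(1 :: ('v, 'f) mpoly) \<in> J" using J_const[of 1] by (simp add: const_poly_def)
  then have J_single: "single m c \<in> J" if "keys m \<subseteq> B" for m c
    unfolding single_eq_mon using that by (intro J_mult J_const eval_monomial_in J_x) auto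
  have "f ^ p = (\<Sum>m\<in>keys f. single m (lookup f m) ^ p)"
    using sum_power_char[OF p p_npoly, of "\<lambda>m. single m (lookup f m)" "keys f"]
    by (simp add: sum_single_lookup)
  moreover have "\<rho> (\<theta> f) = (\<Sum>m\<in>keys f. \<rho> (\<theta> (single m (lookup f m))))"
    by (subst (1) sum_single_lookup[of f, symmetric]) (simp only: theta rho)
  ultimately have "f ^ p - \<rho> (\<theta> f) = (\<Sum>m\<in>keys f. single m (lookup f m) ^ p - \<rho> (\<theta> (single m (lookup f m))))"
    by (simp add: sum_subtractf)
  also have "\<dots> \<in> I"
    using J_single assms by (intro I_sum) (auto simp: J_def poly_ring_carrier)
  finally show ?thesis .
qed

lemma theta_eq_0: "f \<in> carrier P \<Longrightarrow> \<theta> f = 0 \<Longrightarrow> f ^ p \<in> I"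
  using power_p_rho_theta[of f] by (simp add: rho)

lemma homogeneous_xi: "homogeneous 1 (\<xi> b)"
  unfolding \<xi>_def by (auto intro!: homogeneous_sum homogeneous_single)

lemma homogeneous_theta: assumes "homogeneous d f" shows "homogeneous d (\<theta> f)"
  unfolding \<theta>_def eval_mpoly_def
proof (rule homogeneous_sum)
  fix m assume "m \<in> keys f"
  then have "total_degree m = d" using assms by (simp add: homogeneous_def)
  moreover have "homogeneous 0 (single 0 (lookup f m ^ p) :: 'f npoly)" by (rule homogeneous_single) simp
  ultimately show "homogeneous d (single 0 (lookup f m ^ p) * eval_monomial \<xi> m)"
    using homogeneous_mult[OF _ homogeneous_mon[OF homogeneous_xi, of m]] by fastforce
qed

lemma theta_homogeneous_part: assumes "\<theta> f = 0" "d \<in> total_degree ` keys f" shows "\<theta> (homogeneous_part d f) = 0"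
proof (rule homogeneous_sum_eq_0[of "total_degree ` keys f" "\<lambda>d. \<theta> (homogeneous_part d f)"])
  show "(\<Sum>d\<in>total_degree ` keys f. \<theta> (homogeneous_part d f)) = 0"
    by (simp only: theta(6)[symmetric] sum_homogeneous_part assms(1))
qed (use assms in \<open>auto intro: homogeneous_theta homogeneous_homogeneous_part\<close>)

definition \<Theta> :: "('v, 'f) mpoly set \<Rightarrow> 'f npoly fract" where
  "\<Theta> C = to_fract (\<theta> (SOME f. f \<in> carrier P \<and> C = coset f))"

lemma Theta_cs: assumes "f \<in> carrier P" shows "\<Theta> (coset f) = to_fract (\<theta> f)"
proof -
  let ?g = "SOME g. g \<in> carrier P \<and> coset f = coset g"
  have "?g \<in> carrier P \<and> coset f = coset ?g" by (rule someI[of _ f]) (use assms in auto)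
  then have "\<theta> (f - ?g) = 0" using coset_eqD[OF assms] theta_I by blast
  then show ?thesis unfolding \<Theta>_def by (simp add: theta)
qed

lemma Theta_one: "\<Theta> \<one>\<^bsub>S\<^esub> = 1"
  using Theta_cs[OF poly_ring_1] by (simp add: coset_1 theta)

lemma Theta_add:
  assumes "a \<in> carrier S" "b \<in> carrier S" shows "\<Theta> (a \<oplus>\<^bsub>S\<^esub> b) = \<Theta> a + \<Theta> b"
proof -
  obtain f g where fg: "f \<in> carrier P" "a = coset f" "g \<in> carrier P" "b = coset g"
    using assms by (meson S_carrierE)
  then show ?thesis using Theta_cs[OF poly_ring_add[OF fg(1,3)]] by (simp add: coset_add Theta_cs theta)
qed

lemma Theta_mult:
  assumes "a \<in> carrier S" "b \<in> carrier S" shows "\<Theta> (a \<otimes>\<^bsub>S\<^esub> b) = \<Theta> a * \<Theta> b"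
proof -
  obtain f g where fg: "f \<in> carrier P" "a = coset f" "g \<in> carrier P" "b = coset g"
    using assms by (meson S_carrierE)
  then show ?thesis using Theta_cs[OF poly_ring_mult[OF fg(1,3)]] by (simp add: coset_mult Theta_cs theta)
qed

definition "\<eta>0 = {a \<in> carrier S. \<Theta> a = 0}"

lemma eta0_ideal: "ideal \<eta>0 S"
proof -
  have "\<Theta> \<in> ring_hom S field_ring"
    by (rule ring_hom_memI) (auto simp: Theta_add Theta_mult Theta_one field_ring_sel)
  then interpret T: ring_hom_ring S "field_ring :: 'f npoly fract ring" \<Theta>
    by (intro ring_hom_ringI2 S.ring_axioms FR.ring_axioms)
  have "\<eta>0 = a_kernel S field_ring \<Theta>"
    unfolding \<eta>0_def a_kernel_def' field_ring_sel ..
  then show ?thesis using T.kernel_is_ideal by simp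
qed

lemma eta0_prime: "primeideal \<eta>0 S"
proof (rule primeidealI[OF eta0_ideal])
  show "cring S" by (rule S.is_cring)
  show "carrier S \<noteq> \<eta>0" 
    using Theta_one S.one_closed unfolding \<eta>0_def by (metis (mono_tags, lifting) mem_Collect_eq zero_neq_one)
  show "a \<in> \<eta>0 \<or> b \<in> \<eta>0" if "a \<in> carrier S" "b \<in> carrier S" "a \<otimes>\<^bsub>S\<^esub> b \<in> \<eta>0" for a b
    using that Theta_mult[OF that(1,2)] unfolding \<eta>0_def by simp
qed

text \<open>The kernel is a homogeneous ideal because \<theta> preserves degrees, all
  \<open>\<xi> b\<close> being linear forms: the homogeneous parts of an element of the kernel are
  again in the kernel.\<close>

lemma eta0_point: "\<eta>0 \<in> proj_points S Gr"
proof -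
  interpret graded_cring S Gr by (rule graded)
  let ?G = "genideal S (\<eta>0 \<inter> homog Gr)"
  have sub: "\<eta>0 \<inter> homog Gr \<subseteq> carrier S" unfolding \<eta>0_def by blast
  interpret G: ideal ?G S by (rule S.genideal_ideal[OF sub])
  have "\<eta>0 \<subseteq> ?G"
  proof
    fix C assume "C \<in> \<eta>0"
    then have C: "C \<in> carrier S" "\<Theta> C = 0" unfolding \<eta>0_def by blast+
    obtain f where f: "f \<in> carrier P" "C = coset f" using C(1) by (rule S_carrierE)
    then have "\<theta> f = 0" using C(2) Theta_cs by simp
    note f = f this
    have hp: "coset (homogeneous_part d f) \<in> ?G" if "d \<in> total_degree ` keys f" for d
    proof -
      have "homogeneous_part d f \<in> homog_polys B d" using homogeneous_part_homog[OF f(1)] .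
      then have "coset (homogeneous_part d f) \<in> Gr d" "homogeneous_part d f \<in> carrier P"
        by (rule imageI, simp only: homog_polys_iff)
      moreover from this(1) have "coset (homogeneous_part d f) \<in> homog Gr" by (rule Gr_homog)
      moreover from calculation(2) have "\<Theta> (coset (homogeneous_part d f)) = 0"
        by (simp only: Theta_cs theta_homogeneous_part[OF f(3) that] to_fract_0)
      moreover from calculation(2) have "coset (homogeneous_part d f) \<in> carrier S" by (rule coset_carrier)
      ultimately have "coset (homogeneous_part d f) \<in> \<eta>0 \<inter> homog Gr" unfolding \<eta>0_def by blast
      then show ?thesis using S.genideal_self[OF sub] by blast
    qed
    have "coset (\<Sum>d\<in>L. homogeneous_part d f) \<in> ?G" if "L \<subseteq> total_degree ` keys f" for L
      using that
    proof (induction L rule: infinite_finite_induct)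
      case (insert d L)
      have "homogeneous_part k f \<in> carrier P" for k using homogeneous_part_homog[OF f(1), of k] by (simp add: homog_polys_iff)
      then have "coset (\<Sum>d\<in>insert d L. homogeneous_part d f) = coset (homogeneous_part d f) \<oplus>\<^bsub>S\<^esub> coset (\<Sum>d\<in>L. homogeneous_part d f)"
        using insert by (simp add: coset_add poly_ring_sum)
      then show ?case using insert hp by (simp add: G.a_closed)
    qed (use G.zero_closed in \<open>auto simp: coset_0\<close>)
    from this[of "total_degree ` keys f"] show "C \<in> ?G" by (simp add: sum_homogeneous_part f)
  qed
  moreover have "?G \<subseteq> \<eta>0" by (rule S.genideal_minimal[OF eta0_ideal]) blast
  moreover have "\<not> (\<Union>d\<in>{0<..}. Gr d) \<subseteq> \<eta>0"
  proof -
    \<comment> \<open>A variable that is not eliminated maps to a transcendental, so the irrelevant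
      ideal is not contained in the kernel.\<close>
    obtain b where b: "b \<in> B" "b \<noteq> i0" using B2 by blast
    have "\<Theta> (coset (x b)) \<noteq> 0"
      using x_homog[OF b(1)] b(2) by (simp add: Theta_cs homog_polys_iff theta_x \<xi>_def)
        (metis lookup_single_eq lookup_zero zero_neq_one)
    then have "coset (x b) \<notin> \<eta>0" unfolding \<eta>0_def by blast
    moreover have "coset (x b) \<in> Gr 1" using x_homog[OF b(1)] by (rule imageI)
    then have "coset (x b) \<in> (\<Union>d\<in>{0<..}. Gr d)" by (intro UN_I[of 1]) simp_all
    ultimately show ?thesis by (meson subsetD)
  qed
  ultimately show ?thesis unfolding proj_points_def using eta0_prime by blast
qed

lemma specialization: "graded_specialization S Gr \<Theta>"
proof -
  interpret graded_cring S Gr by (rule graded)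
  show ?thesis
  proof unfold_locales
    fix a assume a: "a \<in> carrier S" "\<Theta> a = 0"
    obtain f where f: "f \<in> carrier P" "a = coset f" using a(1) by (rule S_carrierE)
    then have "\<theta> f = 0" using a(2) Theta_cs by simp
    with f show "\<exists>n::nat. a [^]\<^bsub>S\<^esub> n = \<zero>\<^bsub>S\<^esub>"
      by (intro exI[of _ p]) (simp add: coset_pow coset_eq_0 theta_eq_0)
  qed (use eta0_point in \<open>auto simp: Theta_add Theta_mult Theta_one \<eta>0_def\<close>)
qed

text \<open>Constants become p-th powers, and the variables become the \<open>X n\<close> and
  \<alpha>; all of these lie in \<open>k\<close>.\<close>

lemma Theta_in_subfield:
  assumes k: "is_subfield k" "\<And>c. fract_const (c ^ p) \<in> k" "\<And>n. X n \<in> k"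
    "(\<Sum>b\<in>B - {i0}. fract_const (e b) * X (h b)) \<in> k" and C: "C \<in> carrier S"
  shows "\<Theta> C \<in> k"
proof -
  obtain f where f: "f \<in> carrier P" "C = coset f" using C by (rule S_carrierE)
  let ?T = "{g. to_fract g \<in> k}"
  have xi: "\<xi> b \<in> ?T" for b
  proof (cases "b = i0")
    case True
    have "to_fract (\<xi> b) = (\<Sum>b\<in>B - {i0}. fract_const (e b) * X (h b))"
      using True by (simp add: \<xi>_def fract_const_def X_def mult_single flip: to_fract_mult)
    then show ?thesis using k(4) by simp
  next
    case False then show ?thesis using k(3)[of "h b"] by (simp add: \<xi>_def X_def)
  qed
  have m: "eval_monomial \<xi> m \<in> ?T" for m
    by (rule eval_monomial_in) (use k(1) xi in \<open>auto simp: is_subfield_one is_subfield_mult\<close>)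
  have "to_fract (\<theta> f) = (\<Sum>m\<in>keys f. fract_const (lookup f m ^ p) * to_fract (eval_monomial \<xi> m))"
    by (simp add: \<theta>_def eval_mpoly_def fract_const_def)
  also have "\<dots> \<in> k" using m k(2) by (intro is_subfield_sum[OF k(1)] is_subfield_mult[OF k(1)]) auto
  finally show ?thesis using f by (simp add: Theta_cs)
qed

end

text \<open>The sum \<open>\<Sum> c\<^sub>b ^ p * \<phi>(b)\<close> is the value of the form at the
  vector with coordinates \<open>c\<close>.\<close>

lemma (in char_p) frob_indep_anisotropic:
  assumes V: "finite_dimensional_vector_space scale BV"
    and q: "quasilinear_form p scale \<phi>" and an: "anisotropic \<phi>"
  shows "frob_indep (\<phi> :: 'v::ab_group_add \<Rightarrow> 'f) BV"
  unfolding frob_indep_def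
proof (intro allI impI)
  interpret V: finite_dimensional_vector_space scale BV by (rule V)
  have add: "\<phi> (v + w) = \<phi> v + \<phi> w" and sc: "\<phi> (scale c v) = c ^ p * \<phi> v" for c v w
    using q unfolding quasilinear_form_def by auto
  have zero: "\<phi> 0 = 0" using sc[of 0 0] p_gt_0 by (simp add: power_0_left)
  fix c assume c: "(\<Sum>b\<in>BV. c b ^ p * \<phi> b) = 0"
  have "\<phi> (\<Sum>b\<in>L. scale (c b) b) = (\<Sum>b\<in>L. c b ^ p * \<phi> b)" for L
    by (induction L rule: infinite_finite_induct) (auto simp: zero add sc)
  then have "\<phi> (\<Sum>b\<in>BV. scale (c b) b) = 0" using c by simp
  then have "(\<Sum>b\<in>BV. scale (c b) b) = 0" using an unfolding isotropic_def by blast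
  then show "\<forall>b\<in>BV. c b = 0"
    using V.independentD[OF V.independent_Basis V.finite_Basis subset_refl] by blast
qed

lemma (in char_p) fract_const_hom: "fract_const (c ^ p) = fract_const c ^ p"
proof -
  have "(single 0 c :: 'f npoly) ^ n = single 0 (c ^ n)" for n
    by (induction n) (auto simp: mult_single)
  moreover have "to_fract (f ^ n) = to_fract f ^ n" for f :: "'f npoly" and n
    by (induction n) auto
  ultimately show ?thesis unfolding fract_const_def by metis
qed

text \<open>Up to the factor \<open>\<phi> i0\<close>, the families differ only by signs away from
  \<open>i0\<close>, which are absorbed by \<open>(- c) ^ p = - (c ^ p)\<close>.\<close>

lemma (in generic_hypersurface) frob_indep_e:
  assumes "frob_indep \<phi> B"
  shows "frob_indep e B"
  unfolding frob_indep_def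
proof (intro allI impI)
  fix c assume c: "(\<Sum>b\<in>B. c b ^ p * e b) = 0"
  define c' where "c' b = (if b = i0 then c b else - c b)" for b
  have "c' b ^ p * \<phi> b = \<phi> i0 * (c b ^ p * e b)" for b
    using phi uminus_power_char[OF p p_0, of "c b"] by (auto simp: c'_def e_def)
  then have "(\<Sum>b\<in>B. c' b ^ p * \<phi> b) = 0" using c by (simp flip: sum_distrib_left)
  then have "\<forall>b\<in>B. c' b = 0" using assms unfolding frob_indep_def by blast
  then show "\<forall>b\<in>B. c b = 0" by (auto simp: c'_def split: if_splits)
qed

theorem theorem6p10:
  fixes scaleV :: "'f::field \<Rightarrow> 'v::ab_group_add \<Rightarrow> 'v" and BV :: "'v set" and \<phi> :: "'v \<Rightarrow> 'f"
    and scaleW :: "'f \<Rightarrow> 'w::ab_group_add \<Rightarrow> 'w" and BW :: "'w set" and \<psi> :: "'w \<Rightarrow> 'f"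
    and p dX dY :: nat
  assumes "prime p" and "CHAR('f) = p" and "\<not> surj (\<lambda>x::'f. x ^ p)"
    and "finite_dimensional_vector_space scaleV BV"
    and "vector_space.dim scaleV UNIV = dX + 2"
    and "quasilinear_form p scaleV \<phi>" and "anisotropic \<phi>"
    and "finite_dimensional_vector_space scaleW BW"
    and "vector_space.dim scaleW UNIV = dY + 2"
    and "quasilinear_form p scaleW \<psi>" and "anisotropic \<psi>"
    and "\<exists>n\<ge>1. int dY \<le> int p ^ n - 2 \<and> int p ^ n - 2 < int dX"
  shows "rational_morphisms (quasilinear_hypersurface p BV \<phi>)
           (quasilinear_hypersurface p BW \<psi>) = {}"
proof (rule ccontr)
  assume ne: "\<not> ?thesis"
  interpret char_p p "TYPE('f)"
    using assms(1,2) by unfold_locales (auto simp flip: of_nat_CHAR)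
  interpret V: finite_dimensional_vector_space scaleV BV by fact
  interpret W: finite_dimensional_vector_space scaleW BW by fact
  obtain n where "int dY \<le> int p ^ n - 2" "int p ^ n - 2 < int dX" using assms(12) by blast
  \<comment> \<open>Passing from dimensions to numbers of variables adds \<open>2\<close>, which
    cancels the \<open>- 2\<close> in the bounds.\<close>
  then have "int (dY + 2) \<le> int (p ^ n)" "int (p ^ n) < int (dX + 2)" by simp_all
  moreover have cV: "card BV = dX + 2" using assms(5) V.dim_UNIV by simp
  moreover have "card BW = dY + 2" using assms(9) W.dim_UNIV by simp
  ultimately have card: "card BW \<le> p ^ n" "p ^ n < card BV" by linarith+
  have indV: "frob_indep \<phi> BV" by (rule frob_indep_anisotropic) fact+
  have indW: "frob_indep \<psi> BW" by (rule frob_indep_anisotropic) fact+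
  obtain i0 where i0: "i0 \<in> BV" using cV by fastforce
  have "BV - {i0} \<noteq> {}"
  proof
    assume "BV - {i0} = {}"
    then have "BV \<subseteq> {i0}" by blast
    then have "card BV \<le> 1" using card_mono[of "{i0}" BV] by simp
    then show False using cV by simp
  qed
  obtain h :: "'v \<Rightarrow> nat" where h: "inj_on h BV"
    using finite_imp_inj_to_nat_seg[OF V.finite_Basis] by blast
  have "i0 \<noteq> 0" using i0 V.independent_Basis V.dependent_zero by blast
  then have "\<phi> i0 \<noteq> 0" using assms(7) unfolding isotropic_def by blast
  interpret X: generic_hypersurface p BV \<phi> "TYPE('f)" i0 h
    by unfold_locales (use V.finite_Basis i0 h \<open>\<phi> i0 \<noteq> 0\<close> \<open>BV - {i0} \<noteq> {}\<close> in auto)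
  interpret Y: coordinate_ring p BW \<psi> .
  have ins: "insert i0 (BV - {i0}) = BV" using i0 by blast
  obtain k1 where k1: "is_subfield k1" "\<And>c. fract_const (c ^ p) \<in> k1" "\<And>n. X n \<in> k1"
    "(\<Sum>b\<in>BV - {i0}. fract_const (X.e b) * X (h b)) \<in> k1" "lin_indep k1 (\<lambda>b. fract_const (\<psi> b)) BW"
  proof (rule indep_generic[of "BV - {i0}" i0 h X.e BW \<psi> n])
    show "frob_indep X.e (insert i0 (BV - {i0}))" unfolding ins by (rule X.frob_indep_e[OF indV])
    show "p ^ n < card (insert i0 (BV - {i0}))" unfolding ins by (rule card(2))
    show "inj_on h (BV - {i0})" using h by (rule inj_on_subset) blast
    show "X.e i0 = 1" by (simp add: X.e_def)
  qed (use V.finite_Basis W.finite_Basis \<open>BV - {i0} \<noteq> {}\<close> indW card in auto)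
  have ne': "rational_morphisms (Proj X.S X.Gr (\<lambda>c. X.coset (const_poly c)))
      (Proj Y.S Y.Gr (\<lambda>c. Y.coset (const_poly c))) \<noteq> {}"
    using ne unfolding X.hypersurface_eq Y.hypersurface_eq .
  have xY: "Y.coset (Y.x b) \<in> Y.Gr 1" if "b \<in> BW" for b using Y.x_homog[OF that] by (rule imageI)
  have cX: "X.coset (const_poly c) \<in> X.Gr 0" for c using X.const_homog by (rule imageI)
  have cY: "Y.coset (const_poly c) \<in> Y.Gr 0" for c using Y.const_homog by (rule imageI)
  note point = rational_morphism_point[OF X.specialization Y.graded xY Y.some_variable_notin cX cY ne']
  show False
  proof (rule point)
    fix b H
    assume b: "b \<in> BW" "H 1 (Y.coset (Y.x b)) = 1"
      and add: "\<And>d f g. f \<in> Y.Gr d \<Longrightarrow> g \<in> Y.Gr d \<Longrightarrow> H d (f \<oplus>\<^bsub>Y.S\<^esub> g) = H d f + H d g"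
      and mult: "\<And>d e f g. f \<in> Y.Gr d \<Longrightarrow> g \<in> Y.Gr e \<Longrightarrow> H (d + e) (f \<otimes>\<^bsub>Y.S\<^esub> g) = H d f * H e g"
      and const: "\<And>c. H 0 (Y.coset (const_poly c)) = X.\<Theta> (X.coset (const_poly c))"
      and frac: "\<And>d f. f \<in> Y.Gr d \<Longrightarrow> \<exists>a\<in>carrier X.S. \<exists>b\<in>carrier X.S. H d f = X.\<Theta> a / X.\<Theta> b"
    have const: "H 0 (Y.coset (const_poly c)) = fract_const c ^ p" for c
      using const X.Theta_cs[of "const_poly c"] X.const_homog[of c]
      by (simp add: homog_polys_iff X.theta_const fract_const_hom[symmetric]) (simp add: fract_const_def)
    define z where "z b = H 1 (Y.coset (Y.x b))" for b
    \<comment> \<open>The constants of \<open>Y\<close> arrive as p-th powers, so the equation of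
      \<open>Y\<close> at the image point is the p-th power of a linear relation.\<close>
    have "(\<Sum>b\<in>BW. z b * fract_const (\<psi> b)) ^ p = (\<Sum>b\<in>BW. H 0 (Y.coset (const_poly (\<psi> b))) * z b ^ p)"
      by (subst sum_power_char[OF p p_fract]) (simp add: const power_mult_distrib mult.commute)
    also have "\<dots> = 0"
      unfolding z_def
      by (rule Y.form_relation[OF W.finite_Basis add mult]) (simp_all add: const fract_const_1)
    finally have "(\<Sum>b\<in>BW. z b * fract_const (\<psi> b)) = 0" by simp
    moreover have "z b \<in> k1" if bW: "b \<in> BW" for b
    proof -
      obtain a a' where "a \<in> carrier X.S" "a' \<in> carrier X.S" "z b = X.\<Theta> a / X.\<Theta> a'"
        using frac[OF xY[OF bW]] unfolding z_def by blast
      then show ?thesis using X.Theta_in_subfield[OF k1(1-4)] is_subfield_divide[OF k1(1)] by simp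
    qed
    \<comment> \<open>Independence over \<open>k1\<close> kills every coordinate, including the one
      normalised to \<open>1\<close>.\<close>
    ultimately have "z b = 0" using lin_indepD[OF k1(5)] b(1) by blast
    then show False using b(2) by (simp add: z_def)
  qed
qed

end
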